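(* Let $K$ be a real algebraic number field with ring of integers $\mathfrak{o}$, let $\mathbb{H}(K)$ be the standard quaternion algebra over $K$, and suppose that both $K$ and $\mathbb{H}(K)$ have class number $1$. Let $\mathcal{O}$ be a maximal order of $\mathbb{H}(K)$ and put $\Gamma := \operatorname{Im}(\mathcal{O})\subset\mathbb{R}^3$. Then the coincidence site modules (CSMs) of $\Gamma$ are in one-to-one correspondence with the one-sided (right) ideals $q\mathcal{O}$ that are generated by the $\mathcal{O}$-reduced elements $q\in\mathcal{O}$, the right ideal $q\mathcal{O}$ corresponding to the CSM $\Gamma\cap R_q\Gamma$. The corresponding coincidence indices are $[\Gamma:(\Gamma\cap R_q\Gamma)]=\mathrm{N}(|q|^2)$, so that these right ideals are to be counted according to the square root of their ideal index $[\mathcal{O}:q\mathcal{O}]=\mathrm{N}(|q|^4)$.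
   Context: A real algebraic number field is a subfield $K\subset\mathbb{R}$ of finite degree over $\mathbb{Q}$. $\mathbb{H}(K)=K+\mathrm{i}K+\mathrm{j}K+\mathrm{k}K$ with $\mathrm{i}^2=\mathrm{j}^2=\mathrm{k}^2=\mathrm{ijk}=-1$ and $K$ central. For $x=x_0+\mathrm{i}x_1+\mathrm{j}x_2+\mathrm{k}x_3$: $\bar x=x_0-\mathrm{i}x_1-\mathrm{j}x_2-\mathrm{k}x_3$, $|x|^2:=\operatorname{nr}(x)=x\bar x=\sum_i x_i^2\in K$, $|x|^4:=(|x|^2)^2$, and $\operatorname{Im}(x)=\frac12(x-\bar x)$, identified with the column vector $(x_1,x_2,x_3)^t\in K^3\subset\mathbb{R}^3$; for a set $S$, $\operatorname{Im}(S)=\{\operatorname{Im}(x)\mid x\in S\}$. For $0\ne q\in\mathbb{H}(K)$, $R_q\in\mathrm{SO}(3,K)$ is the rotation matrix of $v\mapsto qvq^{-1}$ on the pure quaternions $\mathrm{i}K\oplus\mathrm{j}K\oplus\mathrm{k}K\cong K^3$. An ideal in $\mathbb{H}(K)$ is a finitely generated $\mathfrak{o}$-module whose $K$-span is $\mathbb{H}(K)$; an order is an ideal that is also a ring containing $1$; a maximal order is one not contained in a larger order. A left ideal of an order $L$ is an ideal $I$ with $aI\subseteq I$ for all $a\in L$; right ideals are defined analogously. The class number of a maximal order is the number of equivalence classes of its left ideals under right multiplication by nonzero elements of $\mathbb{H}(K)$; it is the same for all maximal orders and is called the class number of $\mathbb{H}(K)$. For an order $L$ put $L^{\bullet}=L\setminus\{0\}$.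 An element $q\in L^\bullet$ is a unit of $L$ if $q^{-1}\in L$. An element $x\in L^\bullet$ is $L$-reduced if, whenever $x=aqb$ with $a,q,b\in L^\bullet$ and $qL=Lq$, then $q$ is a unit of $L$. Two $\mathbb{Z}$-modules in $\mathbb{R}^3$ are commensurate ($\sim$) if their intersection has finite index in both. $\mathrm{SOC}(\Gamma)=\{R\in\mathrm{SO}(3,\mathbb{R})\mid\Gamma\sim R\Gamma\}$. A CSM of $\Gamma$ is a module of the form $\Gamma\cap R\Gamma$ with $R\in\mathrm{SOC}(\Gamma)$; its coincidence index is the group index $[\Gamma:(\Gamma\cap R\Gamma)]$. $\mathrm{N}(\alpha)=\bigl|\prod_\sigma\sigma(\alpha)\bigr|$, with $\sigma$ running over the homomorphisms $K\to\mathbb{C}$, is the absolute norm from $K$ to $\mathbb{Q}$. *)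

theory Defs
  imports "HOL-Analysis.Analysis" "HOL-Computational_Algebra.Polynomial"
begin

datatype quat = Quat (q0: real) (q1: real) (q2: real) (q3: real)

lemma quat_eqI:
  "q0 x = q0 y \<Longrightarrow> q1 x = q1 y \<Longrightarrow> q2 x = q2 y \<Longrightarrow> q3 x = q3 y \<Longrightarrow> x = y"
  by (cases x; cases y) simp

lemma quat_eq_iff:
  "x = y \<longleftrightarrow> q0 x = q0 y \<and> q1 x = q1 y \<and> q2 x = q2 y \<and> q3 x = q3 y"
  using quat_eqI by auto

definition qnr :: "quat \<Rightarrow> real" where
  "qnr x = (q0 x)\<^sup>2 + (q1 x)\<^sup>2 + (q2 x)\<^sup>2 + (q3 x)\<^sup>2"

definition qcnj :: "quat \<Rightarrow> quat" where
  "qcnj x = Quat (q0 x) (- q1 x) (- q2 x) (- q3 x)"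

instantiation quat :: real_div_algebra
begin

definition "0 = Quat 0 0 0 0"
definition "1 = Quat 1 0 0 0"
definition "x + y = Quat (q0 x + q0 y) (q1 x + q1 y) (q2 x + q2 y) (q3 x + q3 y)"
definition "- x = Quat (- q0 x) (- q1 x) (- q2 x) (- q3 x)"
definition "x - (y::quat) = Quat (q0 x - q0 y) (q1 x - q1 y) (q2 x - q2 y) (q3 x - q3 y)"
definition "x * y = Quat
  (q0 x * q0 y - q1 x * q1 y - q2 x * q2 y - q3 x * q3 y)
  (q0 x * q1 y + q1 x * q0 y + q2 x * q3 y - q3 x * q2 y)
  (q0 x * q2 y - q1 x * q3 y + q2 x * q0 y + q3 x * q1 y)
  (q0 x * q3 y + q1 x * q2 y - q2 x * q1 y + q3 x * q0 y)"
definition "scaleR r x = Quat (r * q0 x) (r * q1 x) (r * q2 x) (r * q3 x)"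
definition "inverse x = (1 / qnr x) *\<^sub>R qcnj x"
definition "x div (y::quat) = x * inverse y"

lemmas quat_ops_def = zero_quat_def one_quat_def plus_quat_def uminus_quat_def
  minus_quat_def times_quat_def scaleR_quat_def

lemma qnr_pos: "x \<noteq> 0 \<Longrightarrow> qnr x > 0"
proof -
  assume "x \<noteq> 0"
  then have "q0 x \<noteq> 0 \<or> q1 x \<noteq> 0 \<or> q2 x \<noteq> 0 \<or> q3 x \<noteq> 0"
    by (auto simp: quat_eq_iff zero_quat_def)
  then show ?thesis
    unfolding qnr_def
    by (smt (verit) zero_le_power2 zero_less_power2)
qed

lemma mult_qcnj: "x * qcnj x = qnr x *\<^sub>R 1"
  and qcnj_mult: "qcnj x * x = qnr x *\<^sub>R 1"
  by (simp_all add: quat_ops_def qcnj_def qnr_def power2_eq_square)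

instance
proof
  fix x y z :: quat and r s :: real
  show "x * y * z = x * (y * z)"
    by (simp add: quat_ops_def algebra_simps)
  show "(x + y) * z = x * z + y * z" "x * (y + z) = x * y + x * z"
    by (simp_all add: quat_ops_def algebra_simps)
  show "r *\<^sub>R x * y = r *\<^sub>R (x * y)" "x * r *\<^sub>R y = r *\<^sub>R (x * y)"
    by (simp_all add: quat_ops_def algebra_simps)
  show "(0::quat) \<noteq> 1"
    by (simp add: quat_ops_def)
  have *: "a * b *\<^sub>R c = b *\<^sub>R (a * c)" "b *\<^sub>R a * c = b *\<^sub>R (a * c)" for a c :: quat and b
    by (simp_all add: quat_ops_def algebra_simps)
  have **: "(1 / n) *\<^sub>R n *\<^sub>R (1::quat) = 1" if "n \<noteq> 0" for n
    using that by (simp add: quat_ops_def)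
  show "inverse x * x = 1" "x * inverse x = 1" if "x \<noteq> 0"
    using qnr_pos[OF that]
    by (simp_all add: inverse_quat_def * mult_qcnj qcnj_mult **)
  show "inverse 0 = (0::quat)"
    by (simp add: inverse_quat_def quat_ops_def qcnj_def)
qed (simp_all add: quat_ops_def divide_quat_def algebra_simps)

end

definition quat_Im :: "quat \<Rightarrow> real^3" where
  "quat_Im x = vector [q1 x, q2 x, q3 x]"

definition quat_pure :: "real^3 \<Rightarrow> quat" where
  "quat_pure v = Quat 0 (v $ 1) (v $ 2) (v $ 3)"

lemma quat_pure_Im: "quat_pure (quat_Im x) = (1/2) *\<^sub>R (x - qcnj x)"
  by (simp add: quat_pure_def quat_Im_def quat_ops_def qcnj_def)

definition quat_rot :: "quat \<Rightarrow> real^3^3" where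
  "quat_rot q = matrix (\<lambda>v. quat_Im (q * quat_pure v * inverse q))"

lemma quat_rot_works: "quat_pure (quat_rot q *v v) = q * quat_pure v * inverse q"
proof -
  have "linear (\<lambda>v. quat_Im (q * quat_pure v * inverse q))"
    by (rule linearI)
      (simp_all add: quat_Im_def quat_pure_def quat_ops_def vec_eq_iff forall_3 algebra_simps)
  then have "quat_rot q *v v = quat_Im (q * quat_pure v * inverse q)"
    by (simp add: quat_rot_def matrix_works)
  moreover have "q0 (q * quat_pure v * inverse q) = 0"
    by (simp add: quat_pure_def inverse_quat_def qcnj_def quat_ops_def algebra_simps)
  ultimately show ?thesis
    by (simp add: quat_pure_def quat_Im_def quat_eq_iff)
qed

definition span_over :: "real set \<Rightarrow> 'a::real_vector set \<Rightarrow> 'a set" where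
  "span_over S B =
    {\<Sum>b\<in>T. c b *\<^sub>R b | T c. finite T \<and> T \<subseteq> B \<and> (\<forall>b\<in>T. c b \<in> S)}"

definition real_number_field :: "real set \<Rightarrow> bool" where
  "real_number_field K \<longleftrightarrow>
     1 \<in> K \<and> (\<forall>x\<in>K. \<forall>y\<in>K. x - y \<in> K \<and> x * y \<in> K) \<and> (\<forall>x\<in>K. inverse x \<in> K) \<and>
     (\<exists>B. finite B \<and> K = span_over \<rat> B)"

definition ring_of_integers :: "real set \<Rightarrow> real set" where
  "ring_of_integers K = {x \<in> K. algebraic_int x}"

(* Embeddings are only determined on K, hence extensional. *)
definition field_embeddings :: "real set \<Rightarrow> (real \<Rightarrow> complex) set" where
  "field_embeddings K = {\<sigma> \<in> extensional K. \<sigma> 1 = 1 \<and>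
     (\<forall>x\<in>K. \<forall>y\<in>K. \<sigma> (x + y) = \<sigma> x + \<sigma> y \<and> \<sigma> (x * y) = \<sigma> x * \<sigma> y)}"

definition abs_norm :: "real set \<Rightarrow> real \<Rightarrow> real" where
  "abs_norm K \<alpha> = cmod (\<Prod>\<sigma>\<in>field_embeddings K. \<sigma> \<alpha>)"

definition fractional_ideal :: "real set \<Rightarrow> real set \<Rightarrow> bool" where
  "fractional_ideal K A \<longleftrightarrow> A \<subseteq> K \<and> A \<noteq> {0} \<and>
     (\<exists>B. finite B \<and> A = span_over (ring_of_integers K) B)"

definition field_class_number :: "real set \<Rightarrow> nat" where
  "field_class_number K = card ({A. fractional_ideal K A} //
     {(A, B). fractional_ideal K A \<and> fractional_ideal K B \<and>
        (\<exists>x\<in>K - {0}. B = (*) x ` A)})"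

definition quat_alg :: "real set \<Rightarrow> quat set" where
  "quat_alg K = {x. q0 x \<in> K \<and> q1 x \<in> K \<and> q2 x \<in> K \<and> q3 x \<in> K}"

definition quat_ideal :: "real set \<Rightarrow> quat set \<Rightarrow> bool" where
  "quat_ideal K I \<longleftrightarrow>
     (\<exists>B. finite B \<and> I = span_over (ring_of_integers K) B) \<and> span_over K I = quat_alg K"

definition quat_order :: "real set \<Rightarrow> quat set \<Rightarrow> bool" where
  "quat_order K L \<longleftrightarrow> quat_ideal K L \<and> 1 \<in> L \<and> (\<forall>x\<in>L. \<forall>y\<in>L. x * y \<in> L)"

definition maximal_order :: "real set \<Rightarrow> quat set \<Rightarrow> bool" where
  "maximal_order K L \<longleftrightarrow> quat_order K L \<and> (\<forall>M. quat_order K M \<and> L \<subseteq> M \<longrightarrow> M = L)"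

definition left_ideal :: "real set \<Rightarrow> quat set \<Rightarrow> quat set \<Rightarrow> bool" where
  "left_ideal K L I \<longleftrightarrow> quat_ideal K I \<and> (\<forall>a\<in>L. (*) a ` I \<subseteq> I)"

definition order_class_number :: "real set \<Rightarrow> quat set \<Rightarrow> nat" where
  "order_class_number K L = card ({I. left_ideal K L I} //
     {(I, J). left_ideal K L I \<and> left_ideal K L J \<and>
        (\<exists>x\<in>quat_alg K - {0}. J = (\<lambda>y. y * x) ` I)})"

(* The class number of the algebra is the common value of the class numbers of its
   maximal orders (which does not depend on the order). *)
definition has_quat_class_number :: "real set \<Rightarrow> nat \<Rightarrow> bool" where
  "has_quat_class_number K h \<longleftrightarrow> (\<forall>L. maximal_order K L \<longrightarrow> order_class_number K L = h)"

definition order_unit :: "quat set \<Rightarrow> quat \<Rightarrow> bool" where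
  "order_unit L q \<longleftrightarrow> q \<in> L - {0} \<and> inverse q \<in> L"

definition order_reduced :: "quat set \<Rightarrow> quat \<Rightarrow> bool" where
  "order_reduced L x \<longleftrightarrow> x \<in> L - {0} \<and>
     (\<forall>a\<in>L - {0}. \<forall>q\<in>L - {0}. \<forall>b\<in>L - {0}.
        x = a * q * b \<and> (*) q ` L = (\<lambda>y. y * q) ` L \<longrightarrow> order_unit L q)"

definition add_cosets :: "'a::ab_group_add set \<Rightarrow> 'a set \<Rightarrow> 'a set set" where
  "add_cosets G H = (\<lambda>g. (+) g ` H) ` G"

(* As usual for card, the value is 0 when the index is infinite. *)
definition add_index :: "'a::ab_group_add set \<Rightarrow> 'a set \<Rightarrow> nat" where
  "add_index G H = card (add_cosets G H)"

definition commensurate :: "'a::ab_group_add set \<Rightarrow> 'a set \<Rightarrow> bool" where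
  "commensurate G H \<longleftrightarrow>
     finite (add_cosets G (G \<inter> H)) \<and> finite (add_cosets H (G \<inter> H))"

definition SOC :: "(real^3) set \<Rightarrow> (real^3^3) set" where
  "SOC \<Gamma> = {R. rotation_matrix R \<and> commensurate \<Gamma> ((*v) R ` \<Gamma>)}"

definition CSMs :: "(real^3) set \<Rightarrow> (real^3) set set" where
  "CSMs \<Gamma> = (\<lambda>R. \<Gamma> \<inter> (*v) R ` \<Gamma>) ` SOC \<Gamma>"

end

theory Submission
  imports Defs "Jordan_Normal_Form.Char_Poly" "HOL-Computational_Algebra.Field_as_Ring"
begin

text \<open>
  Write \<open>L\<close> for the maximal order, \<open>\<oo>\<close> for the integers of \<open>K\<close>, and let \<open>q \<in> L\<close> be nonzero. The proof
  avoids localization: every local statement about the order is replaced by an identity of indices.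

  \<^emph>\<open>From modules in space to ideals.\<close> The map \<open>Im\<close> has kernel \<open>K\<close>, so \<open>\<Gamma>\<close> is \<open>L/\<oo>\<close>, and \<open>R\<^sub>q \<Gamma>\<close> is the
  image of the conjugate order \<open>q L q\<^sup>-\<^sup>1\<close>. If \<open>x \<in> L\<close> and \<open>z \<in> q L q\<^sup>-\<^sup>1\<close> differ by a scalar \<open>c \<in> K\<close>, then traces
  and norms of \<open>x\<close> and \<open>z\<close> are integral, so \<open>c\<close> satisfies a monic quadratic equation over \<open>\<oo>\<close> and lies in
  \<open>\<oo>\<close>. Therefore \<open>\<Gamma> \<inter> R\<^sub>q \<Gamma>\<close> is the image of the idealizer \<open>S = {x \<in> L. x q \<in> q L}\<close> (csm_idealizer), and as
  \<open>\<oo> \<subseteq> S\<close>, nothing is lost by passing to the image.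

  \<^emph>\<open>Reduced elements.\<close> All one-sided ideals of \<open>L\<close> are principal. The two-sided ideal \<open>L q L\<close> is \<open>L t\<close>, and
  \<open>L t = t L\<close> because both have the same index. As \<open>t\<close> divides \<open>q\<close>, the element \<open>q\<close> is reduced iff
  \<open>L q L = L\<close> (order_reduced_iff). This condition does all the work. It gives
  \<open>q L = {x. x L \<subseteq> S}\<close>: from \<open>x L q \<subseteq> q L\<close> follows \<open>x L = x L q L \<subseteq> q L\<close>, so the right ideal can be
  recovered from the coincidence site module (right_ideal_from_idealizer). It also gives \<open>S = \<oo> + q L\<close>
  (idealizer_reduced), since some \<open>a\<close> satisfies \<open>a qcnj(q) + q qcnj(a) = 1\<close>; this needs that the trace
  maps \<open>L\<close> onto \<open>\<oo>\<close> (trace_one_exists).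

  \<^emph>\<open>Surjectivity.\<close> A coincidence rotation has entries in \<open>K\<close>, so it is \<open>R\<^sub>q\<close> for some \<open>q \<in> L\<close>
  (SOC_quat_rot). With \<open>L q L = L t\<close> and \<open>q = b t\<close>, the element \<open>b\<close> is reduced and defines the same
  conjugate order, because \<open>t L t\<^sup>-\<^sup>1 = L\<close> (reduced_factor).

  \<^emph>\<open>Indices.\<close> A principal ideal \<open>a \<oo>\<close> has index \<open>N(a)\<close> (index_principal). The index of \<open>q L\<close> in \<open>L\<close> is
  multiplicative in \<open>q\<close>. As \<open>q\<close> and its conjugate are conjugate in the algebra, they have the same index,
  and its square is the index \<open>N(|q|\<^sup>2)\<^sup>4\<close> of \<open>|q|\<^sup>2 L\<close>; so \<open>[L : q L] = N(|q|\<^sup>2)\<^sup>2\<close> (index_left_mult). Finally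
  \<open>\<oo> \<inter> q L = |q|\<^sup>2 \<oo>\<close> for reduced \<open>q\<close>, whence \<open>[S : q L] = N(|q|\<^sup>2)\<close>, and the tower law leaves
  \<open>[L : S] = N(|q|\<^sup>2)\<close> (index_idealizer).

  \<^emph>\<open>The norm as an index.\<close> For \<open>K = \<rat>(\<theta>)\<close> with integral \<open>\<theta>\<close> of minimal polynomial \<open>f\<close>, the quotient
  \<open>\<int>[\<theta>]/\<theta>\<int>[\<theta>]\<close> is \<open>\<int>/f(0)\<close>, and \<open>\<bar>f(0)\<bar>\<close> is the absolute norm of \<open>\<theta>\<close>. The order \<open>\<int>[\<theta>]\<close> has finite index in
  \<open>\<oo>\<close> because \<open>f'(\<theta>) \<oo> \<subseteq> \<int>[\<theta>]\<close>, and indices of multiplications depend only on the commensurability class.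
  A general element is a quotient of two generators of the field.
\<close>

section \<open>Indices of additive groups\<close>

definition add_subgroup :: "'a::ab_group_add set \<Rightarrow> bool" where
  "add_subgroup H \<longleftrightarrow> 0 \<in> H \<and> (\<forall>x\<in>H. \<forall>y\<in>H. x - y \<in> H)"

lemma add_subgroup_zero: "add_subgroup H \<Longrightarrow> 0 \<in> H"
  and add_subgroup_diff: "add_subgroup H \<Longrightarrow> x \<in> H \<Longrightarrow> y \<in> H \<Longrightarrow> x - y \<in> H"
  by (auto simp: add_subgroup_def)

lemma add_subgroup_minus: "add_subgroup H \<Longrightarrow> x \<in> H \<Longrightarrow> - x \<in> H"
  using add_subgroup_diff[of H 0 x] by (simp add: add_subgroup_def)

lemma add_subgroup_add: "add_subgroup H \<Longrightarrow> x \<in> H \<Longrightarrow> y \<in> H \<Longrightarrow> x + y \<in> H"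
  using add_subgroup_diff[of H x "- y"] add_subgroup_minus[of H y] by simp

lemma add_subgroup_sum: "add_subgroup H \<Longrightarrow> (\<And>i. i \<in> A \<Longrightarrow> f i \<in> H) \<Longrightarrow> sum f A \<in> H"
  by (induction A rule: infinite_finite_induct) (auto simp: add_subgroup_zero intro: add_subgroup_add)

lemma add_subgroup_image:
  assumes "Modules.additive f" "add_subgroup H"
  shows "add_subgroup (f ` H)"
proof -
  have "0 \<in> f ` H"
    using Modules.additive.zero[OF assms(1)] add_subgroup_zero[OF assms(2)] by (metis imageI)
  moreover have "f x - f y \<in> f ` H" if "x \<in> H" "y \<in> H" for x y
    using Modules.additive.diff[OF assms(1)] add_subgroup_diff[OF assms(2) that] by (metis imageI)
  ultimately show ?thesis
    by (auto simp: add_subgroup_def)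
qed

lemma add_subgroup_Int: "add_subgroup G \<Longrightarrow> add_subgroup H \<Longrightarrow> add_subgroup (G \<inter> H)"
  by (auto simp: add_subgroup_def)

lemma coset_eq_iff:
  assumes "add_subgroup H"
  shows "(+) x ` H = (+) y ` H \<longleftrightarrow> x - y \<in> H"
proof
  assume "(+) x ` H = (+) y ` H"
  then have "x + 0 \<in> (+) y ` H"
    using add_subgroup_zero[OF assms] by blast
  then obtain h where "h \<in> H" "x = y + h" by auto
  then show "x - y \<in> H" by simp
next
  assume *: "x - y \<in> H"
  have "(+) x ` H \<subseteq> (+) y ` H" if "x - y \<in> H" for x y
  proof
    fix z assume "z \<in> (+) x ` H"
    then obtain h where "h \<in> H" "z = x + h" by auto
    then have "z = y + ((x - y) + h)" "(x - y) + h \<in> H"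
      using that assms add_subgroup_add by auto
    then show "z \<in> (+) y ` H" by blast
  qed
  moreover have "y - x \<in> H"
    using add_subgroup_minus[OF assms *] by simp
  ultimately show "(+) x ` H = (+) y ` H"
    using * by blast
qed

lemma same_kernel_card:
  assumes "\<And>x y. x \<in> G \<Longrightarrow> y \<in> G \<Longrightarrow> f x = f y \<longleftrightarrow> g x = g y"
  shows "finite (f ` G) \<longleftrightarrow> finite (g ` G)" "card (f ` G) = card (g ` G)"
proof -
  define h where "h c = g (SOME x. x \<in> G \<and> f x = c)" for c
  have h: "h (f x) = g x" if "x \<in> G" for x
  proof -
    have "(SOME y. y \<in> G \<and> f y = f x) \<in> G \<and> f (SOME y. y \<in> G \<and> f y = f x) = f x"
      by (rule someI_ex) (use that in blast)
    then show ?thesis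
      using assms that unfolding h_def by metis
  qed
  have "inj_on h (f ` G)"
    using h assms by (auto simp: inj_on_def)
  moreover have "h ` f ` G = g ` G"
    using h by (auto simp: image_iff)
  ultimately have "bij_betw h (f ` G) (g ` G)"
    by (simp add: bij_betw_def)
  then show "finite (f ` G) \<longleftrightarrow> finite (g ` G)" "card (f ` G) = card (g ` G)"
    by (auto simp: bij_betw_finite bij_betw_same_card)
qed

text \<open>Any map that separates exactly the cosets computes the index; the index lemmas below
  choose such a map with a convenient image.\<close>

lemma add_index_via:
  assumes "add_subgroup H" "\<And>x y. x \<in> G \<Longrightarrow> y \<in> G \<Longrightarrow> f x = f y \<longleftrightarrow> x - y \<in> H"
  shows "finite (add_cosets G H) \<longleftrightarrow> finite (f ` G)" "add_index G H = card (f ` G)"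
  using same_kernel_card[of G "\<lambda>g. (+) g ` H" f] assms coset_eq_iff[OF assms(1)]
  by (simp_all add: add_cosets_def add_index_def)

lemma add_index_pos:
  assumes "finite (add_cosets G H)" "G \<noteq> {}"
  shows "add_index G H > 0"
  using assms by (auto simp: add_index_def add_cosets_def card_gt_0_iff)

lemma add_index_same:
  assumes "add_subgroup H"
  shows "finite (add_cosets H H)" "add_index H H = 1"
  using add_index_via[of H H "\<lambda>_. 0::nat"] add_subgroup_diff[OF assms] add_subgroup_zero[OF assms] assms
  by (auto simp: image_constant_conv)

lemma add_index_eq_1_imp:
  assumes "add_subgroup H" "H \<subseteq> G" "add_index G H = 1"
  shows "G = H"
proof -
  obtain C where C: "add_cosets G H = {C}"
    using assms(3) by (auto simp: add_index_def card_1_singleton_iff)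
  have "x \<in> H" if "x \<in> G" for x
  proof -
    have "(+) x ` H \<in> add_cosets G H" "(+) 0 ` H \<in> add_cosets G H"
      using that add_subgroup_zero[OF assms(1)] assms(2) unfolding add_cosets_def by blast+
    then have "(+) x ` H = (+) 0 ` H"
      using C by simp
    then show ?thesis
      using coset_eq_iff[OF assms(1), of x 0] by simp
  qed
  with assms(2) show ?thesis by blast
qed

text \<open>The tower law. Fixing a representative \<open>s x\<close> of each coset of the middle group, the pair
  (coset of \<open>s x\<close>, coset of \<open>x - s x\<close> modulo the smallest group) separates cosets of the smallest
  group, and all pairs occur.\<close>

lemma add_index_tower:
  assumes "add_subgroup G" "add_subgroup M" "add_subgroup H" "H \<subseteq> M" "M \<subseteq> G"
  shows "add_index G H = add_index G M * add_index M H"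
    and "finite (add_cosets G H) \<longleftrightarrow> finite (add_cosets G M) \<and> finite (add_cosets M H)"
proof -
  define s where "s x = (SOME y. y \<in> G \<and> y - x \<in> M)" for x
  have s: "s x \<in> G" "s x - x \<in> M" if "x \<in> G" for x
  proof -
    have "x \<in> G \<and> x - x \<in> M"
      using that add_subgroup_zero[OF assms(2)] by simp
    then have "s x \<in> G \<and> s x - x \<in> M"
      unfolding s_def by (rule someI)
    then show "s x \<in> G" "s x - x \<in> M" by auto
  qed
  have s': "x - s x \<in> M" if "x \<in> G" for x
    using add_subgroup_minus[OF assms(2) s(2)[OF that]] by simp
  have s_eq: "s x = s y \<longleftrightarrow> x - y \<in> M" if xy: "x \<in> G" "y \<in> G" for x y
  proof
    assume "s x = s y"
    then have "x - y = (x - s x) - (y - s y)" by simp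
    then show "x - y \<in> M"
      using add_subgroup_diff[OF assms(2) s'[OF xy(1)] s'[OF xy(2)]] by simp
  next
    assume *: "x - y \<in> M"
    have "z - x \<in> M \<longleftrightarrow> z - y \<in> M" for z
      using add_subgroup_add[OF assms(2) _ *, of "z - x"] add_subgroup_diff[OF assms(2) _ *, of "z - y"]
      by auto
    then show "s x = s y" by (simp add: s_def)
  qed
  define f where "f x = (s x, (+) (x - s x) ` H)" for x
  have f_eq: "f x = f y \<longleftrightarrow> x - y \<in> H" if xy: "x \<in> G" "y \<in> G" for x y
  proof
    assume "f x = f y"
    then have "s x = s y" "(x - s x) - (y - s y) \<in> H"
      by (auto simp: f_def coset_eq_iff[OF assms(3)])
    then show "x - y \<in> H" by simp
  next
    assume *: "x - y \<in> H"
    then have "s x = s y"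
      using s_eq xy assms(4) by blast
    with * show "f x = f y"
      by (simp add: f_def coset_eq_iff[OF assms(3)])
  qed
  have im: "f ` G = s ` G \<times> add_cosets M H"
  proof
    show "f ` G \<subseteq> s ` G \<times> add_cosets M H"
      using s' by (auto simp: f_def add_cosets_def)
    show "s ` G \<times> add_cosets M H \<subseteq> f ` G"
    proof
      fix p assume "p \<in> s ` G \<times> add_cosets M H"
      then obtain x m where p: "x \<in> G" "m \<in> M" "p = (s x, (+) m ` H)"
        by (auto simp: add_cosets_def)
      define y where "y = s x + m"
      have y: "y \<in> G"
        using p s(1) assms(1,5) add_subgroup_add y_def by blast
      have "y - x = (s x - x) + m" by (simp add: y_def)
      then have "y - x \<in> M"
        using add_subgroup_add[OF assms(2) s(2)[OF p(1)] p(2)] by (simp only:)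
      then have "s y = s x"
        using s_eq y p(1) by blast
      then have "f y = p" by (simp add: f_def y_def p)
      with y show "p \<in> f ` G" by blast
    qed
  qed
  have ne: "G \<noteq> {}" "M \<noteq> {}"
    using add_subgroup_zero assms by auto
  show "add_index G H = add_index G M * add_index M H"
    using add_index_via(2)[OF assms(3) f_eq] add_index_via(2)[OF assms(2) s_eq] im
    by (simp add: card_cartesian_product) (simp add: add_index_def)
  show "finite (add_cosets G H) \<longleftrightarrow> finite (add_cosets G M) \<and> finite (add_cosets M H)"
    using add_index_via(1)[OF assms(3) f_eq] add_index_via(1)[OF assms(2) s_eq] im ne
    by (auto simp: finite_cartesian_product_iff add_cosets_def)
qed

lemma add_index_image:
  assumes "Modules.additive f" "inj f" "add_subgroup H"
  shows "add_index (f ` G) (f ` H) = add_index G H"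
    and "finite (add_cosets (f ` G) (f ` H)) \<longleftrightarrow> finite (add_cosets G H)"
proof -
  have eq: "(+) (inv_into UNIV f x) ` H = (+) (inv_into UNIV f y) ` H \<longleftrightarrow> x - y \<in> f ` H" if "x \<in> f ` G" "y \<in> f ` G" for x y
  proof -
    from that obtain a b where ab: "x = f a" "y = f b" by blast
    have "x - y = f (a - b)"
      using Modules.additive.diff[OF assms(1)] ab by simp
    then show ?thesis
      using ab assms(2) coset_eq_iff[OF assms(3)] by (auto simp: inj_image_mem_iff)
  qed
  have im: "(\<lambda>x. (+) (inv_into UNIV f x) ` H) ` f ` G = add_cosets G H"
    using assms(2) by (auto simp: add_cosets_def image_image)
  show "add_index (f ` G) (f ` H) = add_index G H"
    using add_index_via(2)[OF add_subgroup_image[OF assms(1,3)] eq] im by (simp add: add_index_def)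
  show "finite (add_cosets (f ` G) (f ` H)) \<longleftrightarrow> finite (add_cosets G H)"
    using add_index_via(1)[OF add_subgroup_image[OF assms(1,3)] eq] im by simp
qed

text \<open>The index of the image of an injective endomorphism depends only on the commensurability
  class of the group: \<open>[L : f M]\<close> can be split through \<open>M\<close> or through \<open>f L\<close>, and
  \<open>[f L : f M] = [L : M]\<close> cancels.\<close>

lemma add_index_endo_commensurable:
  assumes "Modules.additive f" "inj f" "add_subgroup L" "add_subgroup M" "M \<subseteq> L"
    and "f ` M \<subseteq> M" "f ` L \<subseteq> L" "finite (add_cosets L M)"
  shows "add_index L (f ` L) = add_index M (f ` M)"
    and "finite (add_cosets L (f ` L)) \<longleftrightarrow> finite (add_cosets M (f ` M))"
proof -
  note sg = add_subgroup_image[OF assms(1,3)] add_subgroup_image[OF assms(1,4)]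
  have pos: "add_index L M > 0"
    using add_index_pos[OF assms(8)] add_subgroup_zero[OF assms(3)] by blast
  have a: "add_index L (f ` M) = add_index L M * add_index M (f ` M)"
    "finite (add_cosets L (f ` M)) \<longleftrightarrow> finite (add_cosets M (f ` M))"
    using add_index_tower[OF assms(3,4) sg(2) assms(6,5)] assms(8) by auto
  have b: "add_index L (f ` M) = add_index L (f ` L) * add_index L M"
    "finite (add_cosets L (f ` M)) \<longleftrightarrow> finite (add_cosets L (f ` L))"
    using add_index_tower[OF assms(3) sg(1) sg(2) _ assms(7)] assms(5,8)
      add_index_image[OF assms(1,2,4), of L] by auto
  show "add_index L (f ` L) = add_index M (f ` M)"
    using a(1) b(1) pos by simp
  show "finite (add_cosets L (f ` L)) \<longleftrightarrow> finite (add_cosets M (f ` M))"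
    using a(2) b(2) by simp
qed

lemma finite_add_cosets_mono:
  assumes "finite (add_cosets G H)" "G' \<subseteq> G" "H \<subseteq> H'" "add_subgroup H" "add_subgroup H'"
  shows "finite (add_cosets G' H')"
proof -
  define h where "h C = (+) (SOME x. x \<in> G \<and> (+) x ` H = C) ` H'" for C
  have h: "h ((+) x ` H) = (+) x ` H'" if "x \<in> G" for x
  proof -
    have "(SOME y. y \<in> G \<and> (+) y ` H = (+) x ` H) \<in> G \<and>
        (+) (SOME y. y \<in> G \<and> (+) y ` H = (+) x ` H) ` H = (+) x ` H"
      by (rule someI_ex) (use that in blast)
    then show ?thesis
      using assms(3) coset_eq_iff[OF assms(4)] coset_eq_iff[OF assms(5)] unfolding h_def by blast
  qed
  have "add_cosets G' H' \<subseteq> h ` add_cosets G H"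
  proof
    fix C assume "C \<in> add_cosets G' H'"
    then obtain x where "x \<in> G" "C = (+) x ` H'"
      using assms(2) by (auto simp: add_cosets_def)
    then show "C \<in> h ` add_cosets G H"
      using h by (auto simp: add_cosets_def intro!: image_eqI[of _ h "(+) x ` H"])
  qed
  then show ?thesis
    using assms(1) finite_surj by blast
qed

section \<open>Algebraic integers\<close>

text \<open>The eigenvalue criterion for integrality: multiplication by \<open>x\<close> maps the group spanned by the
  \<open>v i\<close> to itself, so \<open>x\<close> is a root of the characteristic polynomial of an integer matrix.\<close>

lemma algebraic_int_if_stable:
  fixes x :: "'a::field_char_0" and v :: "nat \<Rightarrow> 'a" and c :: "nat \<Rightarrow> nat \<Rightarrow> int"
  assumes "\<And>i. i < n \<Longrightarrow> x * v i = (\<Sum>j<n. of_int (c i j) * v j)"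
    and "i0 < n" "v i0 \<noteq> 0"
  shows "algebraic_int x"
proof -
  define A where "A = mat n n (\<lambda>(i, j). c i j)"
  define B :: "'a mat" where "B = map_mat of_int A"
  define w where "w = Matrix.vec n v"
  have A: "A \<in> carrier_mat n n" and B: "B \<in> carrier_mat n n"
    by (auto simp: A_def B_def)
  have "B *\<^sub>v w = x \<cdot>\<^sub>v w"
  proof (rule eq_vecI)
    show "dim_vec (B *\<^sub>v w) = dim_vec (x \<cdot>\<^sub>v w)"
      by (simp add: A_def B_def w_def)
    fix i assume "i < dim_vec (x \<cdot>\<^sub>v w)"
    then have i: "i < n" by (simp add: w_def)
    have "vec_index (B *\<^sub>v w) i = (\<Sum>j = 0..<n. of_int (c i j) * v j)"
      using i by (simp add: scalar_prod_def B_def A_def w_def)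
    also have "\<dots> = x * v i"
      using assms(1)[OF i] by (simp add: lessThan_atLeast0)
    finally show "vec_index (B *\<^sub>v w) i = vec_index (x \<cdot>\<^sub>v w) i"
      using i by (simp add: w_def)
  qed
  moreover have "w \<noteq> 0\<^sub>v n"
    using assms(2,3) unfolding w_def by (metis index_vec index_zero_vec(1))
  ultimately have "eigenvalue B x"
    unfolding eigenvalue_def eigenvector_def using B by (auto intro!: exI[of _ w] simp: w_def)
  then have "poly (char_poly B) x = 0"
    using eigenvalue_root_char_poly[OF B] by simp
  moreover have "char_poly B = map_poly of_int (char_poly A)"
    unfolding B_def using of_int_hom.char_poly_hom[OF A] by metis
  moreover have "lead_coeff (char_poly A) = 1"
    using degree_monic_char_poly[OF A] by auto
  ultimately show ?thesis
    unfolding algebraic_int_altdef_ipoly by (intro exI[of _ "char_poly A"]) auto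
qed

lemma algebraic_int_if_stable':
  fixes x :: "'a::field_char_0" and v :: "'i \<Rightarrow> 'a" and c :: "'i \<Rightarrow> 'i \<Rightarrow> int"
  assumes "finite I" "\<And>i. i \<in> I \<Longrightarrow> x * v i = (\<Sum>j\<in>I. of_int (c i j) * v j)"
    and "i0 \<in> I" "v i0 \<noteq> 0"
  shows "algebraic_int x"
proof -
  obtain h where h: "bij_betw h {..<card I} I"
    using ex_bij_betw_nat_finite[OF assms(1)] by (auto simp: lessThan_atLeast0)
  have "x * v (h i) = (\<Sum>j<card I. of_int (c (h i) (h j)) * v (h j))" if "i < card I" for i
  proof -
    have "x * v (h i) = (\<Sum>j\<in>I. of_int (c (h i) j) * v j)"
      using assms(2) bij_betwE[OF h] that by auto
    also have "\<dots> = (\<Sum>j<card I. of_int (c (h i) (h j)) * v (h j))"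
      using sum.reindex_bij_betw[OF h, of "\<lambda>j. of_int (c (h i) j) * v j"] by simp
    finally show ?thesis .
  qed
  moreover obtain k where "k < card I" "h k = i0"
    using h assms(3) unfolding bij_betw_def by (metis imageE lessThan_iff)
  ultimately show ?thesis
    using algebraic_int_if_stable[of "card I" x "\<lambda>i. v (h i)" "\<lambda>i j. c (h i) (h j)" k] assms(4) by auto
qed

lemma algebraic_int_top_power:
  fixes x :: "'a::field_char_0"
  assumes "algebraic_int x"
  obtains n c where "n > 0" "x ^ n = (\<Sum>i<n. of_int (c i) * x ^ i)"
proof -
  obtain p where p: "poly (map_poly of_int p) x = 0" "lead_coeff p = 1"
    using assms unfolding algebraic_int_altdef_ipoly by blast
  have deg: "degree p > 0"
  proof (rule ccontr)
    assume "\<not> degree p > 0"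
    then have "p = [:1:]"
      using p(2) by (metis degree_eq_zeroE gr0I lead_coeff_pCons(2) pCons_0_0 coeff_pCons_0 degree_pCons_0)
    with p(1) show False by simp
  qed
  have "poly (map_poly of_int p) x = (\<Sum>i\<le>degree p. of_int (coeff p i) * x ^ i)"
    by (simp add: poly_altdef)
  also have "\<dots> = (\<Sum>i<degree p. of_int (coeff p i) * x ^ i) + x ^ degree p"
    using p(2) by (simp add: lessThan_Suc_atMost[symmetric])
  finally have "x ^ degree p = (\<Sum>i<degree p. of_int (- coeff p i) * x ^ i)"
    using p(1) by (simp add: sum_negf eq_neg_iff_add_eq_0 add.commute)
  with deg show thesis by (rule that)
qed

text \<open>Sums and products of algebraic integers \<open>x\<close>, \<open>y\<close> map the group spanned by the products
  \<open>x ^ i * y ^ j\<close> of bounded degrees to itself.\<close>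

lemma algebraic_int_add_mult:
  fixes x y :: "'a::field_char_0"
  assumes "algebraic_int x" "algebraic_int y"
  shows "algebraic_int (x + y)" "algebraic_int (x * y)"
proof -
  obtain n c where n: "n > 0" "x ^ n = (\<Sum>i<n. of_int (c i) * x ^ i)"
    using algebraic_int_top_power[OF assms(1)] by blast
  obtain m d where m: "m > 0" "y ^ m = (\<Sum>i<m. of_int (d i) * y ^ i)"
    using algebraic_int_top_power[OF assms(2)] by blast
  define I where "I = {..<n} \<times> {..<m}"
  define v where "v p = x ^ fst p * y ^ snd p" for p :: "nat \<times> nat"
  define S where "S = {z. \<exists>a. z = (\<Sum>p\<in>I. of_int (a p) * v p)}"
  have fin: "finite I" by (simp add: I_def)
  have S_add: "z + w \<in> S" if "z \<in> S" "w \<in> S" for z w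
  proof -
    obtain a b where "z = (\<Sum>p\<in>I. of_int (a p) * v p)" "w = (\<Sum>p\<in>I. of_int (b p) * v p)"
      using \<open>z \<in> S\<close> \<open>w \<in> S\<close> by (auto simp: S_def)
    then have "z + w = (\<Sum>p\<in>I. of_int (a p + b p) * v p)"
      by (simp add: sum.distrib algebra_simps)
    then show ?thesis unfolding S_def mem_Collect_eq by (rule exI[of _ "\<lambda>p. a p + b p"])
  qed
  have S_mult: "of_int k * z \<in> S" if "z \<in> S" for z k
  proof -
    from that obtain a where "z = (\<Sum>p\<in>I. of_int (a p) * v p)"
      by (auto simp: S_def)
    then have "of_int k * z = (\<Sum>p\<in>I. of_int (k * a p) * v p)"
      by (simp add: sum_distrib_left algebra_simps)
    then show ?thesis unfolding S_def mem_Collect_eq by (rule exI[of _ "\<lambda>p. k * a p"])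
  qed
  have S_v: "v p \<in> S" if "p \<in> I" for p
  proof -
    have "(\<Sum>q\<in>I. of_int (if q = p then 1 else 0) * v q) = (\<Sum>q\<in>I. if q = p then v q else 0)"
      by (rule sum.cong) auto
    also have "\<dots> = v p"
      using that fin by simp
    finally show ?thesis
      unfolding S_def mem_Collect_eq by (intro exI[of _ "\<lambda>q. if q = p then 1 else 0"]) simp
  qed
  have S_0: "0 \<in> S"
    unfolding S_def mem_Collect_eq by (rule exI[of _ "\<lambda>_. 0"]) simp
  have S_sum: "(\<Sum>i\<in>J. of_int (e i) * g i) \<in> S" if "\<And>i. i \<in> J \<Longrightarrow> g i \<in> S" for J :: "nat set" and e g
    using that by (induction J rule: infinite_finite_induct) (auto intro: S_0 S_add S_mult)
  have xv: "x * v p \<in> S" if p: "p \<in> I" for p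
  proof (cases "Suc (fst p) < n")
    case True
    then have "x * v p = v (Suc (fst p), snd p)" by (simp add: v_def)
    then show ?thesis using True p S_v by (auto simp: I_def)
  next
    case False
    then have "Suc (fst p) = n" using p by (auto simp: I_def)
    then have "x * v p = x ^ n * y ^ snd p" by (auto simp: v_def)
    also have "\<dots> = (\<Sum>i<n. of_int (c i) * v (i, snd p))"
      unfolding n(2) sum_distrib_right by (simp add: v_def mult.assoc)
    finally show ?thesis using S_sum[of "{..<n}" "\<lambda>i. v (i, snd p)" c] S_v p by (auto simp: I_def)
  qed
  have yv: "y * v p \<in> S" if p: "p \<in> I" for p
  proof (cases "Suc (snd p) < m")
    case True
    then have "y * v p = v (fst p, Suc (snd p))" by (simp add: v_def)
    then show ?thesis using True p S_v by (auto simp: I_def)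
  next
    case False
    then have "Suc (snd p) = m" using p by (auto simp: I_def)
    then have "y * v p = x ^ fst p * y ^ m" by (auto simp: v_def)
    also have "\<dots> = (\<Sum>i<m. of_int (d i) * v (fst p, i))"
      unfolding m(2) sum_distrib_left by (simp add: v_def mult.left_commute)
    finally show ?thesis using S_sum[of "{..<m}" "\<lambda>i. v (fst p, i)" d] S_v p by (auto simp: I_def)
  qed
  have xS: "x * z \<in> S" if "z \<in> S" for z
  proof -
    from that obtain a where z: "z = (\<Sum>p\<in>I. of_int (a p) * v p)"
      by (auto simp: S_def)
    have "x * z = (\<Sum>p\<in>I. of_int (a p) * (x * v p))"
      by (simp add: z sum_distrib_left algebra_simps)
    moreover have "(\<Sum>p\<in>J. of_int (a p) * (x * v p)) \<in> S" if "J \<subseteq> I" for J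
      using finite_subset[OF that fin] that
      by (induction J rule: finite_induct) (auto intro: S_0 S_add S_mult xv)
    ultimately show ?thesis by auto
  qed
  have stable: "algebraic_int u" if "\<And>p. p \<in> I \<Longrightarrow> u * v p \<in> S" for u
  proof -
    have "\<forall>p\<in>I. \<exists>a. u * v p = (\<Sum>q\<in>I. of_int (a q) * v q)"
      using that by (auto simp: S_def)
    then obtain a where "\<And>p. p \<in> I \<Longrightarrow> u * v p = (\<Sum>q\<in>I. of_int (a p q) * v q)"
      by metis
    then show ?thesis
      using algebraic_int_if_stable'[OF fin, of u v a "(0, 0)"] n(1) m(1) by (auto simp: I_def v_def)
  qed
  show "algebraic_int (x + y)"
    by (rule stable) (simp add: distrib_right S_add xv yv)
  show "algebraic_int (x * y)"
    by (rule stable) (simp add: mult.assoc xS yv)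
qed

lemmas algebraic_int_add = algebraic_int_add_mult(1)
  and algebraic_int_mult = algebraic_int_add_mult(2)

lemma algebraic_int_diff:
  fixes x y :: "'a::field_char_0"
  shows "algebraic_int x \<Longrightarrow> algebraic_int y \<Longrightarrow> algebraic_int (x - y)"
  using algebraic_int_add[of x "- y"] by simp

lemma algebraic_int_sum:
  fixes f :: "'i \<Rightarrow> 'a::field_char_0"
  shows "(\<And>i. i \<in> A \<Longrightarrow> algebraic_int (f i)) \<Longrightarrow> algebraic_int (sum f A)"
  by (induction A rule: infinite_finite_induct) (auto intro: algebraic_int_add)

lemma algebraic_int_coeff_mult:
  fixes p q :: "'a::field_char_0 poly"
  assumes "\<And>i. algebraic_int (coeff p i)" "\<And>i. algebraic_int (coeff q i)"
  shows "algebraic_int (coeff (p * q) i)"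
  by (auto simp: coeff_mult intro!: algebraic_int_sum algebraic_int_mult assms)

lemma algebraic_int_coeff_prod_roots:
  fixes A :: "'a::field_char_0 set"
  assumes "\<And>a. a \<in> A \<Longrightarrow> algebraic_int a"
  shows "algebraic_int (coeff (\<Prod>a\<in>A. [:- a, 1:]) i)"
  using assms
proof (induction A arbitrary: i rule: infinite_finite_induct)
  case (insert a A)
  have "algebraic_int (coeff [:- a, 1:] j)" for j
    using insert.prems by (auto simp: coeff_pCons split: nat.splits)
  then show ?case
    using insert by (simp add: algebraic_int_coeff_mult del: mult_pCons_left)
qed (auto simp: coeff_1)

section \<open>Minimal polynomials and primitive elements\<close>

text \<open>Rational polynomials are evaluated both at real elements of the number field and at their
  complex conjugates.\<close>

definition rpoly :: "rat poly \<Rightarrow> 'a::field_char_0 \<Rightarrow> 'a" where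
  "rpoly p x = poly (map_poly of_rat p) x"

interpretation of_rat_poly_hom: map_poly_comm_ring_hom of_rat ..

lemma rpoly_simps [simp]:
  "rpoly 0 x = 0" "rpoly 1 x = 1" "rpoly (p + q) x = rpoly p x + rpoly q x"
  "rpoly (p - q) x = rpoly p x - rpoly q x" "rpoly (- p) x = - rpoly p x"
  "rpoly (p * q) x = rpoly p x * rpoly q x" "rpoly (pCons a p) x = of_rat a + x * rpoly p x"
  "rpoly (Polynomial.smult a p) x = of_rat a * rpoly p x"
  by (simp_all add: rpoly_def hom_distribs)

lemma rpoly_pcompose [simp]: "rpoly (pcompose p q) x = rpoly p (rpoly q x)"
  by (induction p) (simp_all add: pcompose_pCons)

lemma of_real_of_rat: "of_real (of_rat q) = (of_rat q :: complex)"
  by (cases q) (simp add: of_rat_rat)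

lemma map_poly_of_real_of_rat:
  "map_poly of_real (map_poly of_rat p :: real poly) = (map_poly of_rat p :: complex poly)"
  by (rule poly_eqI) (simp add: coeff_map_poly of_real_of_rat)

lemma rpoly_of_real: "rpoly p (of_real x :: complex) = of_real (rpoly p x)"
  by (induction p) (simp_all add: of_real_of_rat)

definition is_min_poly :: "rat poly \<Rightarrow> 'a::field_char_0 \<Rightarrow> bool" where
  "is_min_poly f x \<longleftrightarrow> lead_coeff f = 1 \<and> rpoly f x = 0 \<and> (\<forall>p. rpoly p x = 0 \<longrightarrow> f dvd p)"

lemma min_poly_monic: "is_min_poly f x \<Longrightarrow> lead_coeff f = 1"
  and min_poly_root: "is_min_poly f x \<Longrightarrow> rpoly f x = 0"
  by (simp_all add: is_min_poly_def)

lemma min_poly_nonzero: "is_min_poly f x \<Longrightarrow> f \<noteq> 0"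
  using min_poly_monic leading_coeff_0_iff zero_neq_one by metis

lemma min_poly_root_iff: "is_min_poly f x \<Longrightarrow> rpoly p x = 0 \<longleftrightarrow> f dvd p"
  by (auto simp: is_min_poly_def)

lemma min_poly_exists:
  fixes x :: "'a::field_char_0"
  assumes "p \<noteq> 0" "rpoly p x = 0"
  shows "\<exists>f. is_min_poly f x"
proof -
  obtain g where g: "g \<noteq> 0" "rpoly g x = 0"
    and min: "\<And>q. q \<noteq> 0 \<Longrightarrow> rpoly q x = 0 \<Longrightarrow> degree g \<le> degree q"
    using exists_least_lemma[of "\<lambda>n. \<exists>g. g \<noteq> 0 \<and> rpoly g x = 0 \<and> degree g = n"] assms
    by (metis (no_types, lifting) ex_has_least_nat[of "\<lambda>q. q \<noteq> 0 \<and> rpoly q x = 0" p degree])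
  define f where "f = Polynomial.smult (inverse (lead_coeff g)) g"
  have "lead_coeff f = 1" "rpoly f x = 0" "degree f = degree g"
    using g by (simp_all add: f_def)
  moreover have "f dvd q" if "rpoly q x = 0" for q
  proof -
    have "rpoly (q mod f) x = rpoly q x - rpoly (f * (q div f)) x"
      by (metis minus_mult_div_eq_mod rpoly_simps(4))
    then have "rpoly (q mod f) x = 0"
      using that \<open>rpoly f x = 0\<close> by simp
    moreover have "f \<noteq> 0" using \<open>lead_coeff f = 1\<close> by auto
    ultimately have "q mod f = 0"
      using min[of "q mod f"] degree_mod_less[of f q] \<open>degree f = degree g\<close> by fastforce
    then show ?thesis by auto
  qed
  ultimately show ?thesis unfolding is_min_poly_def by blast
qed

lemma algebraic_imp_rpoly:
  assumes "algebraic (x :: 'a::field_char_0)"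
  obtains p where "p \<noteq> 0" "rpoly p x = 0"
proof -
  obtain p :: "int poly" where p: "poly (map_poly of_int p) x = 0" "p \<noteq> 0"
    using algebraicE'[OF assms] by blast
  have "map_poly of_rat (map_poly of_int p) = (map_poly of_int p :: 'a poly)"
    by (rule poly_eqI) (simp add: coeff_map_poly)
  then have "rpoly (map_poly of_int p) x = 0"
    using p by (simp add: rpoly_def)
  moreover have "map_poly of_int p \<noteq> (0 :: rat poly)"
    using p(2) by simp
  ultimately show thesis using that by blast
qed

lemma algebraic_min_poly: "algebraic (x :: 'a::field_char_0) \<Longrightarrow> \<exists>f. is_min_poly f x"
  using algebraic_imp_rpoly min_poly_exists by metis

lemma min_poly_degree_pos:
  assumes "is_min_poly f x"
  shows "degree f > 0"
proof (rule ccontr)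
  assume "\<not> degree f > 0"
  then have "f = [:lead_coeff f:]"
    using degree_0_id[of f] by simp
  then have "f = 1" using min_poly_monic[OF assms] by simp
  then show False using min_poly_root[OF assms] by simp
qed

text \<open>A minimal polynomial is a prime element of \<open>\<rat>[T]\<close>: if \<open>f = gcd f p * h\<close>, then \<open>x\<close> is a root of
  one of the factors, which is therefore divisible by \<open>f\<close>.\<close>

lemma min_poly_dvd_or_bezout:
  assumes "is_min_poly f x"
  obtains (dvd) "f dvd p" | (coprime) u v where "u * f + v * p = 1"
proof -
  have f0: "f \<noteq> 0" using assms by (rule min_poly_nonzero)
  define g where "g = gcd f p"
  obtain h where h: "f = g * h"
    unfolding g_def by (meson dvdE gcd_dvd1)
  have "rpoly g x = 0 \<or> rpoly h x = 0"
    using min_poly_root[OF assms] h by simp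
  then show thesis
  proof
    assume "rpoly g x = 0"
    then have "f dvd g" using min_poly_root_iff[OF assms] by blast
    then show thesis using dvd g_def by (meson dvd_trans gcd_dvd2)
  next
    assume "rpoly h x = 0"
    then have "g * h dvd 1 * h" using min_poly_root_iff[OF assms] h by simp
    then have "g dvd 1" using f0 h by (subst (asm) dvd_mult_cancel_right) auto
    then have "coprime f p" unfolding g_def by (rule is_unit_gcd[THEN iffD1])
    then show thesis
      using bezout_coefficients_fst_snd[of f p] coprime by (metis coprime_iff_gcd_eq_1)
  qed
qed

text \<open>In characteristic zero the derivative of \<open>f\<close> is a nonzero polynomial of smaller degree.\<close>

lemma min_poly_pderiv:
  assumes "is_min_poly f x"
  shows "rpoly (pderiv f) x \<noteq> 0"
proof
  assume "rpoly (pderiv f) x = 0"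
  then have "f dvd pderiv f" using min_poly_root_iff[OF assms] by blast
  moreover have "pderiv f \<noteq> 0"
    using min_poly_degree_pos[OF assms] by (simp add: pderiv_eq_0_iff)
  ultimately have "degree f \<le> degree (pderiv f)" by (rule dvd_imp_degree_le)
  then show False using min_poly_degree_pos[OF assms] by (simp add: degree_pderiv)
qed

text \<open>A Bezout identity \<open>u f + v p = 1\<close> would fail at a common root of \<open>f\<close> and \<open>p\<close>, in whatever field
  this root lies.\<close>

lemma min_poly_conjugate:
  assumes "is_min_poly f x" "rpoly f y = 0"
  shows "is_min_poly f y"
  unfolding is_min_poly_def
proof (intro conjI allI impI)
  show "lead_coeff f = 1" using assms(1) by (simp add: is_min_poly_def)
  show "rpoly f y = 0" by fact
  fix p assume p: "rpoly p y = 0"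
  show "f dvd p"
  proof (rule min_poly_dvd_or_bezout[OF assms(1), of p])
    fix u v assume "u * f + v * p = 1"
    then have "rpoly (u * f + v * p) y = 1" by simp
    with p assms(2) show ?thesis by simp
  qed
qed

lemma pderiv_map_poly_of_rat: "pderiv (map_poly of_rat p :: 'a::field_char_0 poly) = map_poly of_rat (pderiv p)"
  by (rule poly_eqI) (simp add: coeff_pderiv coeff_map_poly of_rat_mult of_rat_add)

definition rat_adjoin :: "'a::field_char_0 \<Rightarrow> 'a set" where
  "rat_adjoin x = range (\<lambda>p. rpoly p x)"

lemma rat_adjoin_closed:
  shows "x \<in> rat_adjoin x" "of_rat q \<in> rat_adjoin x"
    and "a \<in> rat_adjoin x \<Longrightarrow> b \<in> rat_adjoin x \<Longrightarrow> a + b \<in> rat_adjoin x"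
    and "a \<in> rat_adjoin x \<Longrightarrow> b \<in> rat_adjoin x \<Longrightarrow> a - b \<in> rat_adjoin x"
    and "a \<in> rat_adjoin x \<Longrightarrow> b \<in> rat_adjoin x \<Longrightarrow> a * b \<in> rat_adjoin x"
proof -
  have "x = rpoly [:0, 1:] x" "of_rat q = rpoly [:q:] x" by simp_all
  then show "x \<in> rat_adjoin x" "of_rat q \<in> rat_adjoin x"
    unfolding rat_adjoin_def by blast+
  assume "a \<in> rat_adjoin x" "b \<in> rat_adjoin x"
  then obtain p r where "a = rpoly p x" "b = rpoly r x" by (auto simp: rat_adjoin_def)
  then have "a + b = rpoly (p + r) x" "a - b = rpoly (p - r) x" "a * b = rpoly (p * r) x" by simp_all
  then show "a + b \<in> rat_adjoin x" "a - b \<in> rat_adjoin x" "a * b \<in> rat_adjoin x"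
    unfolding rat_adjoin_def by blast+
qed

lemma rat_adjoin_numbers:
  "0 \<in> rat_adjoin x" "1 \<in> rat_adjoin x" "of_nat n \<in> rat_adjoin x"
  using rat_adjoin_closed(2)[of 0 x] rat_adjoin_closed(2)[of 1 x] rat_adjoin_closed(2)[of "of_nat n" x]
  by simp_all

lemma rat_adjoin_inverse:
  assumes "algebraic x" "a \<in> rat_adjoin x"
  shows "inverse a \<in> rat_adjoin x"
proof (cases "a = 0")
  case True
  then show ?thesis using assms(2) by simp
next
  case False
  obtain f where f: "is_min_poly f x" using algebraic_min_poly[OF assms(1)] by blast
  obtain p where p: "a = rpoly p x" using assms(2) by (auto simp: rat_adjoin_def)
  show ?thesis
  proof (rule min_poly_dvd_or_bezout[OF f, of p])
    assume "f dvd p"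
    then show ?thesis using min_poly_root_iff[OF f] p False by blast
  next
    fix u v assume "u * f + v * p = 1"
    then have "rpoly (u * f + v * p) x = 1" by simp
    then have "rpoly v x * a = 1" using min_poly_root[OF f] p by simp
    then have "inverse a = rpoly v x" by (metis inverse_unique mult.commute)
    then show ?thesis by (auto simp: rat_adjoin_def)
  qed
qed

lemma rat_adjoin_rpoly:
  assumes "y \<in> rat_adjoin x"
  shows "rpoly p y \<in> rat_adjoin x"
  by (induction p) (auto intro: rat_adjoin_closed rat_adjoin_numbers assms)

lemma rat_adjoin_mono: "y \<in> rat_adjoin x \<Longrightarrow> rat_adjoin y \<subseteq> rat_adjoin x"
  using rat_adjoin_rpoly[of y x] unfolding rat_adjoin_def[of y] by blast

text \<open>Over a subfield \<open>F\<close> that is only given as a set, division with remainder by a monic polynomial of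
  least degree shows that this polynomial generates the ideal of polynomials over \<open>F\<close> vanishing at \<open>x\<close>.\<close>

lemma subfield_min_poly:
  fixes F :: "'a::field set" and x :: 'a
  assumes F: "0 \<in> F" "\<And>a b. a \<in> F \<Longrightarrow> b \<in> F \<Longrightarrow> a - b \<in> F" "\<And>a b. a \<in> F \<Longrightarrow> b \<in> F \<Longrightarrow> a * b \<in> F"
      "\<And>a. a \<in> F \<Longrightarrow> inverse a \<in> F"
    and g: "g \<noteq> 0" "\<forall>i. coeff g i \<in> F" "poly g x = 0"
  obtains m where "lead_coeff m = 1" "\<forall>i. coeff m i \<in> F" "poly m x = 0"
    "\<And>p. \<forall>i. coeff p i \<in> F \<Longrightarrow> poly p x = 0 \<Longrightarrow> m dvd p"
proof -
  define P where "P p \<longleftrightarrow> p \<noteq> 0 \<and> (\<forall>i. coeff p i \<in> F) \<and> poly p x = 0" for p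
  obtain m0 where m0: "P m0" and min: "\<And>q. P q \<Longrightarrow> degree m0 \<le> degree q"
    using ex_has_least_nat[of P g degree] g by (auto simp: P_def)
  define m where "m = Polynomial.smult (inverse (lead_coeff m0)) m0"
  have m: "lead_coeff m = 1" "\<forall>i. coeff m i \<in> F" "poly m x = 0" "degree m = degree m0"
    using m0 F by (auto simp: m_def P_def)
  have "m dvd p" if "\<forall>i. coeff p i \<in> F" "poly p x = 0" for p
    using that
  proof (induction "degree p" arbitrary: p rule: less_induct)
    case less
    show ?case
    proof (cases "p = 0 \<or> degree p = 0")
      case True
      then have "p = 0"
        using less.prems(2) by (auto elim: degree_eq_zeroE)
      then show ?thesis by simp
    next
      case False
      then have "P p" using less.prems by (simp add: P_def)
      then have dm: "degree m \<le> degree p" using min m(4) by simp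
      define t where "t = monom (lead_coeff p) (degree p - degree m) * m"
      have t: "\<forall>i. coeff t i \<in> F" "poly t x = 0" "degree t = degree p" "coeff t (degree p) = lead_coeff p"
      proof -
        show "\<forall>i. coeff t i \<in> F"
          using less.prems(1) m(2) F by (auto simp: t_def coeff_monom_mult)
        show "poly t x = 0" by (simp add: t_def m(3))
        have "m \<noteq> 0" using m(1) by auto
        then show "degree t = degree p"
          using dm False by (simp add: t_def degree_mult_eq degree_monom_eq)
        show "coeff t (degree p) = lead_coeff p"
          using dm m(1) by (simp add: t_def coeff_monom_mult)
      qed
      have "degree (p - t) < degree p \<or> p - t = 0"
        using t(3,4) False eq_zero_or_degree_less[of "p - t" "degree p"] degree_diff_le[of p "degree p" t]
        by auto
      then have "m dvd p - t"
      proof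
        assume "degree (p - t) < degree p"
        then show ?thesis
          using less.hyps[of "p - t"] less.prems t F by auto
      qed simp
      moreover have "m dvd t" by (simp add: t_def)
      ultimately show ?thesis by (metis diff_add_cancel dvd_add)
    qed
  qed
  then show thesis using that m by blast
qed

text \<open>The primitive element theorem in the form that all but finitely many combinations
  \<open>\<beta> + c * \<gamma>\<close> generate \<open>\<gamma>\<close>. Let \<open>f\<close>, \<open>g\<close> be the minimal polynomials of \<open>\<beta>\<close>, \<open>\<gamma>\<close> and \<open>\<theta> = \<beta> + c * \<gamma>\<close>.
  The minimal polynomial \<open>m\<close> of \<open>\<gamma>\<close> over \<open>\<rat>(\<theta>)\<close> divides \<open>g\<close> and \<open>f (\<theta> - c T)\<close>. A complex root \<open>d \<noteq> \<gamma>\<close>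
  of \<open>m\<close> would make \<open>\<theta> - c d\<close> a root of \<open>f\<close>, which excludes all but finitely many \<open>c\<close>; and \<open>\<gamma>\<close> is a
  simple root of \<open>g\<close>. Hence \<open>m\<close> is linear.\<close>

lemma primitive_combination:
  fixes \<beta> \<gamma> :: real
  assumes "algebraic \<beta>" "algebraic \<gamma>" "\<And>c. algebraic (\<beta> + of_nat c * \<gamma>)"
  shows "finite {c::nat. \<gamma> \<notin> rat_adjoin (\<beta> + of_nat c * \<gamma>)}"
proof -
  obtain f where f: "is_min_poly f \<beta>" using algebraic_min_poly[OF assms(1)] by blast
  obtain g where g: "is_min_poly g \<gamma>" using algebraic_min_poly[OF assms(2)] by blast
  define A where "A h = {z::complex. poly (map_poly of_rat h) z = 0}" for h
  have finA: "finite (A h)" if "h \<noteq> 0" for h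
    unfolding A_def using that by (intro poly_roots_finite) simp
  have fg0: "f \<noteq> 0" "g \<noteq> 0" using f g min_poly_nonzero by blast+
  define bad where "bad = of_nat -` ((\<lambda>(b, d). (b - of_real \<beta>) / (of_real \<gamma> - d)) ` (A f \<times> A g))"
  have "finite (bad :: nat set)"
    unfolding bad_def by (intro finite_vimageI finite_imageI finite_cartesian_product finA fg0) (simp add: inj_on_def)
  moreover have "\<gamma> \<in> rat_adjoin (\<beta> + of_nat c * \<gamma>)" if c: "c \<notin> bad" for c
  proof -
    define \<theta> where "\<theta> = \<beta> + of_nat c * \<gamma>"
    define F where "F = rat_adjoin \<theta>"
    have alg: "algebraic \<theta>" using assms(3) by (simp add: \<theta>_def)
    have F: "0 \<in> F" "\<And>a b. a \<in> F \<Longrightarrow> b \<in> F \<Longrightarrow> a + b \<in> F" "\<And>a b. a \<in> F \<Longrightarrow> b \<in> F \<Longrightarrow> a - b \<in> F"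
      "\<And>a b. a \<in> F \<Longrightarrow> b \<in> F \<Longrightarrow> a * b \<in> F" "\<And>a. a \<in> F \<Longrightarrow> inverse a \<in> F" "\<And>q. of_rat q \<in> F"
      unfolding F_def by (simp_all add: rat_adjoin_closed rat_adjoin_numbers rat_adjoin_inverse[OF alg])
    have F_sum: "sum h I \<in> F" if "\<And>i. i \<in> I \<Longrightarrow> h i \<in> F" for h :: "nat \<Rightarrow> real" and I
      using that by (induction I rule: infinite_finite_induct) (auto intro: F)
    obtain m where m: "lead_coeff m = 1" "\<forall>i. coeff m i \<in> F" "poly m \<gamma> = 0"
      and mdvd: "\<And>p. \<forall>i. coeff p i \<in> F \<Longrightarrow> poly p \<gamma> = 0 \<Longrightarrow> m dvd p"
    proof (rule subfield_min_poly[of F "map_poly of_rat g" \<gamma>])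
      show "poly (map_poly of_rat g) \<gamma> = 0" using min_poly_root[OF g] by (simp add: rpoly_def)
    qed (use F fg0 in auto)
    define H where "H = pcompose (map_poly of_rat f) [:\<theta>, - of_nat c:]"
    have H_coeff: "\<forall>i. coeff (pcompose (map_poly of_rat h) [:\<theta>, - of_nat c:]) i \<in> F" for h
    proof (induction h)
      case (pCons a h)
      have "coeff [:\<theta>, - of_nat c:] i \<in> F" for i
        using F(1) F(3)[OF F(1) F(6)[of "of_nat c"]] rat_adjoin_closed(1)[of \<theta>]
        by (auto simp: F_def coeff_pCons split: nat.splits)
      then have "coeff ([:\<theta>, - of_nat c:] * pcompose (map_poly of_rat h) [:\<theta>, - of_nat c:]) i \<in> F" for i
        unfolding coeff_mult using pCons by (intro F_sum F) auto
      moreover have "coeff [:of_rat a:] i \<in> F" for i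
        using F by (auto simp: coeff_pCons split: nat.splits)
      ultimately show ?case
        using F(2) by (simp add: pcompose_pCons hom_distribs del: mult_pCons_left)
    qed (use F in simp)
    have "m dvd H"
      using H_coeff min_poly_root[OF f] by (intro mdvd) (simp_all add: H_def poly_pcompose \<theta>_def rpoly_def)
    have "m dvd map_poly of_rat g"
      using min_poly_root[OF g] F(6) by (intro mdvd) (simp_all add: rpoly_def)
    define C :: "real poly \<Rightarrow> complex poly" where "C = map_poly of_real"
    have C_mult: "C (p * q) = C p * C q" for p q
      unfolding C_def by (rule poly_eqI) (simp add: coeff_map_poly coeff_mult)
    have C_poly: "poly (C p) (of_real x) = of_real (poly p x)" for p x
      unfolding C_def by (induction p) (simp_all add: map_poly_pCons)
    have C_rat: "C (map_poly of_rat h) = map_poly of_rat h" for h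
      unfolding C_def by (rule map_poly_of_real_of_rat)
    have "poly (C m) (of_real \<gamma>) = 0" using m(3) C_poly by simp
    then obtain k where k: "C m = [:- of_real \<gamma>, 1:] * k"
      by (auto simp: poly_eq_0_iff_dvd)
    have "degree k = 0"
    proof (rule ccontr)
      assume "degree k \<noteq> 0"
      then obtain d where d: "poly k d = 0"
        using fundamental_theorem_of_algebra[of k] constant_degree[of k] by auto
      obtain e where "map_poly of_rat g = m * e" using \<open>m dvd map_poly of_rat g\<close> by auto
      then have e: "map_poly of_rat g = [:- of_real \<gamma>, 1:] * k * C e"
        using C_rat[of g] C_mult[of m e] k by (simp only:)
      obtain e' where "H = m * e'" using \<open>m dvd H\<close> by auto
      then have "poly (C H) d = 0" using C_mult k d by (simp add: poly_mult)
      moreover have "C H = pcompose (map_poly of_rat f) [:of_real \<theta>, - of_nat c:]"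
      proof -
        have "C (pcompose p q) = pcompose (C p) (C q)" for p q
        proof (induction p)
          case (pCons a p)
          have "C (pCons a p) = pCons (of_real a) (C p)" "C [:a:] = [:of_real a:]" "C (u + w) = C u + C w" for u w
            unfolding C_def by (rule poly_eqI, simp add: coeff_map_poly coeff_pCons split: nat.splits)+
          then show ?case using pCons by (simp add: pcompose_pCons C_mult)
        qed (simp add: C_def)
        moreover have "C [:\<theta>, - of_nat c:] = [:of_real \<theta>, - of_nat c:]"
          unfolding C_def by (rule poly_eqI) (simp add: coeff_map_poly coeff_pCons split: nat.splits)
        ultimately show ?thesis by (simp add: H_def C_rat)
      qed
      ultimately have root: "of_real \<theta> - of_nat c * d \<in> A f"
        by (simp add: poly_pcompose A_def mult.commute)
      show False
      proof (cases "d = of_real \<gamma>")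
        case True
        then obtain k' where "k = [:- of_real \<gamma>, 1:] * k'"
          using d by (auto simp: poly_eq_0_iff_dvd)
        moreover have "poly (pderiv (L * (L * k') * E)) z = 0" if "poly L z = 0" for L E and z :: complex
          using that by (simp add: pderiv_mult)
        ultimately have "poly (pderiv (map_poly of_rat g)) (of_real \<gamma> :: complex) = 0"
          unfolding e by (simp del: mult_pCons_left)
        then have "rpoly (pderiv g) (of_real \<gamma> :: complex) = 0"
          by (simp add: rpoly_def pderiv_map_poly_of_rat)
        then show False using min_poly_pderiv[OF g] by (simp add: rpoly_of_real)
      next
        case False
        have "d \<in> A g" using d by (simp add: A_def e)
        moreover have "of_nat c = (of_real \<theta> - of_nat c * d - of_real \<beta>) / (of_real \<gamma> - d)"
          using False by (simp add: \<theta>_def field_simps)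
        ultimately have "of_nat c = (case (of_real \<theta> - of_nat c * d, d) of (b, d) \<Rightarrow> (b - of_real \<beta>) / (of_real \<gamma> - d))"
            "(of_real \<theta> - of_nat c * d, d) \<in> A f \<times> A g"
          using root by simp_all
        then have "c \<in> bad" unfolding bad_def vimage_eq by (rule image_eqI)
        then show False using c by blast
      qed
    qed
    then have "degree (C m) \<le> 1"
      using k degree_mult_le[of "[:- of_real \<gamma>, 1:]" k] by (simp del: mult_pCons_left)
    then have "degree m \<le> 1" by (simp add: C_def degree_map_poly)
    moreover have "degree m \<noteq> 0"
    proof
      assume "degree m = 0"
      then obtain a where "m = [:a:]" by (rule degree_eq_zeroE)
      with m(1,3) show False by simp
    qed
    ultimately have "degree m = 1" by simp
    then have "m = [:coeff m 0, 1:]"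
      using m(1) coeff_eq_0[of m] by (intro poly_eqI) (auto simp: coeff_pCons split: nat.splits)
    then have "poly m \<gamma> = coeff m 0 + \<gamma>"
      by (metis add.right_neutral mult.right_neutral mult_zero_right poly_0 poly_pCons)
    then have "\<gamma> = 0 - coeff m 0" using m(3) by simp
    moreover have "0 - coeff m 0 \<in> F" using F(1,3) m(2) by blast
    ultimately show ?thesis by (simp only: F_def \<theta>_def)
  qed
  then have "{c. \<gamma> \<notin> rat_adjoin (\<beta> + of_nat c * \<gamma>)} \<subseteq> bad" by blast
  ultimately show ?thesis using finite_subset by blast
qed

section \<open>Real number fields\<close>

lemma span_over_base: "1 \<in> S \<Longrightarrow> b \<in> B \<Longrightarrow> b \<in> span_over S B"
  unfolding span_over_def by (intro CollectI exI[of _ "{b}"] exI[of _ "\<lambda>_. 1"]) simp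

lemma span_over_least:
  assumes "0 \<in> W" "\<And>x y. x \<in> W \<Longrightarrow> y \<in> W \<Longrightarrow> x + y \<in> W" "\<And>a x. a \<in> S \<Longrightarrow> x \<in> W \<Longrightarrow> a *\<^sub>R x \<in> W" "B \<subseteq> W"
  shows "span_over S B \<subseteq> W"
proof
  fix x assume "x \<in> span_over S B"
  then obtain T c where *: "finite T" "T \<subseteq> B" "\<forall>b\<in>T. c b \<in> S" "x = (\<Sum>b\<in>T. c b *\<^sub>R b)"
    by (auto simp: span_over_def)
  have "(\<Sum>b\<in>T. c b *\<^sub>R b) \<in> W"
    using *(1-3)
  proof (induction T rule: finite_induct)
    case (insert b T)
    then have "c b *\<^sub>R b \<in> W" "(\<Sum>b\<in>T. c b *\<^sub>R b) \<in> W"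
      using assms(3,4) by auto
    then show ?case using insert assms(2) by simp
  qed (simp add: assms(1))
  then show "x \<in> W" by (simp add: *)
qed

lemma span_over_finite:
  assumes "finite B" "0 \<in> S"
  shows "span_over S B = {\<Sum>b\<in>B. c b *\<^sub>R b | c. \<forall>b\<in>B. c b \<in> S}"
proof
  show "span_over S B \<subseteq> {\<Sum>b\<in>B. c b *\<^sub>R b | c. \<forall>b\<in>B. c b \<in> S}"
  proof
    fix x assume "x \<in> span_over S B"
    then obtain T c where *: "x = (\<Sum>b\<in>T. c b *\<^sub>R b)" "T \<subseteq> B" "\<forall>b\<in>T. c b \<in> S"
      by (auto simp: span_over_def)
    have "x = (\<Sum>b\<in>B. (if b \<in> T then c b else 0) *\<^sub>R b)"
      unfolding *(1) using assms(1) *(2) by (intro sum.mono_neutral_cong_left) auto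
    then show "x \<in> {\<Sum>b\<in>B. c b *\<^sub>R b | c. \<forall>b\<in>B. c b \<in> S}"
      using * assms(2) by (intro CollectI exI[of _ "\<lambda>b. if b \<in> T then c b else 0"]) auto
  qed
  show "{\<Sum>b\<in>B. c b *\<^sub>R b | c. \<forall>b\<in>B. c b \<in> S} \<subseteq> span_over S B"
    using assms(1) by (auto simp: span_over_def)
qed

lemma common_denominator_rat:
  fixes A :: "'a::field_char_0 set"
  assumes "finite A" "A \<subseteq> \<rat>"
  shows "\<exists>m::nat. m > 0 \<and> (\<forall>a\<in>A. of_nat m * a \<in> \<int>)"
  using assms
proof (induction A rule: finite_induct)
  case (insert a A)
  then obtain m :: nat where m: "m > 0" "\<forall>a\<in>A. of_nat m * a \<in> \<int>" by blast
  have "a \<in> \<rat>" using insert.prems by blast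
  then obtain u v :: int where uv: "v > 0" "a = of_int u / of_int v"
    by (rule Rats_cases')
  define n where "n = nat v"
  have n: "n > 0" "of_nat n = (of_int v :: 'a)" using uv by (simp_all add: n_def)
  have "of_nat n * a = of_int u"
    unfolding n(2) uv(2) using uv(1) by simp
  then have "of_nat (m * n) * a = of_nat m * of_int u"
    by (simp only: of_nat_mult mult.assoc)
  then have "of_nat (m * n) * a \<in> \<int>"
    using Ints_mult[OF Ints_of_nat Ints_of_int, of m u] by (simp only:)
  moreover have "of_nat (m * n) * b \<in> \<int>" if "b \<in> A" for b
  proof -
    have "of_nat (m * n) * b = of_nat n * (of_nat m * b)"
      by (simp only: of_nat_mult ac_simps)
    moreover have "of_nat m * b \<in> \<int>" using m(2) that by blast
    ultimately show ?thesis using Ints_mult[OF Ints_of_nat, of "of_nat m * b" n] by (simp only:)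
  qed
  ultimately show ?case
    using m(1) n(1) by (intro exI[of _ "m * n"]) (simp del: of_nat_mult)
qed (intro exI[of _ 1], simp)

locale number_field =
  fixes K :: "real set"
  assumes real_number_field: "real_number_field K"
begin

abbreviation \<oo> :: "real set" where "\<oo> \<equiv> ring_of_integers K"

lemma K_one: "1 \<in> K" and K_diff: "x \<in> K \<Longrightarrow> y \<in> K \<Longrightarrow> x - y \<in> K"
  and K_mult: "x \<in> K \<Longrightarrow> y \<in> K \<Longrightarrow> x * y \<in> K" and K_inverse: "x \<in> K \<Longrightarrow> inverse x \<in> K"
  using real_number_field by (auto simp: real_number_field_def)

lemma K_zero: "0 \<in> K" using K_diff[OF K_one K_one] by simp

lemma K_minus: "x \<in> K \<Longrightarrow> - x \<in> K" using K_diff[OF K_zero] by simp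

lemma K_add: "x \<in> K \<Longrightarrow> y \<in> K \<Longrightarrow> x + y \<in> K" using K_diff[OF _ K_minus] by force

lemma K_divide: "x \<in> K \<Longrightarrow> y \<in> K \<Longrightarrow> x / y \<in> K" by (simp add: divide_inverse K_mult K_inverse)

lemma K_of_nat: "of_nat n \<in> K" by (induction n) (auto intro: K_zero K_one K_add)

lemma K_of_int: "of_int n \<in> K"
proof (cases "n \<ge> 0")
  case True
  then have "of_int n = (of_nat (nat n) :: real)" by simp
  then show ?thesis using K_of_nat[of "nat n"] by (simp only:)
next
  case False
  then have "of_int n = - (of_nat (nat (- n)) :: real)" by simp
  then show ?thesis using K_minus[OF K_of_nat[of "nat (- n)"]] by (simp only:)
qed

lemma K_of_rat: "of_rat q \<in> K" by (cases q) (simp add: of_rat_rat K_divide K_of_int)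

lemma K_power: "x \<in> K \<Longrightarrow> x ^ n \<in> K" by (induction n) (auto intro: K_one K_mult)

lemma K_rpoly: "x \<in> K \<Longrightarrow> rpoly p x \<in> K"
  by (induction p) (auto intro: K_zero K_add K_mult K_of_rat)

lemma K_span: obtains B where "finite B" "B \<subseteq> K" "K = {\<Sum>b\<in>B. c b * b | c. \<forall>b\<in>B. c b \<in> \<rat>}"
proof -
  obtain B where B: "finite B" "K = span_over \<rat> B"
    using real_number_field by (auto simp: real_number_field_def)
  then have "K = {\<Sum>b\<in>B. c b * b | c. \<forall>b\<in>B. c b \<in> \<rat>}"
    using span_over_finite[OF B(1), of \<rat>] by simp
  moreover have "B \<subseteq> K" unfolding B(2) by (intro subsetI span_over_base) simp_all
  ultimately show thesis using that[OF B(1)] by (simp only:)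
qed

text \<open>Multiplication by \<open>x\<close> is given by a rational matrix on a finite spanning set; clearing its
  denominators makes a multiple of \<open>x\<close> integral.\<close>

lemma integral_multiple:
  assumes "x \<in> K"
  obtains m :: nat where "m > 0" "algebraic_int (of_nat m * x)"
proof -
  obtain B where B: "finite B" "K = {\<Sum>b\<in>B. c b * b | c. \<forall>b\<in>B. c b \<in> \<rat>}" and BK: "B \<subseteq> K"
    by (rule K_span)
  have "\<forall>b\<in>B. \<exists>c. x * b = (\<Sum>b'\<in>B. c b' * b') \<and> (\<forall>b'\<in>B. c b' \<in> \<rat>)"
  proof
    fix b assume "b \<in> B"
    then have "x * b \<in> {\<Sum>b\<in>B. c b * b | c. \<forall>b\<in>B. c b \<in> \<rat>}"
      using K_mult[OF assms subsetD[OF BK]] B(2) by simp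
    then show "\<exists>c. x * b = (\<Sum>b'\<in>B. c b' * b') \<and> (\<forall>b'\<in>B. c b' \<in> \<rat>)"
      by simp
  qed
  from bchoice[OF this] obtain c where
    c': "\<forall>b\<in>B. x * b = (\<Sum>b'\<in>B. c b b' * b') \<and> (\<forall>b'\<in>B. c b b' \<in> \<rat>)" ..
  then have c: "\<And>b. b \<in> B \<Longrightarrow> x * b = (\<Sum>b'\<in>B. c b b' * b')"
      "\<And>b b'. b \<in> B \<Longrightarrow> b' \<in> B \<Longrightarrow> c b b' \<in> \<rat>"
    by simp_all
  obtain m :: nat where m: "m > 0" "\<And>b b'. b \<in> B \<Longrightarrow> b' \<in> B \<Longrightarrow> of_nat m * c b b' \<in> \<int>"
  proof -
    have fin: "finite ((\<lambda>(b, b'). c b b') ` (B \<times> B))" using B(1) by blast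
    have sub: "(\<lambda>(b, b'). c b b') ` (B \<times> B) \<subseteq> \<rat>" using c(2) by auto
    obtain m :: nat where "m > 0" and m: "\<forall>a\<in>(\<lambda>(b, b'). c b b') ` (B \<times> B). of_nat m * a \<in> \<int>"
      using common_denominator_rat[OF fin sub] by blast
    moreover have "of_nat m * c b b' \<in> \<int>" if "b \<in> B" "b' \<in> B" for b b'
      using m[rule_format, of "c b b'"] that by blast
    ultimately show thesis using that by blast
  qed
  obtain b0 where b0: "b0 \<in> B" "b0 \<noteq> 0"
  proof -
    have "\<exists>b\<in>B. b \<noteq> 0"
    proof (rule ccontr)
      assume "\<not> (\<exists>b\<in>B. b \<noteq> 0)"
      then have "(\<Sum>b\<in>B. c b * b) = 0" for c :: "real \<Rightarrow> real" by (intro sum.neutral) simp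
      then have "K = {0} \<or> K = {}" unfolding B(2) by auto
      then show False using K_one by (elim disjE) simp_all
    qed
    then obtain b where "b \<in> B" "b \<noteq> 0" by blast
    then show thesis by (rule that)
  qed
  have mult_b: "of_nat m * x * b = (\<Sum>b'\<in>B. of_int \<lfloor>of_nat m * c b b'\<rfloor> * b')" if "b \<in> B" for b
  proof -
    have "of_nat m * x * b = (\<Sum>b'\<in>B. of_nat m * c b b' * b')"
      unfolding mult.assoc c(1)[OF that] sum_distrib_left ..
    also have "\<dots> = (\<Sum>b'\<in>B. of_int \<lfloor>of_nat m * c b b'\<rfloor> * b')"
    proof (rule sum.cong[OF refl])
      fix b' assume "b' \<in> B"
      then have "of_nat m * c b b' \<in> \<int>" by (rule m(2)[OF that])
      then obtain k where k: "of_nat m * c b b' = of_int k" by (rule Ints_cases)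
      show "of_nat m * c b b' * b' = of_int \<lfloor>of_nat m * c b b'\<rfloor> * b'"
        unfolding k by simp
    qed
    finally show ?thesis .
  qed
  have "algebraic_int (of_nat m * x)"
    by (rule algebraic_int_if_stable'[where I = B and v = "\<lambda>b. b" and c = "\<lambda>b b'. \<lfloor>of_nat m * c b b'\<rfloor>"
        and ?i0.0 = b0, OF B(1) _ b0]) (rule mult_b)
  with m(1) show thesis by (rule that)
qed

lemma K_algebraic:
  assumes "x \<in> K"
  shows "algebraic x"
proof -
  obtain m :: nat where m: "m > 0" "algebraic_int (of_nat m * x)"
    using integral_multiple[OF assms] by blast
  obtain p where p: "p \<noteq> 0" "rpoly p (of_nat m * x) = 0"
    using algebraic_imp_rpoly[OF algebraic_int_imp_algebraic[OF m(2)]] by metis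
  define q where "q = pcompose p [:0, of_nat m:]"
  have "rpoly [:0, of_nat m:] x = of_nat m * x" by (simp add: mult.commute)
  then have "rpoly q x = 0" using p(2) by (simp only: q_def rpoly_pcompose)
  moreover have "q \<noteq> 0" using p(1) m(1) by (simp add: q_def pcompose_eq_0_iff)
  ultimately show ?thesis
    by (intro algebraicI'[of "map_poly of_rat q"]) (simp_all add: rpoly_def)
qed

lemma primitive_combination_K:
  assumes "\<beta> \<in> K" "\<gamma> \<in> K"
  shows "finite {c::nat. \<gamma> \<notin> rat_adjoin (\<beta> + of_nat c * \<gamma>)}"
  by (intro primitive_combination K_algebraic K_add K_mult K_of_nat assms)

definition generator :: "real \<Rightarrow> bool" where
  "generator \<theta> \<longleftrightarrow> \<theta> \<in> K \<and> K \<subseteq> rat_adjoin \<theta>"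

lemma generator_exists: "\<exists>\<theta>. generator \<theta>"
proof -
  obtain B where B: "finite B" "K = {\<Sum>b\<in>B. c b * b | c. \<forall>b\<in>B. c b \<in> \<rat>}" and BK: "B \<subseteq> K"
    by (rule K_span)
  have "\<exists>\<theta>\<in>K. B \<subseteq> rat_adjoin \<theta>"
    using B(1) BK
  proof (induction B rule: finite_induct)
    case empty
    then show ?case using K_zero by blast
  next
    case (insert b B)
    then obtain \<theta> where \<theta>: "\<theta> \<in> K" "B \<subseteq> rat_adjoin \<theta>" by auto
    have bK: "b \<in> K" using insert.prems by simp
    obtain c :: nat where c: "b \<in> rat_adjoin (\<theta> + of_nat c * b)"
      using ex_new_if_finite[OF infinite_UNIV_nat primitive_combination_K[OF \<theta>(1) bK]] by blast
    define \<theta>' where "\<theta>' = \<theta> + of_nat c * b"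
    have b: "b \<in> rat_adjoin \<theta>'" using c by (simp only: \<theta>'_def)
    have "\<theta>' - of_nat c * b \<in> rat_adjoin \<theta>'"
      by (rule rat_adjoin_closed(4)[OF rat_adjoin_closed(1) rat_adjoin_closed(5)[OF rat_adjoin_numbers(3) b]])
    then have "rat_adjoin \<theta> \<subseteq> rat_adjoin \<theta>'"
      by (intro rat_adjoin_mono) (simp add: \<theta>'_def)
    moreover have "\<theta>' \<in> K"
      unfolding \<theta>'_def by (intro K_add K_mult K_of_nat \<theta> bK)
    ultimately have "\<theta>' \<in> K \<and> insert b B \<subseteq> rat_adjoin \<theta>'" using \<theta>(2) b by auto
    then show ?case by blast
  qed
  then obtain \<theta> where \<theta>: "\<theta> \<in> K" "B \<subseteq> rat_adjoin \<theta>" by blast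
  have "(\<Sum>b\<in>B. c b * b) \<in> rat_adjoin \<theta>" if "\<forall>b\<in>B. c b \<in> \<rat>" for c
  proof -
    have "(\<Sum>b\<in>A. c b * b) \<in> rat_adjoin \<theta>" if "A \<subseteq> B" for A
      using finite_subset[OF that B(1)] that
    proof (induction A rule: finite_induct)
      case (insert a A)
      have "a \<in> B" using insert.prems by blast
      then have "c a \<in> \<rat>" "a \<in> rat_adjoin \<theta>" using \<open>\<forall>b\<in>B. c b \<in> \<rat>\<close> \<theta>(2) by auto
      from this(1) obtain q where "c a = of_rat q" by (rule Rats_cases)
      then have "c a * a \<in> rat_adjoin \<theta>"
        using rat_adjoin_closed(5)[OF rat_adjoin_closed(2) \<open>a \<in> rat_adjoin \<theta>\<close>] by simp
      then show ?case using insert rat_adjoin_closed(3) by simp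
    qed (simp add: rat_adjoin_numbers)
    then show ?thesis by blast
  qed
  then have "K \<subseteq> rat_adjoin \<theta>" unfolding B(2) by blast
  then show ?thesis using \<theta>(1) by (auto simp: generator_def)
qed

text \<open>Every element is a quotient of two generators: \<open>\<alpha> = \<alpha> (\<theta> + c) / (\<theta> + c)\<close>, where the numerator
  \<open>\<alpha> \<theta> + c \<alpha>\<close> generates \<open>\<alpha>\<close>, hence \<open>\<theta>\<close>, for all but finitely many \<open>c\<close>.\<close>

lemma generator_multiple:
  assumes "\<alpha> \<in> K" "\<alpha> \<noteq> 0" "generator \<theta>"
  obtains c :: nat where "\<theta> + of_nat c \<noteq> 0" "generator (\<theta> + of_nat c)" "generator (\<alpha> * (\<theta> + of_nat c))"
proof -
  have \<theta>K: "\<theta> \<in> K" using assms(3) by (simp add: generator_def)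
  have "finite {c::nat. \<alpha> \<notin> rat_adjoin (\<alpha> * \<theta> + of_nat c * \<alpha>)}"
    by (rule primitive_combination_K[OF K_mult[OF assms(1) \<theta>K] assms(1)])
  moreover have "finite (of_nat -` {- \<theta>} :: nat set)"
    by (rule finite_vimageI) (simp_all add: inj_on_def)
  ultimately have "finite ({c::nat. \<alpha> \<notin> rat_adjoin (\<alpha> * \<theta> + of_nat c * \<alpha>)} \<union> of_nat -` {- \<theta>})"
    by (rule finite_UnI)
  from ex_new_if_finite[OF infinite_UNIV_nat this]
  obtain c :: nat where c: "\<alpha> \<in> rat_adjoin (\<alpha> * \<theta> + of_nat c * \<alpha>)" "of_nat c \<noteq> - \<theta>"
    by blast
  from c(2) have ne: "\<theta> + of_nat c \<noteq> 0" by (metis add.commute eq_neg_iff_add_eq_0)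
  define \<delta> where "\<delta> = \<alpha> * (\<theta> + of_nat c)"
  have "\<alpha> * \<theta> + of_nat c * \<alpha> = \<delta>" by (simp add: \<delta>_def distrib_left mult.commute)
  with c(1) have \<alpha>: "\<alpha> \<in> rat_adjoin \<delta>" by (simp only:)
  have \<delta>K: "\<delta> \<in> K" unfolding \<delta>_def by (intro K_add K_mult K_of_nat \<theta>K assms)
  have "\<delta> * inverse \<alpha> - of_nat c \<in> rat_adjoin \<delta>"
    by (rule rat_adjoin_closed(4)[OF rat_adjoin_closed(5)[OF rat_adjoin_closed(1)
          rat_adjoin_inverse[OF K_algebraic[OF \<delta>K] \<alpha>]] rat_adjoin_numbers(3)])
  moreover have "\<delta> * inverse \<alpha> - of_nat c = \<theta>" using assms(2) by (simp add: \<delta>_def field_simps)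
  ultimately have "\<theta> \<in> rat_adjoin \<delta>" by (simp only:)
  then have gen: "generator \<delta>"
    using assms(3) rat_adjoin_mono[of \<theta> \<delta>] \<delta>K unfolding generator_def by (meson subset_trans)
  have "\<theta> + of_nat c - of_nat c \<in> rat_adjoin (\<theta> + of_nat c)"
    by (rule rat_adjoin_closed(4)[OF rat_adjoin_closed(1) rat_adjoin_numbers(3)])
  then have "rat_adjoin \<theta> \<subseteq> rat_adjoin (\<theta> + of_nat c)"
    by (intro rat_adjoin_mono) simp
  then have "generator (\<theta> + of_nat c)"
    using assms(3) K_add[OF \<theta>K K_of_nat] unfolding generator_def by blast
  with ne show thesis using gen unfolding \<delta>_def by (rule that)
qed

end

section \<open>Embeddings and the norm of a generator\<close>

lemma abs_norm_mult:
  assumes "x \<in> K" "y \<in> K"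
  shows "abs_norm K (x * y) = abs_norm K x * abs_norm K y"
proof -
  have "(\<Prod>\<sigma>\<in>field_embeddings K. \<sigma> (x * y)) = (\<Prod>\<sigma>\<in>field_embeddings K. \<sigma> x * \<sigma> y)"
    using assms by (intro prod.cong) (auto simp: field_embeddings_def)
  then show ?thesis by (simp add: abs_norm_def prod.distrib norm_mult)
qed

text \<open>A minimal polynomial has no double root \<open>r\<close>: it is the minimal polynomial of \<open>r\<close> as well, and its
  derivative does not vanish there.\<close>

lemma min_poly_splits:
  fixes x :: real
  assumes "is_min_poly f x"
  shows "finite {r::complex. rpoly f r = 0}"
    and "map_poly of_rat f = (\<Prod>r | rpoly f r = 0. [:- r, 1:] :: complex poly)"
proof -
  let ?f = "map_poly of_rat f :: complex poly"
  have "?f \<noteq> 0" using min_poly_nonzero[OF assms] by simp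
  then show "finite {r::complex. rpoly f r = 0}"
    unfolding rpoly_def by (rule poly_roots_finite)
  have "rsquarefree ?f"
    unfolding rsquarefree_roots
  proof (intro allI notI)
    fix a assume *: "poly ?f a = 0 \<and> poly (pderiv ?f) a = 0"
    then have "is_min_poly f a"
      using min_poly_conjugate[OF assms, of a] by (simp add: rpoly_def)
    from min_poly_pderiv[OF this] * show False
      by (simp add: rpoly_def pderiv_map_poly_of_rat)
  qed
  moreover have "lead_coeff ?f = 1"
    using min_poly_monic[OF assms] by simp
  ultimately show "?f = (\<Prod>r | rpoly f r = 0. [:- r, 1:])"
    using complex_poly_decompose_rsquarefree[of ?f] by (simp add: rpoly_def)
qed

lemma rpoly_dvd_root:
  assumes "f dvd p" "rpoly f r = 0"
  shows "rpoly p r = 0"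
proof -
  obtain q where "p = f * q" using assms(1) by (rule dvdE)
  then show ?thesis using assms(2) by simp
qed

lemma min_poly_dvd: "is_min_poly f x \<Longrightarrow> rpoly p x = 0 \<Longrightarrow> f dvd p"
  by (simp only: min_poly_root_iff)

lemma map_poly_of_rat_of_int: "map_poly of_rat (map_poly of_int P) = (map_poly of_int P :: 'a::field_char_0 poly)"
  by (rule poly_eqI) (simp add: coeff_map_poly)

lemma rpoly_of_int_poly: "rpoly (map_poly of_int P) z = poly (map_poly of_int P) z"
  by (simp add: rpoly_def map_poly_of_rat_of_int)

text \<open>Conjugates of algebraic integers are algebraic integers: an integral equation for \<open>h(x)\<close> is a
  rational polynomial vanishing at \<open>x\<close>, hence at every conjugate of \<open>x\<close>.\<close>

lemma conjugate_algebraic_int: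
  fixes x :: real and r :: complex
  assumes "is_min_poly f x" "rpoly f r = 0" "algebraic_int (rpoly h x)"
  shows "algebraic_int (rpoly h r)"
proof -
  obtain P :: "int poly" where P: "poly (map_poly of_int P) (rpoly h x) = 0" "lead_coeff P = 1"
    using assms(3) unfolding algebraic_int_altdef_ipoly by blast
  have "rpoly (pcompose (map_poly of_int P) h) x = 0"
    using P(1) by (simp add: rpoly_of_int_poly)
  then have "f dvd pcompose (map_poly of_int P) h"
    by (rule min_poly_dvd[OF assms(1)])
  then have "rpoly (pcompose (map_poly of_int P) h) r = 0"
    using assms(2) by (rule rpoly_dvd_root)
  then have "poly (map_poly of_int P) (rpoly h r) = 0"
    by (simp add: rpoly_of_int_poly)
  with P(2) show ?thesis
    unfolding algebraic_int_altdef_ipoly by blast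
qed

lemma int_poly_if_algebraic_int:
  assumes "\<And>i. algebraic_int (of_rat (coeff p i) :: complex)"
  shows "p = map_poly of_int (map_poly floor p)"
proof (rule poly_eqI)
  fix i
  have "(of_rat (coeff p i) :: complex) \<in> \<int>"
    using assms by (intro rational_algebraic_int_is_int) simp_all
  then obtain k where "(of_rat (coeff p i) :: complex) = of_int k" by (rule Ints_cases)
  then have "(of_rat (coeff p i) :: complex) = of_rat (of_int k)" by simp
  then have "coeff p i = of_int k" by (simp only: of_rat_eq_iff)
  then show "coeff p i = coeff (map_poly of_int (map_poly floor p)) i"
    by (simp add: coeff_map_poly)
qed

lemma min_poly_integral:
  fixes x :: real
  assumes "is_min_poly f x" "algebraic_int x"
  shows "\<exists>F::int poly. f = map_poly of_int F \<and> lead_coeff F = 1"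
proof -
  have "algebraic_int r" if "rpoly f r = 0" for r :: complex
    using conjugate_algebraic_int[OF assms(1) that, of "[:0, 1:]"] assms(2) by simp
  then have "algebraic_int (coeff (\<Prod>r | rpoly f r = 0. [:- r, 1:] :: complex poly) i)" for i
    by (intro algebraic_int_coeff_prod_roots) simp
  then have "algebraic_int (of_rat (coeff f i) :: complex)" for i
    unfolding min_poly_splits(2)[OF assms(1), symmetric] by simp
  then obtain F :: "int poly" where "f = map_poly of_int F"
    using int_poly_if_algebraic_int by blast
  moreover from this have "lead_coeff F = 1"
    using min_poly_monic[OF assms(1)] by (metis of_int_eq_1_iff of_int_hom.coeff_map_poly_hom of_int_hom.degree_map_poly_hom)
  ultimately show ?thesis by blast
qed

context number_field
begin

lemma embeddingD:
  assumes "\<sigma> \<in> field_embeddings K"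
  shows "\<sigma> 1 = 1" "x \<in> K \<Longrightarrow> y \<in> K \<Longrightarrow> \<sigma> (x + y) = \<sigma> x + \<sigma> y"
    "x \<in> K \<Longrightarrow> y \<in> K \<Longrightarrow> \<sigma> (x * y) = \<sigma> x * \<sigma> y"
  using assms by (auto simp: field_embeddings_def)

lemma embedding_rpoly:
  assumes \<sigma>: "\<sigma> \<in> field_embeddings K" and x: "x \<in> K"
  shows "\<sigma> (rpoly p x) = rpoly p (\<sigma> x)"
proof -
  note add = embeddingD(2)[OF \<sigma>] and mult = embeddingD(3)[OF \<sigma>]
  have zero: "\<sigma> 0 = 0" using add[OF K_zero K_zero] by simp
  have nat: "\<sigma> (of_nat n) = of_nat n" for n
    by (induction n) (simp_all add: zero add K_one K_of_nat embeddingD(1)[OF \<sigma>])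
  have int: "\<sigma> (of_int k) = of_int k" for k
  proof (cases k rule: int_cases2)
    case (nonpos n)
    have "\<sigma> (of_int k + of_nat n) = \<sigma> (of_int k) + of_nat n"
      using add[OF K_of_int K_of_nat] nat by simp
    then show ?thesis using zero nonpos by (simp add: add_eq_0_iff2)
  qed (simp add: nat)
  have rat: "\<sigma> (of_rat q) = of_rat q" for q
  proof (cases q)
    case (Fract a b)
    have "of_rat q * of_int b = (of_int a :: real)" "of_rat q * of_int b = (of_int a :: complex)"
      using Fract by (simp_all add: of_rat_rat)
    moreover from this(1) have "\<sigma> (of_rat q) * of_int b = of_int a"
      using mult[OF K_of_rat K_of_int, of q b] int by simp
    ultimately have "\<sigma> (of_rat q) * of_int b = of_rat q * of_int b" by simp
    then show ?thesis using Fract(2) by simp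
  qed
  show ?thesis
    by (induction p) (simp_all add: zero add mult rat K_of_rat K_mult K_rpoly x)
qed

lemma generator_rpoly:
  assumes "generator \<theta>" "x \<in> K"
  obtains p where "x = rpoly p \<theta>"
proof -
  have "x \<in> range (\<lambda>p. rpoly p \<theta>)"
    using assms unfolding generator_def rat_adjoin_def by (elim conjE) (rule subsetD)
  then show thesis using that by (rule rangeE)
qed

text \<open>An embedding is determined by the image of a generator. Conversely \<open>p(\<theta>) \<mapsto> p(r)\<close> is well defined for
  every root \<open>r\<close>, because \<open>f\<close> divides the polynomials that vanish at \<open>\<theta>\<close>.\<close>

lemma embeddings_roots:
  assumes gen: "generator \<theta>" and f: "is_min_poly f \<theta>"
  shows "bij_betw (\<lambda>\<sigma>. \<sigma> \<theta>) (field_embeddings K) {r. rpoly f r = 0}"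
proof -
  have \<theta>K: "\<theta> \<in> K" using gen by (simp add: generator_def)
  have "inj_on (\<lambda>\<sigma>. \<sigma> \<theta>) (field_embeddings K)"
  proof (rule inj_onI)
    fix \<sigma> \<tau> assume st: "\<sigma> \<in> field_embeddings K" "\<tau> \<in> field_embeddings K" "\<sigma> \<theta> = \<tau> \<theta>"
    have "\<sigma> x = \<tau> x" if "x \<in> K" for x
    proof -
      obtain p where "x = rpoly p \<theta>" using gen \<open>x \<in> K\<close> by (rule generator_rpoly)
      then show ?thesis
        using embedding_rpoly[OF st(1) \<theta>K] embedding_rpoly[OF st(2) \<theta>K] st(3) by simp
    qed
    moreover have "\<sigma> \<in> extensional K" "\<tau> \<in> extensional K"
      using st by (auto simp: field_embeddings_def)
    ultimately show "\<sigma> = \<tau>" using extensionalityI by blast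
  qed
  moreover have "\<sigma> \<theta> \<in> {r. rpoly f r = 0}" if "\<sigma> \<in> field_embeddings K" for \<sigma>
  proof -
    have "\<sigma> (rpoly 0 \<theta>) = rpoly 0 (\<sigma> \<theta>)" "\<sigma> (rpoly f \<theta>) = rpoly f (\<sigma> \<theta>)"
      using embedding_rpoly[OF that \<theta>K] by blast+
    then show ?thesis using min_poly_root[OF f] by simp
  qed
  moreover have "\<exists>\<sigma>\<in>field_embeddings K. r = \<sigma> \<theta>" if r: "rpoly f r = 0" for r
  proof -
    define P where "P x = (SOME p. rpoly p \<theta> = x)" for x
    have P: "rpoly (P x) \<theta> = x" if "x \<in> K" for x
    proof -
      obtain p where "x = rpoly p \<theta>" using gen \<open>x \<in> K\<close> by (rule generator_rpoly)
      from this[symmetric] show ?thesis unfolding P_def by (rule someI)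
    qed
    define \<sigma> where "\<sigma> = restrict (\<lambda>x. rpoly (P x) r) K"
    have \<sigma>_eq: "\<sigma> x = rpoly p r" if "x \<in> K" "rpoly p \<theta> = x" for x p
    proof -
      have "rpoly (P x - p) \<theta> = 0" unfolding rpoly_simps P[OF that(1)] that(2) by (rule diff_self)
      then have "f dvd P x - p" by (rule min_poly_dvd[OF f])
      then have "rpoly (P x - p) r = 0" using r by (rule rpoly_dvd_root)
      then have "rpoly (P x) r = rpoly p r" unfolding rpoly_simps by (simp only: right_minus_eq)
      then show ?thesis unfolding \<sigma>_def restrict_apply if_P[OF that(1)] .
    qed
    have "\<sigma> \<in> field_embeddings K"
      unfolding field_embeddings_def
    proof (intro CollectI conjI ballI)
      show "\<sigma> \<in> extensional K" by (simp add: \<sigma>_def)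
      show "\<sigma> 1 = 1" using \<sigma>_eq[OF K_one rpoly_simps(2)] by (simp only: rpoly_simps)
      fix x y assume xy: "x \<in> K" "y \<in> K"
      show "\<sigma> (x + y) = \<sigma> x + \<sigma> y"
      proof -
        have "rpoly (P x + P y) \<theta> = x + y" unfolding rpoly_simps P[OF xy(1)] P[OF xy(2)] ..
        from \<sigma>_eq[OF K_add[OF xy] this] show ?thesis
          unfolding rpoly_simps \<sigma>_eq[OF xy(1) P[OF xy(1)]] \<sigma>_eq[OF xy(2) P[OF xy(2)]] .
      qed
      show "\<sigma> (x * y) = \<sigma> x * \<sigma> y"
      proof -
        have "rpoly (P x * P y) \<theta> = x * y" unfolding rpoly_simps P[OF xy(1)] P[OF xy(2)] ..
        from \<sigma>_eq[OF K_mult[OF xy] this] show ?thesis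
          unfolding rpoly_simps \<sigma>_eq[OF xy(1) P[OF xy(1)]] \<sigma>_eq[OF xy(2) P[OF xy(2)]] .
      qed
    qed
    moreover have "rpoly [:0, 1:] \<theta> = \<theta>" by simp
    from \<sigma>_eq[OF \<theta>K this] have "r = \<sigma> \<theta>" by simp
    ultimately show ?thesis by (intro bexI[where x = \<sigma>])
  qed
  ultimately show ?thesis unfolding bij_betw_def by blast
qed

text \<open>Up to sign, the constant coefficient of the minimal polynomial is the product of its roots.\<close>

lemma abs_norm_generator:
  assumes gen: "generator \<theta>" and f: "is_min_poly f \<theta>"
  shows "abs_norm K \<theta> = \<bar>of_rat (coeff f 0)\<bar>"
proof -
  let ?A = "{r::complex. rpoly f r = 0}"
  have "(\<Prod>\<sigma>\<in>field_embeddings K. \<sigma> \<theta>) = \<Prod>?A"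
    using prod.reindex_bij_betw[OF embeddings_roots[OF gen f], of "\<lambda>r. r"] .
  moreover have "of_rat (coeff f 0) = (\<Prod>r\<in>?A. - r)"
  proof -
    have "of_rat (coeff f 0) = poly (map_poly of_rat f) (0::complex)"
      by (simp add: poly_0_coeff_0)
    also have "\<dots> = (\<Prod>r\<in>?A. - r)"
      unfolding min_poly_splits(2)[OF f] poly_prod by simp
    finally show ?thesis .
  qed
  moreover have "cmod (\<Prod>r\<in>?A. - r) = cmod (\<Prod>?A)"
    by (simp add: prod_norm[symmetric])
  ultimately have "abs_norm K \<theta> = cmod (of_rat (coeff f 0))"
    by (simp add: abs_norm_def)
  also have "\<dots> = \<bar>of_rat (coeff f 0)\<bar>"
    by (metis norm_of_real of_real_of_rat)
  finally show ?thesis .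
qed

section \<open>The ring of integers and the index of a principal ideal\<close>

lemma oo_K: "x \<in> \<oo> \<Longrightarrow> x \<in> K"
  by (simp add: ring_of_integers_def)

lemma oo_diff: "x \<in> \<oo> \<Longrightarrow> y \<in> \<oo> \<Longrightarrow> x - y \<in> \<oo>"
  and oo_add: "x \<in> \<oo> \<Longrightarrow> y \<in> \<oo> \<Longrightarrow> x + y \<in> \<oo>"
  and oo_mult: "x \<in> \<oo> \<Longrightarrow> y \<in> \<oo> \<Longrightarrow> x * y \<in> \<oo>"
  and oo_minus: "x \<in> \<oo> \<Longrightarrow> - x \<in> \<oo>"
  by (simp_all add: ring_of_integers_def K_diff K_add K_mult K_minus algebraic_int_diff algebraic_int_add algebraic_int_mult)

lemma oo_of_int: "of_int k \<in> \<oo>" and oo_of_nat: "of_nat n \<in> \<oo>"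
  by (simp_all add: ring_of_integers_def K_of_int K_of_nat)

lemma oo_zero: "0 \<in> \<oo>" and oo_one: "1 \<in> \<oo>"
  using oo_of_nat[of 0] oo_of_nat[of 1] by simp_all

lemma oo_power: "x \<in> \<oo> \<Longrightarrow> x ^ n \<in> \<oo>"
  by (induction n) (simp_all add: oo_one oo_mult)

lemma add_subgroup_oo: "add_subgroup \<oo>"
  by (simp add: add_subgroup_def oo_zero oo_diff)

lemma K_denominator:
  assumes "x \<in> K"
  obtains m :: nat where "m > 0" "of_nat m * x \<in> \<oo>"
  using integral_multiple[OF assms] K_mult[OF K_of_nat assms]
  by (metis (no_types, lifting) CollectI ring_of_integers_def)

lemma integral_generator_exists: "\<exists>\<theta>\<in>\<oo>. generator \<theta>"
proof -
  obtain \<theta> where \<theta>: "generator \<theta>" using generator_exists by blast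
  then have \<theta>K: "\<theta> \<in> K" by (simp add: generator_def)
  obtain m :: nat where m: "m > 0" "of_nat m * \<theta> \<in> \<oo>" using K_denominator[OF \<theta>K] by blast
  have "of_rat (1 / of_nat m) * (of_nat m * \<theta>) \<in> rat_adjoin (of_nat m * \<theta>)"
    by (rule rat_adjoin_closed(5)[OF rat_adjoin_closed(2) rat_adjoin_closed(1)])
  moreover have "of_rat (1 / of_nat m) * (of_nat m * \<theta>) = \<theta>"
    using m(1) by (simp add: of_rat_divide)
  ultimately have "rat_adjoin \<theta> \<subseteq> rat_adjoin (of_nat m * \<theta>)"
    by (intro rat_adjoin_mono) (simp only:)
  then have "generator (of_nat m * \<theta>)"
    using \<theta> oo_K[OF m(2)] unfolding generator_def by blast
  with m(2) show ?thesis by blast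
qed

end

definition ipoly :: "int poly \<Rightarrow> real \<Rightarrow> real" where
  "ipoly P x = rpoly (map_poly of_int P) x"

lemma ipoly_simps [simp]:
  "ipoly 0 x = 0" "ipoly (P + Q) x = ipoly P x + ipoly Q x" "ipoly (P - Q) x = ipoly P x - ipoly Q x"
  "ipoly (P * Q) x = ipoly P x * ipoly Q x" "ipoly (pCons a P) x = of_int a + x * ipoly P x"
  "ipoly (Polynomial.smult a P) x = of_int a * ipoly P x"
  by (simp_all add: ipoly_def hom_distribs)

definition int_adjoin :: "real \<Rightarrow> real set" where
  "int_adjoin x = range (\<lambda>P. ipoly P x)"

lemma ipoly_mem: "ipoly P x \<in> int_adjoin x"
  unfolding int_adjoin_def by (rule rangeI)

lemma int_adjoinE:
  assumes "a \<in> int_adjoin x"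
  obtains P where "a = ipoly P x"
  using assms unfolding int_adjoin_def by (rule rangeE)

lemma multiple_int_adjoinE:
  assumes "y \<in> (*) c ` int_adjoin x"
  obtains P where "y = c * ipoly P x"
proof -
  obtain z where z: "y = c * z" "z \<in> int_adjoin x" using assms by (rule imageE)
  from z(2) obtain P where "z = ipoly P x" by (rule int_adjoinE)
  with z(1) have "y = c * ipoly P x" by (simp only:)
  then show thesis by (rule that)
qed

lemma coeff_0_eq_0:
  assumes "coeff p 0 = 0"
  obtains q where "p = pCons 0 q"
  using assms by (cases p rule: pCons_cases) simp

lemma int_adjoin_rep:
  assumes "x \<in> int_adjoin \<theta>"
  shows "ipoly (SOME P. ipoly P \<theta> = x) \<theta> = x"
proof -
  obtain P where "x = ipoly P \<theta>" using assms by (rule int_adjoinE)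
  from this[symmetric] show ?thesis by (rule someI)
qed

lemma add_subgroup_int_adjoin: "add_subgroup (int_adjoin x)"
proof -
  have "a - b \<in> int_adjoin x" if "a \<in> int_adjoin x" "b \<in> int_adjoin x" for a b
    using that ipoly_mem[of "_ - _" x] by (elim int_adjoinE) (simp only: ipoly_simps)
  moreover have "0 \<in> int_adjoin x"
    using ipoly_mem[of 0 x] by (simp only: ipoly_simps)
  ultimately show ?thesis
    unfolding add_subgroup_def by blast
qed

lemma int_adjoin_mult: "a \<in> int_adjoin x \<Longrightarrow> b \<in> int_adjoin x \<Longrightarrow> a * b \<in> int_adjoin x"
  using ipoly_mem[of "_ * _" x] by (elim int_adjoinE) (simp only: ipoly_simps)

lemma int_adjoin_self: "x \<in> int_adjoin x" and int_adjoin_of_int: "of_int k \<in> int_adjoin x"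
proof -
  have "ipoly [:0, 1:] x = x" "ipoly [:k:] x = of_int k" by simp_all
  then show "x \<in> int_adjoin x" "of_int k \<in> int_adjoin x"
    using ipoly_mem[of "[:0, 1:]" x] ipoly_mem[of "[:k:]" x] by (simp_all only:)
qed

text \<open>The minimal polynomial of an algebraic integer in two forms: \<open>f\<close> over the rationals, where it is a
  prime element, and \<open>F\<close> over the integers, where division by it is possible since it is monic.\<close>

locale integral_min_poly =
  fixes \<theta> :: real and f :: "rat poly" and F :: "int poly"
  assumes f: "is_min_poly f \<theta>" and F: "f = map_poly of_int F" and monic: "lead_coeff F = 1"
begin

lemma ipoly_F: "ipoly F \<theta> = 0"
  using min_poly_root[OF f] by (simp add: ipoly_def F)

lemma ipoly_reduce: "ipoly (pseudo_mod P F) \<theta> = ipoly P \<theta>"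
  and degree_reduce: "pseudo_mod P F = 0 \<or> degree (pseudo_mod P F) < degree F"
  and dvd_if_reduce_0: "pseudo_mod P F = 0 \<Longrightarrow> F dvd P"
proof -
  have F0: "F \<noteq> 0" using monic by auto
  obtain Q R where QR: "pseudo_divmod P F = (Q, R)" by fastforce
  then have R: "R = pseudo_mod P F" by (simp add: pseudo_mod_def)
  have P: "P = F * Q + R" using pseudo_divmod(1)[OF F0 QR] monic by simp
  then show "F dvd P" if "pseudo_mod P F = 0" using that R by simp
  have "ipoly P \<theta> = ipoly F \<theta> * ipoly Q \<theta> + ipoly R \<theta>" by (subst P) simp
  then show "ipoly (pseudo_mod P F) \<theta> = ipoly P \<theta>" by (simp add: ipoly_F R)
  show "pseudo_mod P F = 0 \<or> degree (pseudo_mod P F) < degree F"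
    using pseudo_divmod(2)[OF F0 QR] R by simp
qed

lemma ipoly_0_small:
  assumes "ipoly P \<theta> = 0" "P = 0 \<or> degree P < degree F"
  shows "P = 0"
proof (rule ccontr)
  assume "P \<noteq> 0"
  then have "map_poly of_int P \<noteq> (0::rat poly)" by simp
  moreover have "f dvd map_poly of_int P"
    using min_poly_root_iff[OF f] assms(1) by (simp add: ipoly_def)
  ultimately have "degree f \<le> degree (map_poly of_int P :: rat poly)" by (intro dvd_imp_degree_le)
  then show False using assms(2) \<open>P \<noteq> 0\<close> by (simp add: F)
qed

lemma F_dvd: "ipoly P \<theta> = 0 \<Longrightarrow> F dvd P"
  using ipoly_0_small[of "pseudo_mod P F"] ipoly_reduce degree_reduce dvd_if_reduce_0 by simp

lemma degree_F_pos: "degree F > 0"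
  using min_poly_degree_pos[OF f] by (simp add: F)

lemma coeff_F_0:
  assumes "\<theta> \<noteq> 0"
  shows "coeff F 0 \<noteq> 0"
proof
  assume "coeff F 0 = 0"
  then obtain G where G: "F = pCons 0 G" by (rule coeff_0_eq_0)
  then have "ipoly G \<theta> = 0" using ipoly_F assms by simp
  then have "F dvd G" by (rule F_dvd)
  moreover have "G \<noteq> 0" using G monic by auto
  ultimately have "degree F \<le> degree G" by (intro dvd_imp_degree_le)
  then show False using G \<open>G \<noteq> 0\<close> by simp
qed

text \<open>\<open>\<int>[\<theta>] / \<theta>\<int>[\<theta>]\<close> is \<open>\<int> / f(0)\<close>, through the constant coefficient of a representing polynomial.\<close>

lemma mem_multiples_iff: "ipoly P \<theta> \<in> (*) \<theta> ` int_adjoin \<theta> \<longleftrightarrow> coeff F 0 dvd coeff P 0"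
proof
  assume "ipoly P \<theta> \<in> (*) \<theta> ` int_adjoin \<theta>"
  then obtain Q where "ipoly P \<theta> = \<theta> * ipoly Q \<theta>" by (rule multiple_int_adjoinE)
  then have "ipoly (P - pCons 0 Q) \<theta> = 0" by simp
  then have "F dvd P - pCons 0 Q" by (rule F_dvd)
  then obtain H where "P - pCons 0 Q = F * H" by auto
  then have "coeff (P - pCons 0 Q) 0 = coeff F 0 * coeff H 0" by (simp add: coeff_mult_0)
  then show "coeff F 0 dvd coeff P 0" by simp
next
  assume "coeff F 0 dvd coeff P 0"
  then obtain e where e: "coeff P 0 = coeff F 0 * e" by auto
  have const: "coeff (P - Polynomial.smult e F) 0 = 0" using e by simp
  then obtain G where G: "P - Polynomial.smult e F = pCons 0 G" by (rule coeff_0_eq_0)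
  have "ipoly P \<theta> = ipoly (P - Polynomial.smult e F) \<theta>" by (simp add: ipoly_F)
  also have "\<dots> = \<theta> * ipoly G \<theta>" unfolding G by simp
  finally show "ipoly P \<theta> \<in> (*) \<theta> ` int_adjoin \<theta>" using ipoly_mem by (rule image_eqI)
qed

lemma index_int_adjoin:
  assumes "\<theta> \<noteq> 0"
  shows "finite (add_cosets (int_adjoin \<theta>) ((*) \<theta> ` int_adjoin \<theta>))"
    and "add_index (int_adjoin \<theta>) ((*) \<theta> ` int_adjoin \<theta>) = nat \<bar>coeff F 0\<bar>"
proof -
  define n where "n = \<bar>coeff F 0\<bar>"
  have n: "n > 0" using coeff_F_0[OF assms] by (simp add: n_def)
  define P where "P x = (SOME P. ipoly P \<theta> = x)" for x
  have P: "ipoly (P x) \<theta> = x" if "x \<in> int_adjoin \<theta>" for x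
    unfolding P_def using that by (rule int_adjoin_rep)
  define g where "g x = coeff (P x) 0 mod n" for x
  have sg: "add_subgroup ((*) \<theta> ` int_adjoin \<theta>)"
    by (rule add_subgroup_image[OF _ add_subgroup_int_adjoin]) (simp add: Modules.additive_def distrib_left)
  have g: "g x = g y \<longleftrightarrow> x - y \<in> (*) \<theta> ` int_adjoin \<theta>" if "x \<in> int_adjoin \<theta>" "y \<in> int_adjoin \<theta>" for x y
  proof -
    have "x - y = ipoly (P x - P y) \<theta>" using P that by simp
    then show ?thesis
      using mem_multiples_iff[of "P x - P y"] by (simp add: g_def n_def mod_eq_dvd_iff)
  qed
  have "g ` int_adjoin \<theta> = {0..<n}"
  proof
    show "g ` int_adjoin \<theta> \<subseteq> {0..<n}" using n by (auto simp: g_def)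
    show "{0..<n} \<subseteq> g ` int_adjoin \<theta>"
    proof
      fix k assume k: "k \<in> {0..<n}"
      have "ipoly (P (of_int k) - [:k:]) \<theta> = 0"
        using P[OF int_adjoin_of_int] by simp
      also have "0 = \<theta> * ipoly 0 \<theta>" by simp
      finally have "ipoly (P (of_int k) - [:k:]) \<theta> \<in> (*) \<theta> ` int_adjoin \<theta>"
        using ipoly_mem by (rule image_eqI)
      then have "coeff F 0 dvd coeff (P (of_int k) - [:k:]) 0"
        using mem_multiples_iff by blast
      then have "g (of_int k) = k"
        using k mod_eq_dvd_iff[of "coeff (P (of_int k)) 0" n k] by (simp add: g_def n_def)
      then show "k \<in> g ` int_adjoin \<theta>" using int_adjoin_of_int by (metis image_eqI)
    qed
  qed
  then show "finite (add_cosets (int_adjoin \<theta>) ((*) \<theta> ` int_adjoin \<theta>))"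
    "add_index (int_adjoin \<theta>) ((*) \<theta> ` int_adjoin \<theta>) = nat \<bar>coeff F 0\<bar>"
    using add_index_via[OF sg g] by (simp_all add: n_def)
qed

text \<open>The finitely many residues of the coefficients of a representing polynomial of degree less than
  that of \<open>F\<close> separate the cosets.\<close>

lemma finite_index_int_adjoin_multiple:
  assumes "m > 0"
  shows "finite (add_cosets (int_adjoin \<theta>) ((*) (of_nat m) ` int_adjoin \<theta>))"
proof -
  define R where "R x = pseudo_mod (SOME P. ipoly P \<theta> = x) F" for x
  have R: "ipoly (R x) \<theta> = x" "R x = 0 \<or> degree (R x) < degree F" if "x \<in> int_adjoin \<theta>" for x
  proof -
    show "ipoly (R x) \<theta> = x" unfolding R_def ipoly_reduce using that by (rule int_adjoin_rep)
    show "R x = 0 \<or> degree (R x) < degree F" unfolding R_def by (rule degree_reduce)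
  qed
  have sg: "add_subgroup ((*) (of_nat m) ` int_adjoin \<theta>)"
    by (rule add_subgroup_image[OF _ add_subgroup_int_adjoin]) (simp add: Modules.additive_def distrib_left)
  define g where "g x = map (\<lambda>i. coeff (R x) i mod int m) [0..<degree F]" for x
  have g: "g x = g y \<longleftrightarrow> x - y \<in> (*) (of_nat m) ` int_adjoin \<theta>" if xy: "x \<in> int_adjoin \<theta>" "y \<in> int_adjoin \<theta>" for x y
  proof -
    have "g x = g y \<longleftrightarrow> (\<forall>i<degree F. int m dvd coeff (R x - R y) i)"
      by (auto simp: g_def mod_eq_dvd_iff)
    also have "\<dots> \<longleftrightarrow> (\<forall>i. int m dvd coeff (R x - R y) i)"
    proof -
      have "coeff (R x) i = 0" "coeff (R y) i = 0" if "i \<ge> degree F" for i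
        using R(2)[OF xy(1)] R(2)[OF xy(2)] that by (auto intro: coeff_eq_0)
      then have "coeff (R x - R y) i = 0" if "i \<ge> degree F" for i
        using that by simp
      then show ?thesis by (metis dvd_0_right not_le)
    qed
    also have "\<dots> \<longleftrightarrow> (\<exists>Q. R x - R y = Polynomial.smult (int m) Q)"
    proof
      assume *: "\<forall>i. int m dvd coeff (R x - R y) i"
      have "R x - R y = Polynomial.smult (int m) (map_poly (\<lambda>c. c div int m) (R x - R y))"
        using * by (intro poly_eqI) (simp add: coeff_map_poly)
      then show "\<exists>Q. R x - R y = Polynomial.smult (int m) Q" by blast
    next
      assume "\<exists>Q. R x - R y = Polynomial.smult (int m) Q"
      then obtain Q where "R x - R y = Polynomial.smult (int m) Q" ..
      then show "\<forall>i. int m dvd coeff (R x - R y) i" by (simp only: coeff_smult) simp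
    qed
    also have "\<dots> \<longleftrightarrow> x - y \<in> (*) (of_nat m) ` int_adjoin \<theta>"
    proof
      assume "\<exists>Q. R x - R y = Polynomial.smult (int m) Q"
      then obtain Q where "R x - R y = Polynomial.smult (int m) Q" ..
      then have "ipoly (R x - R y) \<theta> = ipoly (Polynomial.smult (int m) Q) \<theta>" by (simp only:)
      then have "x - y = of_nat m * ipoly Q \<theta>" using R(1) xy by simp
      then show "x - y \<in> (*) (of_nat m) ` int_adjoin \<theta>" using ipoly_mem by (rule image_eqI)
    next
      assume "x - y \<in> (*) (of_nat m) ` int_adjoin \<theta>"
      then obtain Q where Q: "x - y = of_nat m * ipoly Q \<theta>" by (rule multiple_int_adjoinE)
      define Q' where "Q' = pseudo_mod Q F"
      have "ipoly (R x - R y - Polynomial.smult (int m) Q') \<theta> = 0"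
        using Q R(1) xy by (simp add: Q'_def ipoly_reduce)
      moreover have "degree (R x - R y - Polynomial.smult (int m) Q') < degree F"
      proof -
        have "degree (R x) < degree F" "degree (R y) < degree F" "degree Q' < degree F"
          using R(2)[OF xy(1)] R(2)[OF xy(2)] degree_reduce[of Q] degree_F_pos by (auto simp: Q'_def)
        then show ?thesis
          using degree_smult_le[of "int m" Q'] by (intro degree_diff_less) auto
      qed
      ultimately have "R x - R y - Polynomial.smult (int m) Q' = 0"
        using ipoly_0_small by blast
      then show "\<exists>Q. R x - R y = Polynomial.smult (int m) Q" by auto
    qed
    finally show ?thesis .
  qed
  have "g ` int_adjoin \<theta> \<subseteq> {xs. set xs \<subseteq> {0..<int m} \<and> length xs = degree F}"
    using assms by (auto simp: g_def)
  moreover have "finite {xs. set xs \<subseteq> {0..<int m} \<and> length xs = degree F}"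
    by (rule finite_lists_length_eq) simp
  ultimately have "finite (g ` int_adjoin \<theta>)" by (rule finite_subset)
  then show ?thesis using add_index_via(1)[OF sg g] by simp
qed

text \<open>Euler's dual basis argument shows \<open>f'(\<theta>) x \<in> \<int>[\<theta>]\<close> for every algebraic integer \<open>x = h(\<theta>)\<close>: the
  polynomial \<open>\<Sum>\<^sub>r h(r) f(T)/(T - r)\<close>, summed over the roots of \<open>f\<close>, has algebraic integers as
  coefficients, and takes at each root the value of \<open>h f'\<close>, so it is the reduction of \<open>h f'\<close> modulo \<open>f\<close>,
  which is rational.\<close>

lemma derivative_multiple:
  assumes "algebraic_int (rpoly h \<theta>)"
  shows "rpoly (pderiv f) \<theta> * rpoly h \<theta> \<in> int_adjoin \<theta>"
proof -
  define A where "A = {r::complex. rpoly f r = 0}"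
  have finA: "finite A" unfolding A_def by (rule min_poly_splits(1)[OF f])
  define fC where "fC = (map_poly of_rat f :: complex poly)"
  have split: "fC = (\<Prod>r\<in>A. [:- r, 1:])"
    unfolding A_def fC_def by (rule min_poly_splits(2)[OF f])
  define u where "u = (h * pderiv f) mod f"
  define uC where "uC = (map_poly of_rat u :: complex poly)"
  define G where "G = (\<Sum>r\<in>A. Polynomial.smult (rpoly h r) (\<Prod>s\<in>A - {r}. [:- s, 1:]))"
  have f0: "f \<noteq> 0" by (rule min_poly_nonzero[OF f])
  have cardA: "card A = degree f"
  proof -
    have "degree fC = (\<Sum>r\<in>A. degree [:- r, 1:])"
      unfolding split by (rule degree_prod_eq_sum_degree) simp
    then show ?thesis by (simp add: fC_def)
  qed
  have prodA: "degree (\<Prod>s\<in>A - {r}. [:- s, 1:] :: complex poly) < degree f" if "r \<in> A" for r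
  proof -
    have "degree (\<Prod>s\<in>A - {r}. [:- s, 1:] :: complex poly) = (\<Sum>s\<in>A - {r}. degree [:- s, 1:])"
      by (rule degree_prod_eq_sum_degree) simp
    also have "\<dots> = card A - 1" using that finA by simp
    finally show ?thesis using cardA min_poly_degree_pos[OF f] by simp
  qed
  have "uC = G"
  proof (rule poly_eqI_degree[of A])
    fix r assume r: "r \<in> A"
    then have fr: "rpoly f r = 0" by (simp add: A_def)
    have "rpoly u r = rpoly (h * pderiv f) r"
    proof -
      have "h * pderiv f = f * (h * pderiv f div f) + u" by (simp add: u_def)
      then have "rpoly (h * pderiv f) r = rpoly (f * (h * pderiv f div f) + u) r" by (simp only:)
      then show ?thesis using fr by (simp only: rpoly_simps) simp
    qed
    moreover have "rpoly (pderiv f) r = (\<Prod>s\<in>A - {r}. r - s)"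
    proof -
      have "fC = [:- r, 1:] * (\<Prod>s\<in>A - {r}. [:- s, 1:])"
        unfolding split using prod.remove[OF finA r] .
      moreover have "poly (pderiv ([:- r, 1:] * q)) r = poly q r" for q
        unfolding pderiv_mult by (simp add: pderiv_pCons)
      ultimately have "poly (pderiv fC) r = poly (\<Prod>s\<in>A - {r}. [:- s, 1:]) r" by (simp only:)
      then show ?thesis by (simp add: fC_def pderiv_map_poly_of_rat rpoly_def poly_prod)
    qed
    moreover have "poly G r = rpoly h r * (\<Prod>s\<in>A - {r}. r - s)"
    proof -
      have "poly (Polynomial.smult (rpoly h t) (\<Prod>s\<in>A - {t}. [:- s, 1:])) r = 0" if "t \<in> A" "t \<noteq> r" for t
        using that r finA by (auto simp: poly_prod intro!: prod_zero)
      then have "poly G r = (\<Sum>t\<in>A. if t = r then poly (Polynomial.smult (rpoly h t) (\<Prod>s\<in>A - {t}. [:- s, 1:])) r else 0)"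
        unfolding G_def poly_sum by (intro sum.cong) auto
      also have "\<dots> = poly (Polynomial.smult (rpoly h r) (\<Prod>s\<in>A - {r}. [:- s, 1:])) r"
        using finA r by simp
      finally show ?thesis by (simp add: poly_prod)
    qed
    ultimately show "poly uC r = poly G r" by (simp add: uC_def rpoly_def[symmetric])
  next
    show "degree uC < card A"
      using degree_mod_less'[of f "h * pderiv f"] f0 min_poly_degree_pos[OF f]
      by (cases "u = 0") (auto simp: uC_def cardA u_def)
    show "degree G < card A"
      unfolding G_def cardA using prodA min_poly_degree_pos[OF f]
      by (intro degree_sum_less) (auto intro: le_less_trans[OF degree_smult_le])
  qed
  have root_int: "algebraic_int r" if "r \<in> A" for r
  proof -
    have "poly (map_poly of_int F) \<theta> = 0"
      using ipoly_F by (simp add: ipoly_def rpoly_of_int_poly)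
    then have "algebraic_int \<theta>"
      unfolding algebraic_int_altdef_ipoly using monic by blast
    then show ?thesis
      using conjugate_algebraic_int[OF f, of r "[:0, 1:]"] that by (simp add: A_def)
  qed
  have "algebraic_int (coeff G i)" for i
    unfolding G_def coeff_sum coeff_smult
  proof (intro algebraic_int_sum algebraic_int_mult)
    fix r assume "r \<in> A"
    then show "algebraic_int (rpoly h r)"
      using conjugate_algebraic_int[OF f _ assms] by (simp add: A_def)
    show "algebraic_int (coeff (\<Prod>s\<in>A - {r}. [:- s, 1:]) i)"
      using root_int by (intro algebraic_int_coeff_prod_roots) auto
  qed
  then have "algebraic_int (of_rat (coeff u i) :: complex)" for i
    unfolding \<open>uC = G\<close>[symmetric] uC_def by simp
  then have "u = map_poly of_int (map_poly floor u)" by (rule int_poly_if_algebraic_int)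
  then have "rpoly u \<theta> = ipoly (map_poly floor u) \<theta>" by (simp add: ipoly_def)
  moreover have "rpoly u \<theta> = rpoly (pderiv f) \<theta> * rpoly h \<theta>"
  proof -
    have "h * pderiv f = f * (h * pderiv f div f) + u" by (simp add: u_def)
    then have "rpoly (h * pderiv f) \<theta> = rpoly (f * (h * pderiv f div f) + u) \<theta>" by (simp only:)
    then show ?thesis using min_poly_root[OF f] by (simp only: rpoly_simps) (simp add: mult.commute)
  qed
  ultimately show ?thesis using ipoly_mem by (simp only:)
qed

end

context number_field
begin

lemma additive_times: "Modules.additive ((*) (a::real))"
  by (simp add: Modules.additive_def distrib_left)

lemma inj_times: "a \<noteq> 0 \<Longrightarrow> inj ((*) (a::real))"
  by (simp add: inj_on_def)

text \<open>\<open>\<int>[\<theta>]\<close> has finite index in the ring of integers, so both give the same index of \<open>\<theta>\<close>.\<close>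

lemma index_generator:
  assumes gen: "generator \<theta>" and int: "\<theta> \<in> \<oo>" and ne: "\<theta> \<noteq> 0"
  shows "finite (add_cosets \<oo> ((*) \<theta> ` \<oo>))" "real (add_index \<oo> ((*) \<theta> ` \<oo>)) = abs_norm K \<theta>"
proof -
  have alg: "algebraic_int \<theta>" and \<theta>K: "\<theta> \<in> K" using int by (auto simp: ring_of_integers_def)
  obtain f where f: "is_min_poly f \<theta>" using algebraic_min_poly[OF algebraic_int_imp_algebraic[OF alg]] by blast
  obtain F where F: "f = map_poly of_int F" "lead_coeff F = 1" using min_poly_integral[OF f alg] by blast
  interpret integral_min_poly \<theta> f F by unfold_locales (fact f F)+
  define M where "M = int_adjoin \<theta>"
  have M: "add_subgroup M" unfolding M_def by (rule add_subgroup_int_adjoin)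
  have M_oo: "M \<subseteq> \<oo>"
  proof -
    have "ipoly P \<theta> \<in> \<oo>" for P
      by (induction P) (simp_all add: oo_zero oo_add oo_mult oo_of_int int)
    then show ?thesis unfolding M_def by (blast elim: int_adjoinE)
  qed
  define b where "b = rpoly (pderiv f) \<theta>"
  have b: "b \<noteq> 0" "b \<in> K"
    using min_poly_pderiv[OF f] K_rpoly[OF \<theta>K] by (simp_all add: b_def)
  \<comment> \<open>A denominator \<open>m\<close> of \<open>1/f'(\<theta>)\<close> maps the integers into \<open>f'(\<theta>) \<oo>\<close>, hence into \<open>\<int>[\<theta>]\<close>.\<close>
  obtain m :: nat where m: "m > 0" "of_nat m * inverse b \<in> \<oo>"
    using K_denominator[OF K_inverse[OF b(2)]] by blast
  have m_oo: "of_nat m * x \<in> M" if "x \<in> \<oo>" for x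
  proof -
    have x': "of_nat m * inverse b * x \<in> \<oo>" using oo_mult[OF m(2) that] .
    obtain h where h: "of_nat m * inverse b * x = rpoly h \<theta>"
      using gen oo_K[OF x'] by (rule generator_rpoly)
    have "algebraic_int (rpoly h \<theta>)" using x' h by (simp add: ring_of_integers_def)
    from derivative_multiple[OF this] have "b * rpoly h \<theta> \<in> M"
      by (simp only: M_def b_def)
    moreover have "b * rpoly h \<theta> = of_nat m * x" unfolding h[symmetric] using b(1) by simp
    ultimately show ?thesis by (simp only:)
  qed
  \<comment> \<open>Multiplication by \<open>m\<close> identifies \<open>\<oo>/M\<close> with a subgroup of the finite group \<open>M/mM\<close>.\<close>
  have fin: "finite (add_cosets \<oo> M)"
  proof -
    have mne: "real m \<noteq> 0" using m(1) by simp
    have "finite (add_cosets M ((*) (real m) ` M))"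
      unfolding M_def by (rule finite_index_int_adjoin_multiple[OF m(1)])
    moreover have "(*) (real m) ` \<oo> \<subseteq> M" using m_oo by (rule image_subsetI)
    ultimately have "finite (add_cosets ((*) (real m) ` \<oo>) ((*) (real m) ` M))"
      by (rule finite_add_cosets_mono[OF _ _ subset_refl]) (intro add_subgroup_image additive_times M)+
    then show ?thesis
      unfolding add_index_image(2)[OF additive_times inj_times[OF mne] M] .
  qed
  have "(*) \<theta> ` M \<subseteq> M" "(*) \<theta> ` \<oo> \<subseteq> \<oo>"
    using int_adjoin_mult[OF int_adjoin_self] oo_mult[OF int] by (auto simp: M_def)
  note endo = add_index_endo_commensurable[OF additive_times inj_times[OF ne] add_subgroup_oo M M_oo this fin]
  show "finite (add_cosets \<oo> ((*) \<theta> ` \<oo>))"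
    using endo(2) index_int_adjoin(1)[OF ne] by (simp add: M_def)
  show "real (add_index \<oo> ((*) \<theta> ` \<oo>)) = abs_norm K \<theta>"
    using endo(1) index_int_adjoin(2)[OF ne] abs_norm_generator[OF gen f] by (simp add: M_def F(1))
qed

text \<open>Index and norm are multiplicative, and every element is a quotient of two generators.\<close>

lemma index_principal:
  assumes "\<alpha> \<in> \<oo>" "\<alpha> \<noteq> 0"
  shows "finite (add_cosets \<oo> ((*) \<alpha> ` \<oo>))" "real (add_index \<oo> ((*) \<alpha> ` \<oo>)) = abs_norm K \<alpha>"
proof -
  obtain \<theta> where \<theta>: "\<theta> \<in> \<oo>" "generator \<theta>" using integral_generator_exists by blast
  obtain c :: nat where c: "\<theta> + of_nat c \<noteq> 0" "generator (\<theta> + of_nat c)" "generator (\<alpha> * (\<theta> + of_nat c))"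
    using generator_multiple[OF oo_K[OF assms(1)] assms(2) \<theta>(2)] by blast
  define \<gamma> where "\<gamma> = \<theta> + of_nat c"
  have \<gamma>: "\<gamma> \<in> \<oo>" "\<gamma> \<noteq> 0" using c(1) \<theta>(1) by (simp_all add: \<gamma>_def oo_add oo_of_nat)
  have ig: "finite (add_cosets \<oo> ((*) \<gamma> ` \<oo>))" "real (add_index \<oo> ((*) \<gamma> ` \<oo>)) = abs_norm K \<gamma>"
    using index_generator[OF _ \<gamma>] c(2) by (simp_all add: \<gamma>_def)
  have ia: "finite (add_cosets \<oo> ((*) (\<alpha> * \<gamma>) ` \<oo>))" "real (add_index \<oo> ((*) (\<alpha> * \<gamma>) ` \<oo>)) = abs_norm K (\<alpha> * \<gamma>)"
    using index_generator[OF _ oo_mult[OF assms(1) \<gamma>(1)]] c(3) assms(2) \<gamma>(2) by (simp_all add: \<gamma>_def)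
  have im: "(*) (\<alpha> * \<gamma>) ` \<oo> = (*) \<alpha> ` (*) \<gamma> ` \<oo>" by (simp add: image_image mult.assoc)
  have sub: "(*) \<gamma> ` \<oo> \<subseteq> \<oo>" "(*) \<alpha> ` \<oo> \<subseteq> \<oo>" using oo_mult \<gamma>(1) assms(1) by auto
  have sg: "add_subgroup ((*) \<gamma> ` \<oo>)" "add_subgroup ((*) \<alpha> ` \<oo>)" "add_subgroup ((*) \<alpha> ` (*) \<gamma> ` \<oo>)"
    by (intro add_subgroup_image additive_times add_subgroup_oo)+
  have tower: "add_index \<oo> ((*) (\<alpha> * \<gamma>) ` \<oo>) = add_index \<oo> ((*) \<alpha> ` \<oo>) * add_index \<oo> ((*) \<gamma> ` \<oo>)"
    "finite (add_cosets \<oo> ((*) (\<alpha> * \<gamma>) ` \<oo>)) \<longleftrightarrow> finite (add_cosets \<oo> ((*) \<alpha> ` \<oo>)) \<and> finite (add_cosets \<oo> ((*) \<gamma> ` \<oo>))"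
    unfolding im add_index_tower[OF add_subgroup_oo sg(2,3) image_mono[OF sub(1)] sub(2)]
      add_index_image[OF additive_times inj_times[OF assms(2)] sg(1)] by (rule refl)+
  show "finite (add_cosets \<oo> ((*) \<alpha> ` \<oo>))" using tower(2) ia(1) by blast
  have "abs_norm K \<gamma> > 0"
  proof -
    have "\<oo> \<noteq> {}" using oo_zero by blast
    from add_index_pos[OF ig(1) this] show ?thesis unfolding ig(2)[symmetric] by simp
  qed
  moreover have "real (add_index \<oo> ((*) \<alpha> ` \<oo>)) * abs_norm K \<gamma> = abs_norm K \<alpha> * abs_norm K \<gamma>"
    unfolding ig(2)[symmetric] of_nat_mult[symmetric] tower(1)[symmetric] ia(2)
    unfolding ig(2) by (rule abs_norm_mult[OF oo_K[OF assms(1)] oo_K[OF \<gamma>(1)]])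
  ultimately show "real (add_index \<oo> ((*) \<alpha> ` \<oo>)) = abs_norm K \<alpha>" by simp
qed

end

section \<open>Class number one\<close>

context number_field
begin

definition oo_module :: "'a::real_vector set \<Rightarrow> bool" where
  "oo_module M \<longleftrightarrow> add_subgroup M \<and> (\<forall>a\<in>\<oo>. \<forall>x\<in>M. a *\<^sub>R x \<in> M)"

lemma oo_moduleD:
  assumes "oo_module M"
  shows "add_subgroup M" "0 \<in> M" "x \<in> M \<Longrightarrow> y \<in> M \<Longrightarrow> x + y \<in> M"
    "x \<in> M \<Longrightarrow> y \<in> M \<Longrightarrow> x - y \<in> M" "x \<in> M \<Longrightarrow> - x \<in> M" "a \<in> \<oo> \<Longrightarrow> x \<in> M \<Longrightarrow> a *\<^sub>R x \<in> M"
  using assms unfolding oo_module_def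
  by (simp_all add: add_subgroup_zero add_subgroup_add add_subgroup_diff add_subgroup_minus)

lemma span_over_subset_module:
  assumes "oo_module W" "B \<subseteq> W"
  shows "span_over \<oo> B \<subseteq> W"
  by (rule span_over_least) (simp_all add: oo_moduleD[OF assms(1)] assms(2))

lemma oo_module_span:
  assumes "finite B"
  shows "oo_module (span_over \<oo> B)"
  unfolding oo_module_def add_subgroup_def span_over_finite[OF assms oo_zero]
proof (intro conjI ballI)
  let ?S = "{\<Sum>b\<in>B. c b *\<^sub>R b | c. \<forall>b\<in>B. c b \<in> \<oo>}"
  show "0 \<in> ?S"
    by (intro CollectI exI[of _ "\<lambda>_. 0"]) (simp add: oo_zero)
  fix x assume "x \<in> ?S"
  then obtain c where c: "x = (\<Sum>b\<in>B. c b *\<^sub>R b)" "\<forall>b\<in>B. c b \<in> \<oo>" by blast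
  show "x - y \<in> ?S" if "y \<in> ?S" for y
  proof -
    from that obtain d where d: "y = (\<Sum>b\<in>B. d b *\<^sub>R b)" "\<forall>b\<in>B. d b \<in> \<oo>" by blast
    have "x - y = (\<Sum>b\<in>B. (c b - d b) *\<^sub>R b)"
      unfolding c(1) d(1) by (simp add: sum_subtractf scaleR_diff_left)
    then show ?thesis
      using c(2) d(2) oo_diff by (intro CollectI exI[of _ "\<lambda>b. c b - d b"]) simp
  qed
  show "a *\<^sub>R x \<in> ?S" if "a \<in> \<oo>" for a
  proof -
    have "a *\<^sub>R x = (\<Sum>b\<in>B. (a * c b) *\<^sub>R b)"
      unfolding c(1) by (simp add: scaleR_sum_right)
    then show ?thesis
      using c(2) that oo_mult by (intro CollectI exI[of _ "\<lambda>b. a * c b"]) simp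
  qed
qed

text \<open>Coset representatives together with generators of the submodule generate the whole module.\<close>

lemma finitely_generated_if_finite_index:
  assumes "finite B" "oo_module A" "span_over \<oo> B \<subseteq> A" "finite (add_cosets A (span_over \<oo> B))"
  shows "\<exists>B'. finite B' \<and> A = span_over \<oo> B'"
proof -
  let ?P = "span_over \<oo> B"
  have P: "oo_module ?P" by (rule oo_module_span[OF assms(1)])
  define s where "s C = (SOME x. x \<in> A \<and> (+) x ` ?P = C)" for C
  have s: "s C \<in> A \<and> (+) (s C) ` ?P = C" if "C \<in> add_cosets A ?P" for C
  proof -
    from that obtain x where "x \<in> A \<and> (+) x ` ?P = C" by (auto simp: add_cosets_def)
    then show ?thesis unfolding s_def by (rule someI)
  qed
  define B' where "B' = B \<union> s ` add_cosets A ?P"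
  have fin: "finite B'" using assms(1,4) by (simp add: B'_def)
  have mod: "oo_module (span_over \<oo> B')" by (rule oo_module_span[OF fin])
  have base: "B' \<subseteq> span_over \<oo> B'" using span_over_base[OF oo_one] by blast
  have "?P \<subseteq> span_over \<oo> B'"
    using base by (intro span_over_subset_module mod) (simp add: B'_def)
  have "A \<subseteq> span_over \<oo> B'"
  proof
    fix x assume x: "x \<in> A"
    define C where "C = (+) x ` ?P"
    have C: "C \<in> add_cosets A ?P" using x by (auto simp: C_def add_cosets_def)
    have "x - s C \<in> ?P"
      using s[OF C] coset_eq_iff[OF oo_moduleD(1)[OF P], of x "s C"] by (simp add: C_def)
    then have "x - s C \<in> span_over \<oo> B'" using \<open>?P \<subseteq> span_over \<oo> B'\<close> by blast
    moreover have "s C \<in> span_over \<oo> B'" using base C by (auto simp: B'_def)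
    ultimately have "(x - s C) + s C \<in> span_over \<oo> B'" by (rule oo_moduleD(3)[OF mod])
    then show "x \<in> span_over \<oo> B'" by simp
  qed
  moreover have "span_over \<oo> B' \<subseteq> A"
  proof (rule span_over_subset_module[OF assms(2)])
    have "B \<subseteq> ?P" using span_over_base[OF oo_one] by blast
    then show "B' \<subseteq> A" using assms(3) s by (auto simp: B'_def)
  qed
  ultimately show ?thesis using fin by blast
qed

lemma span_over_singleton: "span_over \<oo> {b} = (\<lambda>a. a *\<^sub>R b) ` \<oo>"
  unfolding span_over_finite[OF finite.insertI[OF finite.emptyI] oo_zero]
proof (intro subset_antisym subsetI)
  fix x assume "x \<in> {\<Sum>b\<in>{b}. c b *\<^sub>R b | c. \<forall>b\<in>{b}. c b \<in> \<oo>}"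
  then show "x \<in> (\<lambda>a. a *\<^sub>R b) ` \<oo>" by auto
next
  fix x assume "x \<in> (\<lambda>a. a *\<^sub>R b) ` \<oo>"
  then obtain a where "a \<in> \<oo>" "x = a *\<^sub>R b" by blast
  then show "x \<in> {\<Sum>b\<in>{b}. c b *\<^sub>R b | c. \<forall>b\<in>{b}. c b \<in> \<oo>}"
    by (intro CollectI exI[of _ "\<lambda>_. a"]) simp
qed

lemma common_denominator:
  assumes "finite A" "A \<subseteq> K"
  shows "\<exists>m::nat. m > 0 \<and> (\<forall>a\<in>A. of_nat m * a \<in> \<oo>)"
  using assms
proof (induction A rule: finite_induct)
  case (insert a A)
  then obtain m :: nat where m: "m > 0" "\<forall>a\<in>A. of_nat m * a \<in> \<oo>" by blast
  have "a \<in> K" using insert.prems by blast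
  then obtain n :: nat where n: "n > 0" "of_nat n * a \<in> \<oo>" by (rule K_denominator)
  have "of_nat (m * n) * a \<in> \<oo>"
    using oo_mult[OF oo_of_nat n(2), of m] by (simp only: of_nat_mult mult.assoc)
  moreover have "of_nat (m * n) * b \<in> \<oo>" if "b \<in> A" for b
  proof -
    have "of_nat m * b \<in> \<oo>" using m(2) that by blast
    from oo_mult[OF oo_of_nat this, of n] show ?thesis
      by (simp only: of_nat_mult ac_simps)
  qed
  ultimately show ?case
    using m(1) n(1) by (intro exI[of _ "m * n"]) (simp del: of_nat_mult)
qed (intro exI[of _ 1], simp)

abbreviation nrm :: "real \<Rightarrow> nat" where
  "nrm a \<equiv> add_index \<oo> ((*) a ` \<oo>)"

lemma nrm_pos: "a \<in> \<oo> \<Longrightarrow> a \<noteq> 0 \<Longrightarrow> nrm a > 0"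
  using add_index_pos[OF index_principal(1)] oo_zero by blast

lemma nrm_mult:
  assumes "a \<in> \<oo>" "a \<noteq> 0" "b \<in> \<oo>" "b \<noteq> 0"
  shows "nrm (a * b) = nrm a * nrm b"
proof -
  have "real (nrm (a * b)) = real (nrm a) * real (nrm b)"
    using index_principal(2)[OF oo_mult[OF assms(1,3)]] index_principal(2)[OF assms(1,2)]
      index_principal(2)[OF assms(3,4)] abs_norm_mult[OF oo_K[OF assms(1)] oo_K[OF assms(3)]] assms(2,4)
    by (simp only: mult_eq_0_iff) simp
  then show ?thesis by (simp only: of_nat_mult[symmetric] of_nat_eq_iff)
qed

lemma nrm_eq_1:
  assumes "a \<in> \<oo>" "nrm a = 1"
  shows "inverse a \<in> \<oo>"
proof -
  have "(*) a ` \<oo> \<subseteq> \<oo>" using oo_mult assms(1) by auto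
  then have "\<oo> = (*) a ` \<oo>"
    using add_index_eq_1_imp[OF add_subgroup_image[OF additive_times add_subgroup_oo]] assms(2) by blast
  then have "1 \<in> (*) a ` \<oo>" using oo_one by simp
  then obtain b where b: "1 = a * b" "b \<in> \<oo>" by (rule imageE)
  then show ?thesis by (metis inverse_unique)
qed

lemma nrm_power: "a \<in> \<oo> \<Longrightarrow> a \<noteq> 0 \<Longrightarrow> nrm (a ^ k) = nrm a ^ k"
proof (induction k)
  case 0
  have "(*) 1 ` \<oo> = \<oo>" by simp
  then show ?case using add_index_same(2)[OF add_subgroup_oo] by simp
next
  case (Suc k)
  then show ?case using nrm_mult[OF Suc.prems oo_power[OF Suc.prems(1), of k]] by simp
qed

end

locale class_number_one = number_field +
  assumes class_number: "field_class_number K = 1"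
begin

text \<open>A quotient set with a single element puts any two of its points in relation, because each
  point is related to itself by the scalar \<open>1\<close>.\<close>

lemma principal_fractional_ideal:
  assumes "fractional_ideal K A"
  obtains r where "r \<in> K" "r \<noteq> 0" "A = (*) r ` \<oo>"
proof -
  let ?rel = "{(A, B). fractional_ideal K A \<and> fractional_ideal K B \<and> (\<exists>x\<in>K - {0}. B = (*) x ` A)}"
  obtain C where C: "{A. fractional_ideal K A} // ?rel = {C}"
    using class_number unfolding field_class_number_def by (auto simp: card_1_singleton_iff)
  have "\<oo> = span_over \<oo> {1}" by (simp add: span_over_singleton)
  then have "\<exists>B. finite B \<and> \<oo> = span_over \<oo> B" by (intro exI[of _ "{1}"] conjI) simp_all
  moreover have "\<oo> \<subseteq> K" "\<oo> \<noteq> {0}" using oo_K oo_one by auto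
  ultimately have oo: "fractional_ideal K \<oo>" unfolding fractional_ideal_def by blast
  have "?rel `` {A} = C" "?rel `` {\<oo>} = C"
    using C assms oo quotientI[of A "{A. fractional_ideal K A}" ?rel]
      quotientI[of \<oo> "{A. fractional_ideal K A}" ?rel] by simp_all
  moreover have "(\<oo>, \<oo>) \<in> ?rel"
    using oo K_one by (auto intro!: bexI[of _ 1])
  then have "\<oo> \<in> ?rel `` {\<oo>}" by (rule ImageI) simp
  ultimately have "\<oo> \<in> ?rel `` {A}" by (simp only:)
  then have "(A, \<oo>) \<in> ?rel" by (simp only: Image_singleton_iff)
  then have "\<exists>x\<in>K - {0}. \<oo> = (*) x ` A" by (simp only: mem_Collect_eq case_prod_conv)
  then obtain x where x: "x \<in> K" "x \<noteq> 0" "\<oo> = (*) x ` A" by auto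
  have "A = (*) (inverse x) ` \<oo>"
    unfolding x(3) image_image using x(2) by (simp add: mult.assoc[symmetric])
  with x that[of "inverse x"] show thesis by (simp add: K_inverse)
qed

text \<open>An integral ideal containing \<open>m \<noteq> 0\<close> is finitely generated because \<open>m \<oo>\<close> has finite index in it.\<close>

lemma principal_ideal:
  fixes A :: "real set"
  assumes "oo_module A" "A \<subseteq> \<oo>" "m \<in> A" "m \<noteq> 0"
  obtains r where "r \<in> \<oo>" "r \<noteq> 0" "A = (*) r ` \<oo>"
proof -
  have m: "m \<in> \<oo>" using assms by blast
  have P: "span_over \<oo> {m} = (*) m ` \<oo>" by (simp add: span_over_singleton mult.commute)
  have sub: "span_over \<oo> {m} \<subseteq> A"
    using oo_moduleD(6)[OF assms(1) _ assms(3)] unfolding span_over_singleton by blast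
  have "finite (add_cosets A (span_over \<oo> {m}))"
    using index_principal(1)[OF m assms(4)] assms(2) unfolding P
    by (rule finite_add_cosets_mono[OF _ _ subset_refl]) (intro add_subgroup_image additive_times add_subgroup_oo)+
  then have "\<exists>B. finite B \<and> A = span_over \<oo> B"
    using finitely_generated_if_finite_index[of "{m}" A] assms(1) sub by simp
  moreover have "A \<subseteq> K" "A \<noteq> {0}" using assms oo_K by auto
  ultimately have "fractional_ideal K A" unfolding fractional_ideal_def by blast
  then obtain r where r: "r \<noteq> 0" "A = (*) r ` \<oo>" by (rule principal_fractional_ideal)
  have "r * 1 \<in> A" unfolding r(2) using oo_one by (rule imageI)
  then have "r \<in> \<oo>" using assms(2) by auto
  with r that show thesis by blast
qed

text \<open>Bounded denominators of all powers force integrality: with \<open>\<oo> + c\<oo> = r\<oo>\<close> and \<open>s = 1/r\<close>, every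
  power of \<open>s\<close> divides \<open>D\<close>, so \<open>s\<close> is a unit by comparing norms.\<close>

lemma integral_if_bounded_powers:
  assumes c: "c \<in> K" and D: "D \<in> \<oo>" "D \<noteq> 0" and bounded: "\<And>k. D * c ^ k \<in> \<oo>"
  shows "c \<in> \<oo>"
proof -
  have fin: "finite {1, c}" by simp
  have mod: "oo_module (span_over \<oo> {1, c})" by (rule oo_module_span[OF fin])
  have mem: "1 \<in> span_over \<oo> {1, c}" "c \<in> span_over \<oo> {1, c}"
    by (simp_all add: span_over_base[OF oo_one])
  have "span_over \<oo> {1, c} \<subseteq> K"
    by (rule span_over_least) (auto intro: K_zero K_add K_mult oo_K K_one c)
  moreover have "span_over \<oo> {1, c} \<noteq> {0}"
  proof
    assume "span_over \<oo> {1, c} = {0}"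
    then have "1 \<in> {0::real}" using mem(1) by (simp only:)
    then show False by simp
  qed
  ultimately have "fractional_ideal K (span_over \<oo> {1, c})"
    unfolding fractional_ideal_def using fin by blast
  then obtain r where r: "r \<in> K" "r \<noteq> 0" "span_over \<oo> {1, c} = (*) r ` \<oo>"
    by (rule principal_fractional_ideal)
  have r1: "r * 1 \<in> span_over \<oo> {1, c}" unfolding r(3) using oo_one by (rule imageI)
  obtain s where s: "1 = r * s" "s \<in> \<oo>" using mem(1) unfolding r(3) by (rule imageE)
  obtain t where t: "c = r * t" "t \<in> \<oo>" using mem(2) unfolding r(3) by (rule imageE)
  have s0: "s \<noteq> 0" using s(1) by auto
  obtain a b where ab: "a \<in> \<oo>" "b \<in> \<oo>" "r = a + b * c"
  proof -
    let ?W = "{x. \<exists>a b. a \<in> \<oo> \<and> b \<in> \<oo> \<and> x = a + b * c}"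
    have "span_over \<oo> {1, c} \<subseteq> ?W"
    proof (rule span_over_least)
      show "0 \<in> ?W" by (intro CollectI exI[of _ 0]) (simp add: oo_zero)
      show "x + y \<in> ?W" if "x \<in> ?W" "y \<in> ?W" for x y
      proof -
        from that obtain a b a' b' where "a \<in> \<oo>" "b \<in> \<oo>" "x = a + b * c" "a' \<in> \<oo>" "b' \<in> \<oo>" "y = a' + b' * c"
          by blast
        then show ?thesis
          by (intro CollectI exI[of _ "a + a'"] exI[of _ "b + b'"]) (simp add: oo_add distrib_right)
      qed
      show "k *\<^sub>R x \<in> ?W" if "k \<in> \<oo>" "x \<in> ?W" for k x
      proof -
        from that obtain a b where "a \<in> \<oo>" "b \<in> \<oo>" "x = a + b * c" by blast
        then show ?thesis using that(1)
          by (intro CollectI exI[of _ "k * a"] exI[of _ "k * b"]) (simp add: oo_mult distrib_left mult.assoc)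
      qed
      have "1 \<in> ?W" by (intro CollectI exI[of _ 1] exI[of _ 0]) (simp add: oo_zero oo_one)
      moreover have "c \<in> ?W" by (intro CollectI exI[of _ 0] exI[of _ 1]) (simp add: oo_zero oo_one)
      ultimately show "{1, c} \<subseteq> ?W" by blast
    qed
    then have "r * 1 \<in> ?W" using r1 by (rule subsetD)
    then have "\<exists>a b. a \<in> \<oo> \<and> b \<in> \<oo> \<and> r = a + b * c" by simp
    then show thesis using that by (elim exE conjE)
  qed
  have "D * c ^ j * r ^ k \<in> \<oo>" for j k
  proof (induction k arbitrary: j)
    case (Suc k)
    have "D * c ^ j * r ^ Suc k = a * (D * c ^ j * r ^ k) + b * (D * c ^ Suc j * r ^ k)"
      by (simp add: ab(3) algebra_simps)
    then show ?case using Suc ab(1,2) by (simp only: oo_add oo_mult)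
  qed (simp add: bounded)
  from this[of 0] have Dr: "D * r ^ k \<in> \<oo>" for k by simp
  have bound: "nrm s ^ k \<le> nrm D" for k
  proof -
    have D_eq: "D = D * r ^ k * s ^ k"
      using s(1) by (metis mult.assoc mult.right_neutral power_mult_distrib power_one)
    have ne: "D * r ^ k \<noteq> 0" using D(2) r(2) by simp
    have "nrm D = nrm (D * r ^ k) * nrm (s ^ k)"
      by (subst D_eq, rule nrm_mult[OF Dr ne oo_power[OF s(2)]]) (simp add: s0)
    then have "nrm D = nrm (D * r ^ k) * nrm s ^ k"
      by (simp only: nrm_power[OF s(2) s0])
    moreover have "nrm (D * r ^ k) \<ge> 1" using nrm_pos[OF Dr ne] by simp
    ultimately show ?thesis by simp
  qed
  have "nrm s = 1"
  proof (rule ccontr)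
    assume "nrm s \<noteq> 1"
    then have "nrm s \<ge> 2" using nrm_pos[OF s(2) s0] by simp
    then have "(2::nat) ^ k \<le> nrm D" for k
      using bound[of k] power_mono[of 2 "nrm s" k] by simp
    then have "(2::nat) ^ nrm D \<le> nrm D" .
    then show False using less_exp[of "nrm D"] by simp
  qed
  then have "inverse s \<in> \<oo>" by (rule nrm_eq_1[OF s(2)])
  moreover have "inverse s = r" using s(1) s0 by (metis inverse_unique mult.commute)
  ultimately show ?thesis using t oo_mult by simp
qed

text \<open>The quadratic equation reduces all powers of \<open>c\<close> to \<open>\<oo> + \<oo> c\<close>, where denominators are bounded.\<close>

lemma quadratic_integral:
  assumes "c \<in> K" "t \<in> \<oo>" "c\<^sup>2 + c * t \<in> \<oo>"
  shows "c \<in> \<oo>"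
proof -
  obtain m :: nat where m: "m > 0" "of_nat m * c \<in> \<oo>" using K_denominator[OF assms(1)] by blast
  have "\<exists>a\<in>\<oo>. \<exists>b\<in>\<oo>. c ^ k = a + b * c" for k
  proof (induction k)
    case 0
    show ?case by (intro bexI[of _ 1] bexI[of _ 0]) (simp_all add: oo_one oo_zero)
  next
    case (Suc k)
    then obtain a b where ab: "a \<in> \<oo>" "b \<in> \<oo>" "c ^ k = a + b * c" by blast
    have "c ^ Suc k = b * (c\<^sup>2 + c * t) + (a - b * t) * c"
      by (simp add: ab(3) algebra_simps power2_eq_square)
    then show ?case using ab(1,2) assms(2,3) oo_mult oo_diff by blast
  qed
  then have "of_nat m * c ^ k \<in> \<oo>" for k
  proof -
    obtain a b where ab: "a \<in> \<oo>" "b \<in> \<oo>" "c ^ k = a + b * c"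
      using \<open>\<And>k. \<exists>a\<in>\<oo>. \<exists>b\<in>\<oo>. c ^ k = a + b * c\<close> by blast
    have "of_nat m * c ^ k = of_nat m * a + b * (of_nat m * c)" by (simp add: ab(3) algebra_simps)
    then show ?thesis using ab(1,2) m(2) by (simp only: oo_add oo_mult oo_of_nat)
  qed
  then show ?thesis
    using m(1) by (intro integral_if_bounded_powers[OF assms(1) oo_of_nat[of m]]) simp_all
qed

end

section \<open>Quaternions\<close>

lemma quat_sel [simp]:
  "q0 0 = 0" "q1 0 = 0" "q2 0 = 0" "q3 0 = 0" "q0 1 = 1" "q1 1 = 0" "q2 1 = 0" "q3 1 = 0"
  "q0 (x + y) = q0 x + q0 y" "q1 (x + y) = q1 x + q1 y" "q2 (x + y) = q2 x + q2 y" "q3 (x + y) = q3 x + q3 y"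
  "q0 (x - y) = q0 x - q0 y" "q1 (x - y) = q1 x - q1 y" "q2 (x - y) = q2 x - q2 y" "q3 (x - y) = q3 x - q3 y"
  "q0 (- x) = - q0 x" "q1 (- x) = - q1 x" "q2 (- x) = - q2 x" "q3 (- x) = - q3 x"
  "q0 (r *\<^sub>R x) = r * q0 x" "q1 (r *\<^sub>R x) = r * q1 x" "q2 (r *\<^sub>R x) = r * q2 x" "q3 (r *\<^sub>R x) = r * q3 x"
  "q0 (qcnj x) = q0 x" "q1 (qcnj x) = - q1 x" "q2 (qcnj x) = - q2 x" "q3 (qcnj x) = - q3 x"
  by (simp_all add: quat_ops_def qcnj_def)

lemma quat_sel_mult:
  "q0 (x * y) = q0 x * q0 y - q1 x * q1 y - q2 x * q2 y - q3 x * q3 y"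
  "q1 (x * y) = q0 x * q1 y + q1 x * q0 y + q2 x * q3 y - q3 x * q2 y"
  "q2 (x * y) = q0 x * q2 y - q1 x * q3 y + q2 x * q0 y + q3 x * q1 y"
  "q3 (x * y) = q0 x * q3 y + q1 x * q2 y - q2 x * q1 y + q3 x * q0 y"
  by (simp_all add: times_quat_def)

definition qtr :: "quat \<Rightarrow> real" where
  "qtr x = 2 * q0 x"

lemma qcnj_simps:
  "qcnj (x + y) = qcnj x + qcnj y" "qcnj (x - y) = qcnj x - qcnj y" "qcnj (x * y) = qcnj y * qcnj x"
  "qcnj (r *\<^sub>R x) = r *\<^sub>R qcnj x" "qcnj (qcnj x) = x" "qcnj 0 = 0" "qcnj 1 = 1"
  by (simp_all add: quat_eq_iff quat_sel_mult)

lemma qtr_simps: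
  "qtr (x + y) = qtr x + qtr y" "qtr (x - y) = qtr x - qtr y" "qtr (r *\<^sub>R x) = r * qtr x"
  "qtr (qcnj x) = qtr x" "qtr 0 = 0" "qtr 1 = 2"
  by (simp_all add: qtr_def algebra_simps)

lemma qtr_commute: "qtr (x * y) = qtr (y * x)"
  by (simp add: qtr_def quat_sel_mult)

lemma qcnj_eq: "qcnj x = qtr x *\<^sub>R 1 - x"
  by (simp add: quat_eq_iff qtr_def)

lemma qnr_mult: "qnr (x * y) = qnr x * qnr y"
  by (simp add: qnr_def quat_sel_mult power2_eq_square algebra_simps)

lemma qnr_scaleR: "qnr (r *\<^sub>R x) = r\<^sup>2 * qnr x"
  by (simp add: qnr_def power_mult_distrib distrib_left)

lemma qnr_qcnj [simp]: "qnr (qcnj x) = qnr x"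
  by (simp add: qnr_def)

lemma qnr_numbers [simp]: "qnr 0 = 0" "qnr 1 = 1"
  by (simp_all add: qnr_def)

lemma qnr_eq_0_iff [simp]: "qnr x = 0 \<longleftrightarrow> x = 0"
  using qnr_pos[of x] by fastforce

lemma qcnj_eq_0_iff [simp]: "qcnj x = 0 \<longleftrightarrow> x = 0"
  by (simp add: quat_eq_iff)

lemma qnr_diff: "qnr (x - y) = qnr x + qnr y - qtr (x * qcnj y)"
  by (simp add: qnr_def qtr_def quat_sel_mult power2_eq_square algebra_simps)

lemma qnr_add: "qnr (x + y) = qnr x + qnr y + qtr (x * qcnj y)"
  by (simp add: qnr_def qtr_def quat_sel_mult power2_eq_square algebra_simps)

lemma qnr_power: "qnr (x ^ k) = qnr x ^ k"
  by (induction k) (simp_all add: qnr_mult)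

lemma additive_quat:
  "Modules.additive ((*) (q::quat))" "Modules.additive (\<lambda>x. x * (q::quat))" "Modules.additive ((*\<^sub>R) r :: quat \<Rightarrow> quat)"
  "Modules.additive qcnj"
  by (simp_all add: Modules.additive_def distrib_left distrib_right scaleR_add_right qcnj_simps)

lemma inj_quat:
  "q \<noteq> 0 \<Longrightarrow> inj ((*) (q::quat))" "q \<noteq> 0 \<Longrightarrow> inj (\<lambda>x. x * (q::quat))" "r \<noteq> 0 \<Longrightarrow> inj ((*\<^sub>R) r :: quat \<Rightarrow> quat)"
  "inj qcnj"
proof -
  show "inj qcnj" by (rule inj_on_inverseI[of _ qcnj]) (simp add: qcnj_simps)
qed (simp_all add: inj_on_def)

text \<open>A pure quaternion orthogonal to the imaginary part of \<open>q\<close> anticommutes with it.\<close>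

lemma conjugating_pure:
  defines "u q \<equiv> if q1 q = 0 \<and> q2 q = 0 then Quat 0 1 0 0 else Quat 0 (- q2 q) (q1 q) 0"
  shows "u q \<noteq> 0" "qcnj q * u q = u q * q"
  by (auto simp: u_def quat_eq_iff quat_sel_mult)

section \<open>Maximal orders of class number one\<close>

context number_field
begin

abbreviation \<H> :: "quat set" where "\<H> \<equiv> quat_alg K"

lemma H_closed:
  "x \<in> \<H> \<Longrightarrow> y \<in> \<H> \<Longrightarrow> x + y \<in> \<H>" "x \<in> \<H> \<Longrightarrow> y \<in> \<H> \<Longrightarrow> x - y \<in> \<H>"
  "x \<in> \<H> \<Longrightarrow> y \<in> \<H> \<Longrightarrow> x * y \<in> \<H>" "x \<in> \<H> \<Longrightarrow> qcnj x \<in> \<H>" "a \<in> K \<Longrightarrow> x \<in> \<H> \<Longrightarrow> a *\<^sub>R x \<in> \<H>"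
  "0 \<in> \<H>" "1 \<in> \<H>"
  by (simp_all add: quat_alg_def quat_sel_mult K_add K_diff K_mult K_minus K_zero K_one)

lemma K_qnr: "x \<in> \<H> \<Longrightarrow> qnr x \<in> K"
  by (simp add: quat_alg_def qnr_def K_add K_power)

lemma H_inverse: "x \<in> \<H> \<Longrightarrow> inverse x \<in> \<H>"
  by (simp add: inverse_quat_def H_closed K_divide K_one K_qnr)

text \<open>For the quaternions with integral coordinates, cosets are determined coordinate by coordinate.\<close>

lemma index_scalar_quaternions:
  assumes a: "a \<in> \<oo>" "a \<noteq> 0"
  defines "\<Lambda> \<equiv> {x. q0 x \<in> \<oo> \<and> q1 x \<in> \<oo> \<and> q2 x \<in> \<oo> \<and> q3 x \<in> \<oo>}"
  shows "add_index \<Lambda> ((*\<^sub>R) a ` \<Lambda>) = nrm a ^ 4" "finite (add_cosets \<Lambda> ((*\<^sub>R) a ` \<Lambda>))" "add_subgroup \<Lambda>"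
proof -
  let ?A = "(*) a ` \<oo>"
  have A: "add_subgroup ?A" by (rule add_subgroup_image[OF additive_times add_subgroup_oo])
  show sg: "add_subgroup \<Lambda>"
    by (simp add: \<Lambda>_def add_subgroup_def oo_zero oo_diff)
  have mem: "x \<in> (*\<^sub>R) a ` \<Lambda> \<longleftrightarrow> q0 x \<in> ?A \<and> q1 x \<in> ?A \<and> q2 x \<in> ?A \<and> q3 x \<in> ?A" for x
  proof
    assume "x \<in> (*\<^sub>R) a ` \<Lambda>"
    then show "q0 x \<in> ?A \<and> q1 x \<in> ?A \<and> q2 x \<in> ?A \<and> q3 x \<in> ?A" by (auto simp: \<Lambda>_def)
  next
    assume "q0 x \<in> ?A \<and> q1 x \<in> ?A \<and> q2 x \<in> ?A \<and> q3 x \<in> ?A"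
    then obtain b0 b1 b2 b3 where b: "b0 \<in> \<oo>" "b1 \<in> \<oo>" "b2 \<in> \<oo>" "b3 \<in> \<oo>"
      "q0 x = a * b0" "q1 x = a * b1" "q2 x = a * b2" "q3 x = a * b3" by blast
    then have "x = a *\<^sub>R Quat b0 b1 b2 b3" by (simp add: quat_eq_iff)
    then show "x \<in> (*\<^sub>R) a ` \<Lambda>" by (rule image_eqI) (simp add: \<Lambda>_def b)
  qed
  define c where "c t = (+) t ` ?A" for t
  have c: "c s = c t \<longleftrightarrow> s - t \<in> ?A" for s t
    unfolding c_def by (rule coset_eq_iff[OF A])
  define f where "f x = (c (q0 x), c (q1 x), c (q2 x), c (q3 x))" for x
  have f: "f x = f y \<longleftrightarrow> x - y \<in> (*\<^sub>R) a ` \<Lambda>" for x y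
    unfolding mem f_def prod.inject c by simp
  let ?C = "add_cosets \<oo> ?A"
  have im: "f ` \<Lambda> = ?C \<times> ?C \<times> ?C \<times> ?C"
  proof (intro subset_antisym subsetI)
    fix p assume "p \<in> f ` \<Lambda>"
    then show "p \<in> ?C \<times> ?C \<times> ?C \<times> ?C" by (auto simp: f_def c_def \<Lambda>_def add_cosets_def)
  next
    fix p assume "p \<in> ?C \<times> ?C \<times> ?C \<times> ?C"
    then obtain b0 b1 b2 b3 where b: "b0 \<in> \<oo>" "b1 \<in> \<oo>" "b2 \<in> \<oo>" "b3 \<in> \<oo>" "p = (c b0, c b1, c b2, c b3)"
      by (auto simp: add_cosets_def c_def)
    have "p = f (Quat b0 b1 b2 b3)" by (simp add: f_def b(5))
    then show "p \<in> f ` \<Lambda>" by (rule image_eqI) (simp add: \<Lambda>_def b)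
  qed
  have sgA: "add_subgroup ((*\<^sub>R) a ` \<Lambda>)" by (rule add_subgroup_image[OF additive_quat(3) sg])
  show "add_index \<Lambda> ((*\<^sub>R) a ` \<Lambda>) = nrm a ^ 4"
    using add_index_via(2)[OF sgA, of \<Lambda> f] f im
    by (simp add: card_cartesian_product add_index_def power4_eq_xxxx)
  have "finite ?C" by (rule index_principal(1)[OF a])
  then show "finite (add_cosets \<Lambda> ((*\<^sub>R) a ` \<Lambda>))"
    using add_index_via(1)[OF sgA, of \<Lambda> f] f im by simp
qed

end

text \<open>The finite sums of products \<open>a q b\<close>, generated one summand at a time so that statements linear in
  the ideal reduce to the products by induction.\<close>

inductive_set two_sided_ideal :: "quat set \<Rightarrow> quat \<Rightarrow> quat set" for L q where
  zero: "0 \<in> two_sided_ideal L q"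
| step: "x \<in> two_sided_ideal L q \<Longrightarrow> a \<in> L \<Longrightarrow> b \<in> L \<Longrightarrow> x + a * q * b \<in> two_sided_ideal L q"

locale maximal_order_class_one = class_number_one +
  fixes L :: "quat set"
  assumes quat_class_number: "has_quat_class_number K 1" and max_order: "maximal_order K L"
begin

lemma L_order: "quat_order K L"
  using max_order by (simp add: maximal_order_def)

lemma L_ideal: "quat_ideal K L"
  using L_order by (simp add: quat_order_def)

lemma L_one: "1 \<in> L" and L_mult: "x \<in> L \<Longrightarrow> y \<in> L \<Longrightarrow> x * y \<in> L"
  using L_order by (simp_all add: quat_order_def)

lemma L_span: obtains B where "finite B" "L = span_over \<oo> B"
  using L_ideal by (auto simp: quat_ideal_def)

lemma L_module: "oo_module L"
proof -
  obtain B where "finite B" "L = span_over \<oo> B" by (rule L_span)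
  then show ?thesis using oo_module_span[of B] by simp
qed

lemmas add_subgroup_L = oo_moduleD(1)[OF L_module] and L_zero = oo_moduleD(2)[OF L_module]
  and L_add = oo_moduleD(3)[OF L_module] and L_diff = oo_moduleD(4)[OF L_module]
  and L_scale = oo_moduleD(6)[OF L_module]

lemma span_K_L: "span_over K L = \<H>"
  using L_ideal by (simp add: quat_ideal_def)

lemma L_H: "x \<in> L \<Longrightarrow> x \<in> \<H>"
  using span_over_base[OF K_one, of x L] by (simp add: span_K_L)

lemma L_power: "x \<in> L \<Longrightarrow> x ^ k \<in> L"
  by (induction k) (simp_all add: L_one L_mult)

lemma L_denominator:
  assumes "x \<in> \<H>"
  obtains m :: nat where "m > 0" "of_nat m *\<^sub>R x \<in> L"
proof -
  have "x \<in> span_over K L" using assms span_K_L by simp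
  then obtain T c where T: "finite T" "T \<subseteq> L" "\<forall>b\<in>T. c b \<in> K" "x = (\<Sum>b\<in>T. c b *\<^sub>R b)"
    by (auto simp: span_over_def)
  have "finite (c ` T)" "c ` T \<subseteq> K" using T by auto
  then obtain m :: nat where m: "m > 0" "\<forall>a\<in>c ` T. of_nat m * a \<in> \<oo>"
    using common_denominator by blast
  have "of_nat m *\<^sub>R x = (\<Sum>b\<in>T. (of_nat m * c b) *\<^sub>R b)"
    by (simp add: T(4) scaleR_sum_right)
  also have "\<dots> \<in> L"
    using m(2) T(2) by (intro add_subgroup_sum[OF add_subgroup_L] L_scale) auto
  finally show thesis using m(1) that by blast
qed

lemma L_coordinates:
  obtains m :: nat where "m > 0"
    "\<And>x. x \<in> L \<Longrightarrow> of_nat m * q0 x \<in> \<oo> \<and> of_nat m * q1 x \<in> \<oo> \<and> of_nat m * q2 x \<in> \<oo> \<and> of_nat m * q3 x \<in> \<oo>"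
proof -
  obtain B where B: "finite B" "L = span_over \<oo> B" by (rule L_span)
  have BL: "B \<subseteq> L" unfolding B(2) by (intro subsetI span_over_base[OF oo_one])
  define A where "A = q0 ` B \<union> q1 ` B \<union> q2 ` B \<union> q3 ` B"
  have "finite A" "A \<subseteq> K" using B(1) BL L_H by (auto simp: A_def quat_alg_def)
  then obtain m :: nat where m: "m > 0" "\<forall>a\<in>A. of_nat m * a \<in> \<oo>"
    using common_denominator by blast
  define W where "W = {x. of_nat m * q0 x \<in> \<oo> \<and> of_nat m * q1 x \<in> \<oo> \<and> of_nat m * q2 x \<in> \<oo> \<and> of_nat m * q3 x \<in> \<oo>}"
  have "L \<subseteq> W"
    unfolding B(2)
  proof (rule span_over_least)
    show "0 \<in> W" by (simp add: W_def oo_zero)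
    show "x + y \<in> W" if "x \<in> W" "y \<in> W" for x y
      using that by (simp add: W_def distrib_left oo_add)
    show "a *\<^sub>R x \<in> W" if "a \<in> \<oo>" "x \<in> W" for a x
    proof -
      have "of_nat m * (a * y) = a * (of_nat m * y)" for y :: real by simp
      then show ?thesis using that by (simp only: W_def mem_Collect_eq quat_sel oo_mult)
    qed
    show "B \<subseteq> W" using m(2) by (auto simp: W_def A_def)
  qed
  then show thesis using that[OF m(1)] by (auto simp: W_def)
qed

text \<open>The coordinates of the powers of \<open>x \<in> L\<close> have a common denominator, hence so have the powers of
  the norm of \<open>x\<close>.\<close>

lemma qnr_integral:
  assumes "x \<in> L"
  shows "qnr x \<in> \<oo>"
proof -
  obtain m :: nat where m: "m > 0"
    "\<And>x. x \<in> L \<Longrightarrow> of_nat m * q0 x \<in> \<oo> \<and> of_nat m * q1 x \<in> \<oo> \<and> of_nat m * q2 x \<in> \<oo> \<and> of_nat m * q3 x \<in> \<oo>"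
    using L_coordinates by blast
  have "(of_nat m)\<^sup>2 * qnr x ^ k \<in> \<oo>" for k
  proof -
    have "(of_nat m)\<^sup>2 * qnr x ^ k = (of_nat m)\<^sup>2 * qnr (x ^ k)" by (simp add: qnr_power)
    also have "\<dots> = (of_nat m * q0 (x ^ k))\<^sup>2 + (of_nat m * q1 (x ^ k))\<^sup>2 + (of_nat m * q2 (x ^ k))\<^sup>2 + (of_nat m * q3 (x ^ k))\<^sup>2"
      by (simp add: qnr_def power_mult_distrib distrib_left)
    also have "\<dots> \<in> \<oo>"
      using m(2)[OF L_power[OF assms, of k]] by (intro oo_add oo_power) simp_all
    finally show ?thesis .
  qed
  then show ?thesis
    using m(1) by (intro integral_if_bounded_powers[OF K_qnr[OF L_H[OF assms]] oo_power[OF oo_of_nat[of m], of 2]]) simp_all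
qed

lemma qtr_integral: "x \<in> L \<Longrightarrow> qtr x \<in> \<oo>"
proof -
  assume x: "x \<in> L"
  have "qtr x = qnr (x + 1) - qnr x - 1"
    by (simp add: qnr_add qcnj_simps)
  then show ?thesis
    using x L_add[OF x L_one] by (simp only: oo_diff qnr_integral oo_one)
qed

lemma oo_L: "a \<in> \<oo> \<Longrightarrow> a *\<^sub>R 1 \<in> L"
  by (rule L_scale[OF _ L_one])

lemma L_qcnj: "x \<in> L \<Longrightarrow> qcnj x \<in> L"
  unfolding qcnj_eq by (intro L_diff oo_L qtr_integral)

lemma L_qcnj_image: "qcnj ` L = L"
proof (intro subset_antisym subsetI)
  fix x assume "x \<in> L"
  then show "x \<in> qcnj ` L" using L_qcnj by (intro image_eqI[of _ _ "qcnj x"]) (simp_all add: qcnj_simps)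
qed (auto intro: L_qcnj)

lemma real_in_L:
  assumes "a *\<^sub>R 1 \<in> L"
  shows "a \<in> \<oo>"
proof -
  have "a \<in> K" using L_H[OF assms] by (simp add: quat_alg_def)
  moreover have "a\<^sup>2 + a * 0 \<in> \<oo>" using qnr_integral[OF assms] by (simp add: qnr_scaleR)
  ultimately show ?thesis using quadratic_integral[OF _ oo_zero] by blast
qed

subsection \<open>Indices of one-sided ideals\<close>

text \<open>\<open>L\<close> is commensurable with the module \<open>\<Lambda>\<close> of quaternions with integral coordinates: some multiple of
  either lies in the other. So the index of a scalar multiplication can be computed in \<open>\<Lambda>\<close>.\<close>

lemma index_scalar:
  assumes a: "a \<in> \<oo>" "a \<noteq> 0"
  shows "add_index L ((*\<^sub>R) a ` L) = nrm a ^ 4" "finite (add_cosets L ((*\<^sub>R) a ` L))"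
proof -
  define \<Lambda> where "\<Lambda> = {x. q0 x \<in> \<oo> \<and> q1 x \<in> \<oo> \<and> q2 x \<in> \<oo> \<and> q3 x \<in> \<oo>}"
  note \<Lambda> = index_scalar_quaternions[folded \<Lambda>_def]
  have sg: "add_subgroup \<Lambda>" by (rule \<Lambda>(3)[OF a])
  obtain m :: nat where m: "m > 0" and m_\<Lambda>: "(*\<^sub>R) (of_nat m) ` L \<subseteq> \<Lambda>"
  proof -
    obtain m :: nat where m: "m > 0"
      "\<And>x. x \<in> L \<Longrightarrow> of_nat m * q0 x \<in> \<oo> \<and> of_nat m * q1 x \<in> \<oo> \<and> of_nat m * q2 x \<in> \<oo> \<and> of_nat m * q3 x \<in> \<oo>"
      using L_coordinates by blast
    have "(*\<^sub>R) (of_nat m) ` L \<subseteq> \<Lambda>"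
      using m(2) by (intro image_subsetI) (simp add: \<Lambda>_def)
    with m(1) show thesis by (rule that)
  qed
  obtain n :: nat where n: "n > 0" and n_L: "(*\<^sub>R) (of_nat n) ` \<Lambda> \<subseteq> L"
  proof -
    obtain n1 :: nat where n1: "n1 > 0" "of_nat n1 *\<^sub>R Quat 0 1 0 0 \<in> L"
      by (rule L_denominator[of "Quat 0 1 0 0"]) (simp_all add: quat_alg_def K_zero K_one)
    obtain n2 :: nat where n2: "n2 > 0" "of_nat n2 *\<^sub>R Quat 0 0 1 0 \<in> L"
      by (rule L_denominator[of "Quat 0 0 1 0"]) (simp_all add: quat_alg_def K_zero K_one)
    obtain n3 :: nat where n3: "n3 > 0" "of_nat n3 *\<^sub>R Quat 0 0 0 1 \<in> L"
      by (rule L_denominator[of "Quat 0 0 0 1"]) (simp_all add: quat_alg_def K_zero K_one)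
    define n where "n = n1 * n2 * n3"
    have "of_nat n *\<^sub>R x \<in> L" if "x \<in> \<Lambda>" for x
    proof -
      have x: "q0 x \<in> \<oo>" "q1 x \<in> \<oo>" "q2 x \<in> \<oo>" "q3 x \<in> \<oo>" using that by (simp_all add: \<Lambda>_def)
      have "of_nat n *\<^sub>R x = (of_nat n * q0 x) *\<^sub>R 1 + (of_nat (n2 * n3) * q1 x) *\<^sub>R (of_nat n1 *\<^sub>R Quat 0 1 0 0)
          + (of_nat (n1 * n3) * q2 x) *\<^sub>R (of_nat n2 *\<^sub>R Quat 0 0 1 0)
          + (of_nat (n1 * n2) * q3 x) *\<^sub>R (of_nat n3 *\<^sub>R Quat 0 0 0 1)"
        by (simp add: quat_eq_iff n_def)
      also have "\<dots> \<in> L"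
        by (intro L_add L_scale oo_mult oo_of_nat x n1(2) n2(2) n3(2) L_one)
      finally show ?thesis .
    qed
    then have "(*\<^sub>R) (of_nat n) ` \<Lambda> \<subseteq> L" by (intro image_subsetI)
    moreover have "n > 0" using n1(1) n2(1) n3(1) by (simp add: n_def)
    ultimately show thesis using that by blast
  qed
  let ?M = "(*\<^sub>R) (of_nat n) ` \<Lambda>"
  have scale_comp: "(*\<^sub>R) s ` (*\<^sub>R) t ` X = (*\<^sub>R) (s * t) ` X" for s t and X :: "quat set"
    by (simp add: image_image)
  have M: "add_subgroup ?M" by (rule add_subgroup_image[OF additive_quat(3) sg])
  have n0: "of_nat n \<noteq> (0::real)" "of_nat m \<noteq> (0::real)" using n m by simp_all
  \<comment> \<open>Scaling by \<open>m\<close> identifies \<open>L/n\<Lambda>\<close> with a subgroup of the finite group \<open>\<Lambda>/mn\<Lambda>\<close>.\<close>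
  have fin: "finite (add_cosets L ?M)"
  proof -
    have mn: "of_nat m * of_nat n \<in> \<oo>" "of_nat m * of_nat n \<noteq> (0::real)"
      using n0 by (simp_all add: oo_mult oo_of_nat)
    have "finite (add_cosets \<Lambda> ((*\<^sub>R) (of_nat m * of_nat n) ` \<Lambda>))" by (rule \<Lambda>(2)[OF mn])
    then have "finite (add_cosets ((*\<^sub>R) (of_nat m) ` L) ((*\<^sub>R) (of_nat m * of_nat n) ` \<Lambda>))"
      using m_\<Lambda> by (rule finite_add_cosets_mono[OF _ _ subset_refl]) (intro add_subgroup_image additive_quat sg)+
    then show ?thesis
      unfolding scale_comp[symmetric] add_index_image(2)[OF additive_quat(3) inj_quat(3)[OF n0(2)] M] .
  qed
  have "(*\<^sub>R) a ` L \<subseteq> L" using L_scale[OF a(1)] by (intro image_subsetI)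
  moreover have a_comm: "(*\<^sub>R) a ` ?M = (*\<^sub>R) (of_nat n) ` (*\<^sub>R) a ` \<Lambda>"
    by (simp only: scale_comp mult.commute)
  moreover have "(*\<^sub>R) a ` \<Lambda> \<subseteq> \<Lambda>"
    using oo_mult[OF a(1)] by (intro image_subsetI) (simp add: \<Lambda>_def)
  ultimately have stable: "(*\<^sub>R) a ` ?M \<subseteq> ?M" "(*\<^sub>R) a ` L \<subseteq> L"
    using image_mono by (simp_all only:)
  note endo = add_index_endo_commensurable[OF additive_quat(3) inj_quat(3)[OF a(2)] add_subgroup_L M n_L stable fin]
  note im = add_index_image[OF additive_quat(3) inj_quat(3)[OF n0(1)] add_subgroup_image[OF additive_quat(3) sg]]
  show "add_index L ((*\<^sub>R) a ` L) = nrm a ^ 4"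
    unfolding endo(1) a_comm im(1) by (rule \<Lambda>(1)[OF a])
  show "finite (add_cosets L ((*\<^sub>R) a ` L))"
    unfolding endo(2) a_comm im(2) by (rule \<Lambda>(2)[OF a])
qed

lemma left_mult_sub: "q \<in> L \<Longrightarrow> (*) q ` L \<subseteq> L" and right_mult_sub: "q \<in> L \<Longrightarrow> (\<lambda>x. x * q) ` L \<subseteq> L"
  by (auto intro: L_mult)

lemma add_subgroup_mult: "add_subgroup ((*) q ` L)" "add_subgroup ((\<lambda>x. x * q) ` L)" "add_subgroup ((*\<^sub>R) a ` L)"
  by (intro add_subgroup_image additive_quat add_subgroup_L)+

lemma qnr_multiples:
  assumes "q \<in> L"
  shows "(*\<^sub>R) (qnr q) ` L \<subseteq> (*) q ` L"
proof (intro image_subsetI)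
  fix x assume "x \<in> L"
  then have "qcnj q * x \<in> L" by (rule L_mult[OF L_qcnj[OF assms]])
  moreover have "qnr q *\<^sub>R x = q * (qcnj q * x)"
    using mult_qcnj[of q] by (simp add: mult.assoc[symmetric])
  ultimately show "qnr q *\<^sub>R x \<in> (*) q ` L" by (rule image_eqI[rotated])
qed

lemma finite_index_left_mult:
  assumes "q \<in> L" "q \<noteq> 0"
  shows "finite (add_cosets L ((*) q ` L))"
proof -
  have "finite (add_cosets L ((*\<^sub>R) (qnr q) ` L))"
    using assms by (intro index_scalar(2) qnr_integral) simp_all
  then show ?thesis
    by (rule finite_add_cosets_mono[OF _ subset_refl qnr_multiples[OF assms(1)]]) (rule add_subgroup_mult)+
qed

lemma index_left_mult_pos: "q \<in> L \<Longrightarrow> q \<noteq> 0 \<Longrightarrow> add_index L ((*) q ` L) > 0"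
  by (rule add_index_pos[OF finite_index_left_mult]) (use L_zero in auto)

lemma index_left_mult_mult:
  assumes "p \<in> L" "p \<noteq> 0" "q \<in> L"
  shows "add_index L ((*) (p * q) ` L) = add_index L ((*) p ` L) * add_index L ((*) q ` L)"
proof -
  have im: "(*) (p * q) ` L = (*) p ` (*) q ` L" by (simp add: image_image mult.assoc)
  have sub: "(*) p ` (*) q ` L \<subseteq> (*) p ` L" by (rule image_mono[OF left_mult_sub[OF assms(3)]])
  have "add_index L ((*) p ` (*) q ` L) = add_index L ((*) p ` L) * add_index ((*) p ` L) ((*) p ` (*) q ` L)"
    by (rule add_index_tower(1)[OF add_subgroup_L add_subgroup_mult(1)
          add_subgroup_image[OF additive_quat(1) add_subgroup_mult(1)] sub left_mult_sub[OF assms(1)]])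
  also have "add_index ((*) p ` L) ((*) p ` (*) q ` L) = add_index L ((*) q ` L)"
    by (rule add_index_image(1)[OF additive_quat(1) inj_quat(1)[OF assms(2)] add_subgroup_mult(1)])
  finally show ?thesis unfolding im .
qed

text \<open>With \<open>qcnj(q) u = u q\<close> for some nonzero \<open>u \<in> L\<close>, the index of \<open>u L\<close> cancels.\<close>

lemma index_left_mult_qcnj:
  assumes "q \<in> L" "q \<noteq> 0"
  shows "add_index L ((*) (qcnj q) ` L) = add_index L ((*) q ` L)"
proof -
  define u where "u = (if q1 q = 0 \<and> q2 q = 0 then Quat 0 1 0 0 else Quat 0 (- q2 q) (q1 q) 0)"
  have u: "u \<noteq> 0" "qcnj q * u = u * q" unfolding u_def by (rule conjugating_pure)+
  have "u \<in> \<H>" using L_H[OF assms(1)] by (simp add: u_def quat_alg_def K_zero K_one K_minus)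
  then obtain m :: nat where m: "m > 0" "of_nat m *\<^sub>R u \<in> L" by (rule L_denominator)
  define v where "v = of_nat m *\<^sub>R u"
  have v: "v \<in> L" "v \<noteq> 0" "qcnj q * v = v * q" using m u by (simp_all add: v_def)
  have "add_index L ((*) (qcnj q) ` L) * add_index L ((*) v ` L) = add_index L ((*) (qcnj q * v) ` L)"
    using index_left_mult_mult[OF L_qcnj[OF assms(1)] _ v(1)] assms(2) by simp
  also have "\<dots> = add_index L ((*) v ` L) * add_index L ((*) q ` L)"
    unfolding v(3) by (rule index_left_mult_mult[OF v(1,2) assms(1)])
  finally show ?thesis using index_left_mult_pos[OF v(1,2)] by simp
qed

text \<open>The two factors of \<open>q qcnj(q) = |q|\<^sup>2\<close> have the same index.\<close>

lemma index_left_mult: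
  assumes "q \<in> L" "q \<noteq> 0"
  shows "add_index L ((*) q ` L) = nrm (qnr q) ^ 2"
proof -
  have "(*) (q * qcnj q) ` L = (*\<^sub>R) (qnr q) ` L" by (simp add: mult_qcnj)
  then have "add_index L ((*) q ` L) * add_index L ((*) (qcnj q) ` L) = nrm (qnr q) ^ 4"
    using index_left_mult_mult[OF assms L_qcnj[OF assms(1)]] index_scalar(1)[OF qnr_integral[OF assms(1)]] assms(2)
    by simp
  then have "(add_index L ((*) q ` L)) ^ 2 = (nrm (qnr q) ^ 2) ^ 2"
    by (simp add: index_left_mult_qcnj[OF assms] power2_eq_square power4_eq_xxxx mult.assoc)
  then show ?thesis by (simp only: power2_eq_iff_nonneg[OF le0 le0])
qed

text \<open>Conjugation maps \<open>L q\<close> to the right ideal of the conjugate of \<open>q\<close>.\<close>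

lemma index_right_mult:
  assumes "q \<in> L" "q \<noteq> 0"
  shows "add_index L ((\<lambda>x. x * q) ` L) = nrm (qnr q) ^ 2" "finite (add_cosets L ((\<lambda>x. x * q) ` L))"
proof -
  have "qcnj ` (\<lambda>x. x * q) ` L = (*) (qcnj q) ` qcnj ` L" by (simp add: image_image qcnj_simps)
  then have im: "qcnj ` (\<lambda>x. x * q) ` L = (*) (qcnj q) ` L" by (simp only: L_qcnj_image)
  note idx = add_index_image[OF additive_quat(4) inj_quat(4) add_subgroup_mult(2)[of q], of L, unfolded im L_qcnj_image]
  have q': "qcnj q \<in> L" "qcnj q \<noteq> 0" using assms L_qcnj by simp_all
  show "add_index L ((\<lambda>x. x * q) ` L) = nrm (qnr q) ^ 2"
    using idx(1) index_left_mult[OF q'] by simp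
  show "finite (add_cosets L ((\<lambda>x. x * q) ` L))"
    using idx(2) finite_index_left_mult[OF q'] by simp
qed

subsection \<open>Principal ideals and reduced elements\<close>

text \<open>Lying between \<open>a L\<close> and \<open>L\<close>, the module \<open>I\<close> is finitely generated and spans the algebra, so it is an
  ideal in the sense of the class number, and a single class relates it to \<open>L\<close>.\<close>

lemma principal_left_ideal:
  assumes I: "oo_module I" "I \<subseteq> L" and left: "\<And>a x. a \<in> L \<Longrightarrow> x \<in> I \<Longrightarrow> a * x \<in> I"
    and a: "a \<in> \<oo>" "a \<noteq> 0" "(*\<^sub>R) a ` L \<subseteq> I"
  obtains t where "t \<in> L" "t \<noteq> 0" "I = (\<lambda>x. x * t) ` L"
proof -
  obtain B where B: "finite B" "L = span_over \<oo> B" by (rule L_span)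
  have aB: "span_over \<oo> ((*\<^sub>R) a ` B) = (*\<^sub>R) a ` L"
  proof
    have "oo_module ((*\<^sub>R) a ` L)"
      unfolding oo_module_def
    proof (intro conjI ballI add_subgroup_mult)
      fix b x assume "b \<in> \<oo>" "x \<in> (*\<^sub>R) a ` L"
      then obtain y where y: "y \<in> L" "x = a *\<^sub>R y" by blast
      have "b *\<^sub>R x = a *\<^sub>R (b *\<^sub>R y)" by (simp add: y(2) mult.commute)
      moreover have "b *\<^sub>R y \<in> L" using \<open>b \<in> \<oo>\<close> y(1) by (rule L_scale)
      ultimately show "b *\<^sub>R x \<in> (*\<^sub>R) a ` L" by (rule image_eqI)
    qed
    moreover have "(*\<^sub>R) a ` B \<subseteq> (*\<^sub>R) a ` L"
      unfolding B(2) using span_over_base[OF oo_one] by (intro image_mono subsetI)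
    ultimately show "span_over \<oo> ((*\<^sub>R) a ` B) \<subseteq> (*\<^sub>R) a ` L"
      by (rule span_over_subset_module)
    have mod: "oo_module (span_over \<oo> ((*\<^sub>R) a ` B))" using B(1) by (intro oo_module_span) simp
    have "L \<subseteq> {x. a *\<^sub>R x \<in> span_over \<oo> ((*\<^sub>R) a ` B)}"
      unfolding B(2)
    proof (rule span_over_least)
      show "B \<subseteq> {x. a *\<^sub>R x \<in> span_over \<oo> ((*\<^sub>R) a ` B)}"
        by (intro subsetI CollectI span_over_base[OF oo_one] imageI)
      fix b x assume b: "b \<in> \<oo>" and x: "x \<in> {x. a *\<^sub>R x \<in> span_over \<oo> ((*\<^sub>R) a ` B)}"
      have "b *\<^sub>R (a *\<^sub>R x) \<in> span_over \<oo> ((*\<^sub>R) a ` B)" by (rule oo_moduleD(6)[OF mod b CollectD[OF x]])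
      then show "b *\<^sub>R x \<in> {x. a *\<^sub>R x \<in> span_over \<oo> ((*\<^sub>R) a ` B)}" by (simp add: mult.commute)
    qed (simp_all add: oo_moduleD(2,3)[OF mod] scaleR_add_right)
    then show "(*\<^sub>R) a ` L \<subseteq> span_over \<oo> ((*\<^sub>R) a ` B)" by (intro image_subsetI) (rule CollectD, rule subsetD)
  qed
  have "finite (add_cosets I ((*\<^sub>R) a ` L))"
    by (rule finite_add_cosets_mono[OF index_scalar(2)[OF a(1,2)] I(2) subset_refl]) (rule add_subgroup_mult)+
  then have fg: "\<exists>B'. finite B' \<and> I = span_over \<oo> B'"
    using finitely_generated_if_finite_index[of "(*\<^sub>R) a ` B" I] B(1) I(1) a(3) by (simp only: aB finite_imageI)
  have "span_over K I = \<H>"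
  proof
    show "span_over K I \<subseteq> \<H>"
      using I(2) L_H by (intro span_over_least H_closed) auto
    show "\<H> \<subseteq> span_over K I"
    proof
      fix x assume "x \<in> \<H>"
      then obtain m :: nat where m: "m > 0" "of_nat m *\<^sub>R x \<in> L" by (rule L_denominator)
      define y where "y = a *\<^sub>R (of_nat m *\<^sub>R x)"
      have y: "y \<in> I" unfolding y_def using a(3) imageI[OF m(2)] by (rule subsetD)
      define k where "k = inverse (a * of_nat m)"
      have "k \<in> K" unfolding k_def by (intro K_inverse K_mult oo_K a K_of_nat)
      moreover have "k * (a * of_nat m) = 1" using m(1) a(2) unfolding k_def by (intro left_inverse) simp
      then have "x = k *\<^sub>R y" unfolding y_def scaleR_scaleR by (simp add: mult.assoc)
      ultimately show "x \<in> span_over K I"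
        unfolding span_over_def using y by (intro CollectI exI[of _ "{y}"] exI[of _ "\<lambda>_. k"]) simp
    qed
  qed
  with fg have "quat_ideal K I" by (simp add: quat_ideal_def)
  with left have I_left: "left_ideal K L I" by (simp add: left_ideal_def image_subset_iff)
  have L_left: "left_ideal K L L" using L_ideal L_mult by (simp add: left_ideal_def image_subset_iff)
  let ?rel = "{(I, J). left_ideal K L I \<and> left_ideal K L J \<and> (\<exists>x\<in>\<H> - {0}. J = (\<lambda>y. y * x) ` I)}"
  have "order_class_number K L = 1"
    using quat_class_number max_order by (simp add: has_quat_class_number_def)
  then obtain C where C: "{I. left_ideal K L I} // ?rel = {C}"
    unfolding order_class_number_def by (auto simp: card_1_singleton_iff)
  have "?rel `` {I} = C" "?rel `` {L} = C"
    using C I_left L_left quotientI[of I "{I. left_ideal K L I}" ?rel]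
      quotientI[of L "{I. left_ideal K L I}" ?rel] by simp_all
  moreover have "(L, L) \<in> ?rel"
    using L_left H_closed(7) by (auto intro!: bexI[of _ 1])
  then have "L \<in> ?rel `` {L}" by (rule ImageI) simp
  ultimately have "L \<in> ?rel `` {I}" by (simp only:)
  then have "(I, L) \<in> ?rel" by (simp only: Image_singleton_iff)
  then have "\<exists>x\<in>\<H> - {0}. L = (\<lambda>y. y * x) ` I" by (simp only: mem_Collect_eq case_prod_conv)
  then obtain x where x: "x \<noteq> 0" "L = (\<lambda>y. y * x) ` I" by auto
  have "(\<lambda>y. y * inverse x) ` L = I"
    unfolding x(2) image_image using x(1) by (simp add: mult.assoc)
  moreover have "1 * inverse x \<in> (\<lambda>y. y * inverse x) ` L" using L_one by (rule imageI)
  ultimately have "inverse x \<in> L" using I(2) by auto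
  then show thesis using that[of "inverse x"] x(1) \<open>(\<lambda>y. y * inverse x) ` L = I\<close> by simp
qed

text \<open>The inclusion \<open>t L \<subseteq> L t\<close> is an equality because both ideals have the same index.\<close>

lemma two_sided_principal:
  assumes t: "t \<in> L" "t \<noteq> 0" and right: "\<And>x. x \<in> L \<Longrightarrow> t * x \<in> (\<lambda>x. x * t) ` L"
  shows "(*) t ` L = (\<lambda>x. x * t) ` L"
proof -
  have sub: "(*) t ` L \<subseteq> (\<lambda>x. x * t) ` L" using right by (intro image_subsetI)
  have "add_index L ((*) t ` L) = add_index L ((\<lambda>x. x * t) ` L) * add_index ((\<lambda>x. x * t) ` L) ((*) t ` L)"
    by (rule add_index_tower(1)[OF add_subgroup_L add_subgroup_mult(2,1) sub right_mult_sub[OF t(1)]])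
  then have "add_index ((\<lambda>x. x * t) ` L) ((*) t ` L) = 1"
    using index_left_mult[OF t] index_right_mult(1)[OF t] index_left_mult_pos[OF t] by simp
  then show ?thesis
    using add_index_eq_1_imp[OF add_subgroup_mult(1) sub] by simp
qed

lemma two_sided_ideal_props:
  assumes q: "q \<in> L" "q \<noteq> 0"
  defines "J \<equiv> two_sided_ideal L q"
  shows "q \<in> J" "oo_module J" "J \<subseteq> L" "a \<in> L \<Longrightarrow> x \<in> J \<Longrightarrow> a * x \<in> J" "a \<in> L \<Longrightarrow> x \<in> J \<Longrightarrow> x * a \<in> J"
    "(*\<^sub>R) (qnr q) ` L \<subseteq> J"
proof -
  have gen: "a * q * b \<in> J" if "a \<in> L" "b \<in> L" for a b
    using two_sided_ideal.step[OF two_sided_ideal.zero that] by (simp add: J_def)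
  have add: "x + y \<in> J" if "x \<in> J" "y \<in> J" for x y
    using that(2) unfolding J_def
  proof (induction rule: two_sided_ideal.induct)
    case zero
    show ?case using that(1) by (simp add: J_def)
  next
    case (step y a b)
    from two_sided_ideal.step[OF step.IH step.hyps(2,3)] show ?case by (simp add: add.assoc)
  qed
  have closed: "a * x * b \<in> J" if "x \<in> J" "a \<in> L" "b \<in> L" for x a b
    using that(1) unfolding J_def
  proof (induction rule: two_sided_ideal.induct)
    case zero
    show ?case by (simp add: two_sided_ideal.zero)
  next
    case (step y c d)
    have "a * (y + c * q * d) * b = a * y * b + (a * c) * q * (d * b)"
      by (simp add: distrib_left distrib_right mult.assoc)
    then show ?case
      using two_sided_ideal.step[OF step.IH L_mult[OF that(2) step.hyps(2)] L_mult[OF step.hyps(3) that(3)]]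
      by (simp only:)
  qed
  show "a * x \<in> J" if "a \<in> L" "x \<in> J"
    using closed[OF that(2,1) L_one] by simp
  show "x * a \<in> J" if "a \<in> L" "x \<in> J"
    using closed[OF that(2) L_one that(1)] by simp
  show "q \<in> J" using gen[OF L_one L_one] by simp
  show "J \<subseteq> L"
  proof
    fix x assume "x \<in> J"
    then show "x \<in> L" unfolding J_def
      by (induction rule: two_sided_ideal.induct) (simp_all add: L_zero L_add L_mult q(1))
  qed
  have scale: "c *\<^sub>R x \<in> J" if "c \<in> \<oo>" "x \<in> J" for c x
    using closed[OF that(2) oo_L[OF that(1)] L_one] by simp
  have "x - y \<in> J" if "x \<in> J" "y \<in> J" for x y
    using add[OF that(1) scale[OF oo_minus[OF oo_one] that(2)]] by simp
  moreover have "0 \<in> J" by (simp add: J_def two_sided_ideal.zero)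
  ultimately show "oo_module J"
    using scale unfolding oo_module_def add_subgroup_def by (intro conjI ballI)
  show "(*\<^sub>R) (qnr q) ` L \<subseteq> J"
  proof (intro image_subsetI)
    fix x assume "x \<in> L"
    then have "qcnj q * x \<in> L" by (rule L_mult[OF L_qcnj[OF q(1)]])
    then have "1 * q * (qcnj q * x) \<in> J" by (rule gen[OF L_one])
    moreover have "1 * q * (qcnj q * x) = qnr q *\<^sub>R x"
      using mult_qcnj[of q] by (simp add: mult.assoc[symmetric])
    ultimately show "qnr q *\<^sub>R x \<in> J" by (simp only:)
  qed
qed

lemma two_sided_ideal_principal:
  assumes q: "q \<in> L" "q \<noteq> 0"
  obtains t where "t \<in> L" "t \<noteq> 0" "two_sided_ideal L q = (\<lambda>x. x * t) ` L" "(*) t ` L = (\<lambda>x. x * t) ` L"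
proof -
  note J = two_sided_ideal_props[OF q]
  have "qnr q \<noteq> 0" using q(2) by simp
  obtain t where t: "t \<in> L" "t \<noteq> 0" "two_sided_ideal L q = (\<lambda>x. x * t) ` L"
  proof (rule principal_left_ideal[OF J(2,3) _ qnr_integral[OF q(1)] \<open>qnr q \<noteq> 0\<close> J(6)])
    show "a * x \<in> two_sided_ideal L q" if "a \<in> L" "x \<in> two_sided_ideal L q" for a x
      by (rule J(4)[OF that])
  qed (rule that)
  have "1 * t \<in> two_sided_ideal L q" unfolding t(3) using L_one by (rule imageI)
  then have "t * x \<in> (\<lambda>x. x * t) ` L" if "x \<in> L" for x
    using J(5)[OF that] unfolding t(3) by simp
  then have "(*) t ` L = (\<lambda>x. x * t) ` L" by (rule two_sided_principal[OF t(1,2)])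
  with t show thesis by (rule that)
qed

text \<open>The two-sided ideal of \<open>q\<close> is \<open>L t = t L\<close>, where \<open>t\<close> is itself a two-sided factor of \<open>q\<close> and a unit if
  \<open>q\<close> is reduced. Conversely every two-sided factor of \<open>q\<close> generates an ideal containing that of \<open>q\<close>.\<close>

lemma order_reduced_iff:
  "order_reduced L q \<longleftrightarrow> q \<in> L \<and> q \<noteq> 0 \<and> 1 \<in> two_sided_ideal L q"
proof (intro iffI conjI)
  assume red: "order_reduced L q"
  then show q: "q \<in> L" "q \<noteq> 0" by (simp_all add: order_reduced_def)
  obtain t where t: "t \<in> L" "t \<noteq> 0" "two_sided_ideal L q = (\<lambda>x. x * t) ` L" "(*) t ` L = (\<lambda>x. x * t) ` L"
    by (rule two_sided_ideal_principal[OF q])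
  have "q \<in> (\<lambda>x. x * t) ` L" using two_sided_ideal_props(1)[OF q] t(3) by simp
  then obtain a where a: "q = a * t" "a \<in> L" by (rule imageE)
  have "a \<noteq> 0" using a(1) q(2) by auto
  have "\<forall>a\<in>L - {0}. \<forall>r\<in>L - {0}. \<forall>b\<in>L - {0}. q = a * r * b \<and> (*) r ` L = (\<lambda>y. y * r) ` L \<longrightarrow> order_unit L r"
    using red unfolding order_reduced_def by (rule conjunct2)
  from bspec[OF bspec[OF bspec[OF this]], of a t 1]
  have "q = a * t * 1 \<and> (*) t ` L = (\<lambda>y. y * t) ` L \<longrightarrow> order_unit L t"
    using a(2) \<open>a \<noteq> 0\<close> t(1,2) L_one by simp
  then have "inverse t \<in> L" using a(1) t(4) by (simp add: order_unit_def)
  then have "inverse t * t \<in> two_sided_ideal L q" unfolding t(3) by (rule imageI)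
  then show "1 \<in> two_sided_ideal L q" using t(2) by simp
next
  assume "q \<in> L \<and> q \<noteq> 0 \<and> 1 \<in> two_sided_ideal L q"
  then have q: "q \<in> L" "q \<noteq> 0" "1 \<in> two_sided_ideal L q" by auto
  have "order_unit L t" if t: "a \<in> L - {0}" "t \<in> L - {0}" "b \<in> L - {0}" "q = a * t * b" "(*) t ` L = (\<lambda>y. y * t) ` L" for a t b
  proof -
    have "two_sided_ideal L q \<subseteq> (*) t ` L"
    proof
      fix x assume "x \<in> two_sided_ideal L q"
      then show "x \<in> (*) t ` L"
      proof (induction rule: two_sided_ideal.induct)
        case zero
        show ?case by (rule add_subgroup_zero[OF add_subgroup_mult(1)])
      next
        case (step x c d)
        have "c * a \<in> L" using step.hyps(2) t(1) by (simp add: L_mult)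
        then have "(c * a) * t \<in> (*) t ` L" unfolding t(5) by (rule imageI)
        then obtain e where e: "(c * a) * t = t * e" "e \<in> L" by (rule imageE)
        have "c * q * d = ((c * a) * t) * (b * d)" by (simp add: t(4) mult.assoc)
        also have "\<dots> = t * (e * (b * d))" unfolding e(1) by (simp add: mult.assoc)
        finally have "c * q * d = t * (e * (b * d))" .
        moreover have "e * (b * d) \<in> L" using e(2) t(3) step.hyps by (simp add: L_mult)
        ultimately have "c * q * d \<in> (*) t ` L" by (rule image_eqI)
        with step.IH show ?case by (rule add_subgroup_add[OF add_subgroup_mult(1)])
      qed
    qed
    then have "1 \<in> (*) t ` L" using q(3) by (rule subsetD)
    then obtain s where "1 = t * s" "s \<in> L" by (rule imageE)
    then show ?thesis using t(2) by (simp add: order_unit_def inverse_unique[of t s])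
  qed
  then show "order_reduced L q" unfolding order_reduced_def using q by blast
qed

end

context maximal_order_class_one
begin

section \<open>Traces and idealizers of reduced elements\<close>

text \<open>If \<open>g\<close> divides all traces, then the norm is additive modulo \<open>g\<close>, so \<open>P = {x. g dvd |x|\<^sup>2}\<close> is a left
  ideal \<open>L t\<close> whose index is at most the norm of \<open>g\<close>. But that index is the square of the norm of
  \<open>|t|\<^sup>2\<close>, a multiple of \<open>g\<close>. Hence \<open>g\<close> is a unit.\<close>

lemma trace_one_exists: "\<exists>c\<in>L. qtr c = 1"
proof -
  have add_qtr: "Modules.additive qtr" by (simp add: Modules.additive_def qtr_simps)
  have "oo_module (qtr ` L)"
    unfolding oo_module_def
  proof (intro conjI ballI add_subgroup_image add_qtr add_subgroup_L)
    fix a x assume a: "a \<in> \<oo>" and "x \<in> qtr ` L"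
    then obtain y where y: "y \<in> L" "x = qtr y" by blast
    have "a *\<^sub>R x = qtr (a *\<^sub>R y)" by (simp add: y(2) qtr_simps)
    then show "a *\<^sub>R x \<in> qtr ` L" using L_scale[OF a y(1)] by (rule image_eqI)
  qed
  moreover have "qtr ` L \<subseteq> \<oo>" by (intro image_subsetI qtr_integral)
  moreover have two: "2 \<in> qtr ` L" using L_one by (intro image_eqI[of _ _ 1]) (simp_all add: qtr_simps)
  ultimately obtain g where g: "g \<in> \<oo>" "g \<noteq> 0" "qtr ` L = (*) g ` \<oo>"
    by (rule principal_ideal) simp
  define G where "G = (*) g ` \<oo>"
  have G: "add_subgroup G" unfolding G_def by (rule add_subgroup_image[OF additive_times add_subgroup_oo])
  have G_mult: "a * x \<in> G" if "a \<in> \<oo>" "x \<in> G" for a x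
  proof -
    from that(2)[unfolded G_def] obtain y where y: "x = g * y" "y \<in> \<oo>" by (rule imageE)
    have "a * x = g * (a * y)" by (simp add: y(1))
    then show ?thesis unfolding G_def using oo_mult[OF that(1) y(2)] by (rule image_eqI)
  qed
  have trG: "qtr x \<in> G" if "x \<in> L" for x
    unfolding G_def g(3)[symmetric] using that by (rule imageI)
  define P where "P = {x \<in> L. qnr x \<in> G}"
  have P_diff: "x - y \<in> P" if "x \<in> P" "y \<in> P" for x y
  proof -
    have xy: "x \<in> L" "y \<in> L" "qnr x \<in> G" "qnr y \<in> G" using that by (simp_all add: P_def)
    have "qnr x + qnr y - qtr (x * qcnj y) \<in> G"
      by (intro add_subgroup_diff[OF G] add_subgroup_add[OF G] trG L_mult L_qcnj xy)
    then show ?thesis using L_diff[OF xy(1,2)] by (simp add: P_def qnr_diff)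
  qed
  have P_scale: "a *\<^sub>R x \<in> P" if "a \<in> \<oo>" "x \<in> P" for a x
    using that G_mult[OF oo_power[OF that(1), of 2]] by (simp add: P_def qnr_scaleR L_scale)
  have "0 \<in> P" using add_subgroup_zero[OF G] by (simp add: P_def L_zero)
  then have P: "oo_module P"
    using P_diff P_scale unfolding oo_module_def add_subgroup_def by (intro conjI ballI)
  have PL: "P \<subseteq> L" by (simp add: P_def)
  have gP: "(*\<^sub>R) g ` L \<subseteq> P"
  proof (intro image_subsetI)
    fix x assume x: "x \<in> L"
    have "qnr (g *\<^sub>R x) = g * (g * qnr x)" by (simp add: qnr_scaleR power2_eq_square)
    then have "qnr (g *\<^sub>R x) \<in> G" unfolding G_def using oo_mult[OF g(1) qnr_integral[OF x]] by (rule image_eqI)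
    then show "g *\<^sub>R x \<in> P" using L_scale[OF g(1) x] by (simp add: P_def)
  qed
  obtain t where t: "t \<in> L" "t \<noteq> 0" "P = (\<lambda>x. x * t) ` L"
  proof (rule principal_left_ideal[OF P PL _ g(1,2) gP])
    show "a * x \<in> P" if "a \<in> L" "x \<in> P" for a x
      using that G_mult[OF qnr_integral[OF that(1)]] by (simp add: P_def qnr_mult L_mult)
  qed (rule that)
  define f where "f x = (+) (qnr x) ` G" for x
  have f: "f x = f y \<longleftrightarrow> x - y \<in> P" if xy: "x \<in> L" "y \<in> L" for x y
  proof -
    have "2 \<in> G" unfolding G_def g(3)[symmetric] by (rule two)
    then have "qnr y * 2 \<in> G" by (rule G_mult[OF qnr_integral[OF xy(2)]])
    then have "2 * qnr y - qtr (x * qcnj y) \<in> G"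
      unfolding mult.commute[of _ 2] by (intro add_subgroup_diff[OF G] trG L_mult L_qcnj xy)
    then have "qnr x - qnr y + (2 * qnr y - qtr (x * qcnj y)) \<in> G \<longleftrightarrow> qnr x - qnr y \<in> G"
      using add_subgroup_add[OF G] add_subgroup_diff[OF G] by (metis add_diff_cancel_right')
    moreover have "qnr (x - y) = qnr x - qnr y + (2 * qnr y - qtr (x * qcnj y))" by (simp add: qnr_diff)
    moreover have "x - y \<in> P \<longleftrightarrow> qnr (x - y) \<in> G" using L_diff[OF xy] by (simp add: P_def)
    ultimately show ?thesis by (simp only: f_def coset_eq_iff[OF G])
  qed
  have "f ` L \<subseteq> add_cosets \<oo> G" using qnr_integral by (auto simp: f_def add_cosets_def)
  then have "card (f ` L) \<le> nrm g"
    unfolding add_index_def G_def using index_principal(1)[OF g(1,2)] by (intro card_mono) simp_all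
  moreover have "add_index L P = card (f ` L)"
    by (rule add_index_via(2)[OF oo_moduleD(1)[OF P] f])
  moreover have "add_index L P = nrm (qnr t) ^ 2"
    unfolding t(3) by (rule index_right_mult(1)[OF t(1,2)])
  ultimately have le: "nrm (qnr t) ^ 2 \<le> nrm g" by simp
  have "1 * t \<in> P" unfolding t(3) using L_one by (rule imageI)
  then have "qnr t \<in> G" by (simp add: P_def)
  then obtain y where y: "qnr t = g * y" "y \<in> \<oo>" unfolding G_def by (rule imageE)
  have y0: "y \<noteq> 0" using y(1) t(2) by auto
  have "nrm g * 1 \<le> nrm (qnr t)"
    unfolding y(1) nrm_mult[OF g(1,2) y(2) y0] using nrm_pos[OF y(2) y0] by (intro mult_le_mono2) simp
  then have "nrm g ^ 2 \<le> nrm (qnr t) ^ 2" by (intro power_mono) simp_all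
  then have "nrm g ^ 2 \<le> nrm g" using le by (rule order.trans)
  then have "nrm g * nrm g \<le> nrm g * 1" by (simp only: power2_eq_square mult_1_right)
  then have "nrm g = 1" using nrm_pos[OF g(1,2)] by simp
  then have "inverse g \<in> \<oo>" by (rule nrm_eq_1[OF g(1)])
  then have "g * inverse g \<in> qtr ` L" unfolding g(3) by (rule imageI)
  then have "1 \<in> qtr ` L" using g(2) by simp
  then obtain c where "1 = qtr c" "c \<in> L" by (rule imageE)
  then show ?thesis by (intro bexI[of _ c]) simp_all
qed

text \<open>If \<open>1\<close> is a sum of products \<open>a q b\<close>, then every trace \<open>tr(c) = \<Sum> tr(c a q b) = \<Sum> tr(b c a q)\<close> is the trace of a
  left multiple of \<open>q\<close>, in particular the trace \<open>1\<close>.\<close>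

lemma trace_one_multiple:
  assumes "order_reduced L q"
  obtains a where "a \<in> L" "qtr (a * qcnj q) = 1"
proof -
  obtain c where c: "c \<in> L" "qtr c = 1" using trace_one_exists by blast
  have "\<exists>a\<in>L. qtr (c * z) = qtr (a * q)" if "z \<in> two_sided_ideal L q" for z
    using that
  proof (induction rule: two_sided_ideal.induct)
    case zero
    show ?case by (intro bexI[of _ 0]) (simp_all add: L_zero)
  next
    case (step x a b)
    then obtain a' where a': "a' \<in> L" "qtr (c * x) = qtr (a' * q)" by blast
    have "qtr (c * (a * q * b)) = qtr (b * (c * (a * q)))"
      using qtr_commute[of "c * (a * q)" b] by (simp add: mult.assoc)
    then have "qtr (c * (x + a * q * b)) = qtr ((a' + b * (c * a)) * q)"
      by (simp add: distrib_left distrib_right qtr_simps a'(2) mult.assoc)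
    then show ?case using a'(1) step.hyps c(1) by (intro bexI[of _ "a' + b * (c * a)"]) (simp_all add: L_add L_mult)
  qed
  from this[of 1] obtain a where a: "a \<in> L" "qtr (a * q) = 1"
    using assms c(2) by (auto simp: order_reduced_iff)
  have "qtr (qcnj a * qcnj q) = qtr (qcnj (q * a))" by (simp add: qcnj_simps)
  also have "\<dots> = 1" using a(2) qtr_commute[of q a] by (simp add: qtr_simps)
  finally show thesis using that L_qcnj[OF a(1)] by blast
qed

definition idealizer :: "quat \<Rightarrow> quat set" where
  "idealizer q = {x \<in> L. x * q \<in> (*) q ` L}"

lemma idealizer_sub: "idealizer q \<subseteq> L"
  by (simp add: idealizer_def)

lemma add_subgroup_idealizer: "add_subgroup (idealizer q)"
  unfolding add_subgroup_def
proof (intro conjI ballI)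
  show "0 \<in> idealizer q"
    using add_subgroup_zero[OF add_subgroup_mult(1)] by (simp add: idealizer_def L_zero)
  fix x y assume "x \<in> idealizer q" "y \<in> idealizer q"
  then show "x - y \<in> idealizer q"
    using add_subgroup_diff[OF add_subgroup_mult(1), of "x * q" q "y * q"]
    by (simp add: idealizer_def L_diff left_diff_distrib)
qed

lemma scalar_idealizer:
  assumes "a \<in> \<oo>"
  shows "a *\<^sub>R 1 \<in> idealizer q"
proof -
  have "(a *\<^sub>R 1) * q = q * (a *\<^sub>R 1)" by simp
  then have "(a *\<^sub>R 1) * q \<in> (*) q ` L" using oo_L[OF assms] by (rule image_eqI)
  then show ?thesis using oo_L[OF assms] by (simp add: idealizer_def)
qed

lemma right_ideal_idealizer:
  assumes "q \<in> L"
  shows "(*) q ` L \<subseteq> idealizer q"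
proof (intro image_subsetI)
  fix x assume x: "x \<in> L"
  have "q * x * q = q * (x * q)" by (simp add: mult.assoc)
  then have "q * x * q \<in> (*) q ` L" using L_mult[OF x assms] by (rule image_eqI)
  then show "q * x \<in> idealizer q" using L_mult[OF assms x] by (simp add: idealizer_def)
qed

text \<open>With \<open>a qcnj(q) + q qcnj(a) = 1\<close>, multiplication by \<open>x\<close> exhibits \<open>x\<close> as the scalar
  \<open>tr(x a qcnj(q))\<close> up to an element of \<open>q L\<close>.\<close>

lemma idealizer_reduced:
  assumes red: "order_reduced L q" and x: "x \<in> idealizer q"
  obtains s y where "s \<in> \<oo>" "y \<in> L" "x = s *\<^sub>R 1 + q * y"
proof -
  have q: "q \<in> L" using red by (simp add: order_reduced_iff)
  obtain a where a: "a \<in> L" "qtr (a * qcnj q) = 1" by (rule trace_one_multiple[OF red])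
  have xL: "x \<in> L" using x by (simp add: idealizer_def)
  have "x * q \<in> (*) q ` L" using x by (simp add: idealizer_def)
  then obtain z where z: "x * q = q * z" "z \<in> L" by (rule imageE)
  have cnj: "w = qtr w *\<^sub>R 1 - qcnj w" for w by (simp add: qcnj_eq)
  have a_eq: "a * qcnj q = 1 - q * qcnj a"
    using cnj[of "a * qcnj q"] a(2) by (simp add: qcnj_simps)
  have "(x * a) * qcnj q = x - q * (z * qcnj a)"
  proof -
    have "(x * a) * qcnj q = x * (a * qcnj q)" by (simp only: mult.assoc)
    also have "\<dots> = x - (x * q) * qcnj a" unfolding a_eq by (simp add: right_diff_distrib mult.assoc)
    finally show ?thesis unfolding z(1) by (simp only: mult.assoc)
  qed
  moreover have "(x * a) * qcnj q = qtr ((x * a) * qcnj q) *\<^sub>R 1 - q * qcnj (x * a)"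
    using cnj[of "(x * a) * qcnj q"] by (simp add: qcnj_simps)
  ultimately have "x - q * (z * qcnj a) = qtr ((x * a) * qcnj q) *\<^sub>R 1 - q * qcnj (x * a)" by (simp only:)
  then have "x = qtr ((x * a) * qcnj q) *\<^sub>R 1 + q * (z * qcnj a - qcnj (x * a))"
    by (simp add: right_diff_distrib algebra_simps)
  moreover have "qtr ((x * a) * qcnj q) \<in> \<oo>" "z * qcnj a - qcnj (x * a) \<in> L"
    using xL a(1) q z(2) by (simp_all add: qtr_integral L_mult L_qcnj L_diff)
  ultimately show thesis using that by blast
qed

text \<open>A scalar in \<open>q L\<close> is a multiple of \<open>|q|\<^sup>2\<close>: the ideal of these scalars is generated by some \<open>m\<close>
  with \<open>|q|\<^sup>2 = m t\<close>, and then the central element \<open>t\<close> divides \<open>q\<close>, so it is a unit.\<close>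

lemma scalars_in_right_ideal:
  assumes red: "order_reduced L q"
  shows "s \<in> \<oo> \<and> s *\<^sub>R 1 \<in> (*) q ` L \<longleftrightarrow> s \<in> (*) (qnr q) ` \<oo>"
proof -
  have q: "q \<in> L" "q \<noteq> 0" using red by (simp_all add: order_reduced_iff)
  define n where "n = qnr q"
  have n: "n \<in> \<oo>" "n \<noteq> 0" using q by (simp_all add: n_def qnr_integral)
  define A where "A = {s \<in> \<oo>. s *\<^sub>R 1 \<in> (*) q ` L}"
  have A_scale: "a *\<^sub>R s \<in> A" if a: "a \<in> \<oo>" and s: "s \<in> A" for a s
  proof -
    have "s *\<^sub>R 1 \<in> (*) q ` L" using s by (simp add: A_def)
    then obtain y where y: "s *\<^sub>R 1 = q * y" "y \<in> L" by (rule imageE)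
    have "(a * s) *\<^sub>R 1 = a *\<^sub>R (s *\<^sub>R (1::quat))" by simp
    also have "\<dots> = q * (a *\<^sub>R y)" unfolding y(1) by simp
    finally have "(a * s) *\<^sub>R 1 \<in> (*) q ` L" using L_scale[OF a y(2)] by (rule image_eqI)
    then show ?thesis using a s by (simp add: A_def oo_mult)
  qed
  have "oo_module A"
    unfolding oo_module_def add_subgroup_def
  proof (intro conjI ballI A_scale)
    show "0 \<in> A" using add_subgroup_zero[OF add_subgroup_mult(1)] by (simp add: A_def oo_zero)
    fix s t assume "s \<in> A" "t \<in> A"
    then show "s - t \<in> A"
      using add_subgroup_diff[OF add_subgroup_mult(1), of "s *\<^sub>R 1" q "t *\<^sub>R 1"]
      by (simp add: A_def oo_diff scaleR_diff_left)
  qed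
  moreover have "A \<subseteq> \<oo>" by (simp add: A_def)
  moreover have nA: "n \<in> A"
  proof -
    have "n *\<^sub>R 1 = q * qcnj q" by (simp add: mult_qcnj n_def)
    then have "n *\<^sub>R 1 \<in> (*) q ` L" using L_qcnj[OF q(1)] by (rule image_eqI)
    then show ?thesis using n(1) by (simp add: A_def)
  qed
  ultimately obtain m where m: "m \<in> \<oo>" "m \<noteq> 0" "A = (*) m ` \<oo>"
    using n(2) by (rule principal_ideal)
  have "m * 1 \<in> A" unfolding m(3) using oo_one by (rule imageI)
  then have "m *\<^sub>R 1 \<in> (*) q ` L" by (simp add: A_def)
  then obtain r where r: "m *\<^sub>R 1 = q * r" "r \<in> L" by (rule imageE)
  obtain t where t: "n = m * t" "t \<in> \<oo>" using nA unfolding m(3) by (rule imageE)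
  have t0: "t \<noteq> 0" using t(1) n(2) by auto
  have "q * qcnj q = q * (t *\<^sub>R r)"
  proof -
    have "q * qcnj q = t *\<^sub>R (m *\<^sub>R 1)" by (simp add: mult_qcnj n_def[symmetric] t(1) mult.commute)
    also have "\<dots> = q * (t *\<^sub>R r)" unfolding r(1) by simp
    finally show ?thesis .
  qed
  then have "qcnj q = t *\<^sub>R r" by (simp only: mult_left_cancel[OF q(2)])
  then have "qcnj (qcnj q) = qcnj (t *\<^sub>R r)" by (simp only:)
  then have q_eq: "q = 1 * (t *\<^sub>R 1) * qcnj r" by (simp add: qcnj_simps)
  have "qcnj r \<noteq> 0"
  proof
    assume "qcnj r = 0"
    then have "q = 0" by (subst q_eq) simp
    then show False using q(2) by simp
  qed
  have all: "\<forall>a\<in>L - {0}. \<forall>u\<in>L - {0}. \<forall>b\<in>L - {0}. q = a * u * b \<and> (*) u ` L = (\<lambda>y. y * u) ` L \<longrightarrow> order_unit L u"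
    using red unfolding order_reduced_def by (rule conjunct2)
  have mem: "1 \<in> L - {0}" "t *\<^sub>R 1 \<in> L - {0}" "qcnj r \<in> L - {0}"
    using L_one oo_L[OF t(2)] L_qcnj[OF r(2)] t0 \<open>qcnj r \<noteq> 0\<close> by simp_all
  have "(*) (t *\<^sub>R 1) ` L = (\<lambda>y. y * (t *\<^sub>R 1)) ` L" by simp
  with q_eq have "order_unit L (t *\<^sub>R 1)"
    using bspec[OF bspec[OF bspec[OF all mem(1)] mem(2)] mem(3)] by (elim impE) (rule conjI)
  then have "inverse (t *\<^sub>R 1) \<in> L" by (simp add: order_unit_def)
  moreover have "inverse (t *\<^sub>R 1) = inverse t *\<^sub>R (1::quat)"
    using inverse_scaleR_distrib[of t "1::quat"] by simp
  ultimately have "inverse t \<in> \<oo>" by (intro real_in_L) (simp only:)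
  have "(*) m ` \<oo> = (*) n ` \<oo>"
  proof (intro subset_antisym image_subsetI)
    fix a assume a: "a \<in> \<oo>"
    have "m * a = n * (inverse t * a)" using t0 by (simp add: t(1))
    then show "m * a \<in> (*) n ` \<oo>" using oo_mult[OF \<open>inverse t \<in> \<oo>\<close> a] by (rule image_eqI)
    have "n * a = m * (t * a)" by (simp add: t(1))
    then show "n * a \<in> (*) m ` \<oo>" using oo_mult[OF t(2) a] by (rule image_eqI)
  qed
  then have "A = (*) n ` \<oo>" using m(3) by simp
  then show ?thesis unfolding A_def n_def by blast
qed

text \<open>The tower \<open>q L \<subseteq> S \<subseteq> L\<close> for the idealizer \<open>S = \<oo> + q L\<close>: as \<open>\<oo> \<inter> q L\<close> is generated by \<open>|q|\<^sup>2\<close>, the lower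
  index is the norm of \<open>|q|\<^sup>2\<close>, which is the square root of the total index.\<close>

lemma index_idealizer:
  assumes red: "order_reduced L q"
  shows "add_index L (idealizer q) = nrm (qnr q)" "finite (add_cosets L (idealizer q))"
proof -
  have q: "q \<in> L" "q \<noteq> 0" using red by (simp_all add: order_reduced_iff)
  let ?S = "idealizer q" and ?I = "(*) q ` L" and ?n = "qnr q"
  define f where "f s = (+) (s *\<^sub>R 1) ` ?I" for s :: real
  have nA: "add_subgroup ((*) ?n ` \<oo>)" by (rule add_subgroup_image[OF additive_times add_subgroup_oo])
  have f: "f s = f t \<longleftrightarrow> s - t \<in> (*) ?n ` \<oo>" if "s \<in> \<oo>" "t \<in> \<oo>" for s t
    using scalars_in_right_ideal[OF red, of "s - t"] oo_diff[OF that]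
    by (simp add: f_def coset_eq_iff[OF add_subgroup_mult(1)] scaleR_diff_left)
  have "f ` \<oo> = add_cosets ?S ?I"
  proof (intro subset_antisym subsetI)
    fix C assume "C \<in> f ` \<oo>"
    then show "C \<in> add_cosets ?S ?I"
      unfolding add_cosets_def f_def using scalar_idealizer by blast
  next
    fix C assume "C \<in> add_cosets ?S ?I"
    then obtain x where x: "x \<in> ?S" "C = (+) x ` ?I" unfolding add_cosets_def by blast
    obtain s y where sy: "s \<in> \<oo>" "y \<in> L" "x = s *\<^sub>R 1 + q * y"
      by (rule idealizer_reduced[OF red x(1)])
    have "C = f s"
      unfolding x(2) f_def coset_eq_iff[OF add_subgroup_mult(1)] sy(3) using sy(2) by (simp add: imageI)
    then show "C \<in> f ` \<oo>" using sy(1) by (rule image_eqI)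
  qed
  then have SI: "add_index ?S ?I = nrm ?n"
    using add_index_via(2)[OF nA f] by (simp add: add_index_def)
  have tower: "add_index L ?I = add_index L ?S * add_index ?S ?I"
    by (rule add_index_tower(1)[OF add_subgroup_L add_subgroup_idealizer add_subgroup_mult(1)
          right_ideal_idealizer[OF q(1)] idealizer_sub])
  have pos: "nrm ?n > 0" using q by (intro nrm_pos qnr_integral) simp_all
  show "add_index L ?S = nrm ?n"
    using tower pos unfolding index_left_mult[OF q] SI by (simp add: power2_eq_square)
  show "finite (add_cosets L ?S)"
    by (rule finite_add_cosets_mono[OF finite_index_left_mult[OF q] subset_refl right_ideal_idealizer[OF q(1)]
          add_subgroup_mult(1) add_subgroup_idealizer])
qed

text \<open>If \<open>x L\<close> lies in the idealizer, then \<open>x L q \<subseteq> q L\<close>, hence \<open>x L q L \<subseteq> q L\<close>, and \<open>L q L\<close> contains \<open>1\<close>.\<close>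

lemma right_ideal_from_idealizer:
  assumes red: "order_reduced L q"
  shows "(*) q ` L = {x \<in> L. \<forall>y\<in>L. x * y \<in> idealizer q}"
proof (intro subset_antisym subsetI)
  have q: "q \<in> L" "q \<noteq> 0" "1 \<in> two_sided_ideal L q" using red by (simp_all add: order_reduced_iff)
  have right: "x * y \<in> (*) q ` L" if x: "x \<in> (*) q ` L" and y: "y \<in> L" for x y
  proof -
    obtain z where z: "x = q * z" "z \<in> L" using x by (rule imageE)
    have "x * y = q * (z * y)" by (simp add: z(1) mult.assoc)
    then show ?thesis using L_mult[OF z(2) y] by (rule image_eqI)
  qed
  fix x
  {
    assume x: "x \<in> (*) q ` L"
    then have "x \<in> L" using left_mult_sub[OF q(1)] by (rule subsetD[rotated])
    moreover have "x * y \<in> idealizer q" if "y \<in> L" for y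
      using right_ideal_idealizer[OF q(1)] right[OF x that] by (rule subsetD)
    ultimately show "x \<in> {x \<in> L. \<forall>y\<in>L. x * y \<in> idealizer q}" by simp
  }
  {
    assume "x \<in> {x \<in> L. \<forall>y\<in>L. x * y \<in> idealizer q}"
    then have x: "\<And>y. y \<in> L \<Longrightarrow> x * y * q \<in> (*) q ` L" by (simp add: idealizer_def)
    have "x * z \<in> (*) q ` L" if "z \<in> two_sided_ideal L q" for z
      using that
    proof (induction rule: two_sided_ideal.induct)
      case zero
      show ?case using add_subgroup_zero[OF add_subgroup_mult(1)] by simp
    next
      case (step z a b)
      have "x * (z + a * q * b) = x * z + (x * a * q) * b" by (simp add: distrib_left mult.assoc)
      moreover have "(x * a * q) * b \<in> (*) q ` L" using x[OF step.hyps(2)] step.hyps(3) by (rule right)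
      ultimately show ?case using add_subgroup_add[OF add_subgroup_mult(1) step.IH] by simp
    qed
    from this[OF q(3)] show "x \<in> (*) q ` L" by simp
  }
qed

text \<open>Splitting off the two-sided ideal of \<open>q\<close> leaves a reduced element defining the same conjugate
  order.\<close>

lemma reduced_factor:
  assumes q: "q \<in> L" "q \<noteq> 0"
  obtains b where "order_reduced L b" "(\<lambda>x. q * x * inverse q) ` L = (\<lambda>x. b * x * inverse b) ` L"
proof -
  obtain t where t: "t \<in> L" "t \<noteq> 0" "two_sided_ideal L q = (\<lambda>x. x * t) ` L" "(*) t ` L = (\<lambda>x. x * t) ` L"
    by (rule two_sided_ideal_principal[OF q])
  have "q \<in> (\<lambda>x. x * t) ` L" using two_sided_ideal_props(1)[OF q] t(3) by simp
  then obtain b where b: "q = b * t" "b \<in> L" by (rule imageE)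
  have b0: "b \<noteq> 0" using b(1) q(2) by auto
  have "z \<in> (\<lambda>x. x * t) ` two_sided_ideal L b" if "z \<in> two_sided_ideal L q" for z
    using that
  proof (induction rule: two_sided_ideal.induct)
    case zero
    show ?case by (rule image_eqI[OF _ two_sided_ideal.zero]) simp
  next
    case (step z c d)
    obtain w where w: "z = w * t" "w \<in> two_sided_ideal L b" using step.IH by (rule imageE)
    have "t * d \<in> (\<lambda>x. x * t) ` L" unfolding t(4)[symmetric] using step.hyps(3) by (rule imageI)
    then obtain e where e: "t * d = e * t" "e \<in> L" by (rule imageE)
    have "c * q * d = c * b * (t * d)" by (simp add: b(1) mult.assoc)
    then have "z + c * q * d = (w + c * b * e) * t" unfolding e(1) w(1) by (simp add: distrib_right mult.assoc)
    then show ?case using two_sided_ideal.step[OF w(2) step.hyps(2) e(2)] by (rule image_eqI)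
  qed
  moreover have "1 * t \<in> two_sided_ideal L q" unfolding t(3) using L_one by (rule imageI)
  ultimately have "1 * t \<in> (\<lambda>x. x * t) ` two_sided_ideal L b" by blast
  then obtain w where w: "1 * t = w * t" "w \<in> two_sided_ideal L b" by (rule imageE)
  then have "w = 1" using t(2) by simp
  with w(2) b(2) b0 have red: "order_reduced L b" by (simp add: order_reduced_iff)
  have inv: "inverse q = inverse t * inverse b"
    unfolding b(1) by (rule nonzero_inverse_mult_distrib[OF b0 t(2)])
  have "q * x * inverse q = b * (t * x * inverse t) * inverse b" for x
    unfolding inv by (simp add: b(1) mult.assoc)
  then have "(\<lambda>x. q * x * inverse q) ` L = (\<lambda>x. b * x * inverse b) ` (\<lambda>x. x * inverse t) ` (*) t ` L"
    by (simp add: image_image)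
  also have "(\<lambda>x. x * inverse t) ` (*) t ` L = L"
    unfolding t(4) image_image using t(2) by (simp add: mult.assoc)
  finally show thesis using red by (rule that[rotated])
qed

end

section \<open>Rotations\<close>

lemma quat_Im_simps:
  "quat_Im (x + y) = quat_Im x + quat_Im y" "quat_Im (x - y) = quat_Im x - quat_Im y"
  "quat_Im (r *\<^sub>R x) = r *\<^sub>R quat_Im x" "quat_Im (quat_pure v) = v" "quat_Im 1 = 0" "quat_Im 0 = 0"
  by (simp_all add: quat_Im_def quat_pure_def Finite_Cartesian_Product.vec_eq_iff forall_3)

lemma quat_Im_nth [simp]: "vec_nth (quat_Im x) 1 = q1 x" "vec_nth (quat_Im x) 2 = q2 x" "vec_nth (quat_Im x) 3 = q3 x"
  by (simp_all add: quat_Im_def)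

lemma quat_Im_eq_iff: "quat_Im x = quat_Im y \<longleftrightarrow> x - y = (q0 x - q0 y) *\<^sub>R 1"
  by (auto simp: Finite_Cartesian_Product.vec_eq_iff forall_3 quat_eq_iff)

lemma additive_quat_Im: "Modules.additive quat_Im"
  by (simp add: Modules.additive_def quat_Im_simps)

lemma quat_rot_Im:
  assumes "q \<noteq> 0"
  shows "quat_rot q *v quat_Im x = quat_Im (q * x * inverse q)"
proof -
  have "quat_pure (quat_Im x) = x - q0 x *\<^sub>R 1" by (simp add: quat_pure_def quat_eq_iff)
  then have "q * quat_pure (quat_Im x) * inverse q = q * x * inverse q - q0 x *\<^sub>R (q * inverse q)"
    by (simp add: right_diff_distrib left_diff_distrib)
  then have "quat_pure (quat_rot q *v quat_Im x) = q * x * inverse q - q0 x *\<^sub>R 1"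
    using assms by (simp add: quat_rot_works)
  then have "quat_Im (quat_pure (quat_rot q *v quat_Im x)) = quat_Im (q * x * inverse q - q0 x *\<^sub>R 1)" by (simp only:)
  then show ?thesis by (simp add: quat_Im_simps)
qed

lemma quat_rot_image:
  "q \<noteq> 0 \<Longrightarrow> (*v) (quat_rot q) ` quat_Im ` X = quat_Im ` (\<lambda>x. q * x * inverse q) ` X"
  by (simp add: image_image quat_rot_Im)

lemma quat_mult_vector:
  "q0 (x * y) = q0 x * q0 y - inner (quat_Im x) (quat_Im y)"
  "quat_Im (x * y) = q0 x *\<^sub>R quat_Im y + q0 y *\<^sub>R quat_Im x + cross3 (quat_Im x) (quat_Im y)"
  by (simp_all add: quat_sel_mult inner_vec_def sum_3 Finite_Cartesian_Product.vec_eq_iff forall_3 cross3_simps)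

lemma qnr_norm: "qnr (quat_pure v) = (norm v)\<^sup>2"
  unfolding power2_norm_eq_inner by (simp add: qnr_def quat_pure_def inner_vec_def sum_3 power2_eq_square)

text \<open>Conjugation preserves the norm of pure quaternions and their products, whose imaginary parts are
  cross products; an orthogonal matrix of determinant \<open>-1\<close> would reverse cross products.\<close>

lemma rotation_matrix_quat_rot:
  assumes q: "q \<noteq> 0"
  shows "rotation_matrix (quat_rot q)"
proof -
  let ?A = "quat_rot q"
  have norm: "norm (?A *v v) = norm v" for v
  proof -
    have "qnr q * qnr (inverse q) = 1" using q by (simp add: qnr_mult[symmetric])
    then have "qnr (quat_pure (?A *v v)) = qnr (quat_pure v)"
      unfolding quat_rot_works qnr_mult by (metis mult.commute mult.left_commute mult.right_neutral)
    then show ?thesis by (simp add: qnr_norm)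
  qed
  then have "orthogonal_transformation ((*v) ?A)"
    by (simp add: orthogonal_transformation matrix_vector_mul_linear)
  then have orth: "orthogonal_matrix ?A"
    by (simp add: orthogonal_transformation_matrix matrix_of_matrix_vector_mul)
  moreover have "Determinants.det ?A \<noteq> - 1"
  proof
    assume det: "Determinants.det ?A = - 1"
    have cross: "cross3 (?A *v v) (?A *v w) = ?A *v cross3 v w" for v w
    proof -
      have pure: "quat_Im (quat_pure a * quat_pure b) = cross3 a b" for a b
        unfolding quat_mult_vector quat_Im_simps by (simp add: quat_pure_def)
      have "quat_pure (?A *v v) * quat_pure (?A *v w) = q * (quat_pure v * quat_pure w) * inverse q"
        unfolding quat_rot_works using q by (simp add: mult.assoc) (simp add: mult.assoc[symmetric])
      then have "quat_Im (quat_pure (?A *v v) * quat_pure (?A *v w)) = ?A *v quat_Im (quat_pure v * quat_pure w)"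
        unfolding quat_rot_Im[OF q] by (simp only:)
      then show ?thesis unfolding pure .
    qed
    define e :: "real^3" where "e = vector [0, 0, 1]"
    have e: "cross3 (vector [1, 0, 0]) (vector [0, 1, 0]) = e"
      by (simp add: e_def cross3_simps Finite_Cartesian_Product.vec_eq_iff forall_3)
    have "?A *v e = Determinants.det ?A *\<^sub>R (?A *v e)"
      using cross_orthogonal_matrix[OF orth, of "vector [1, 0, 0]" "vector [0, 1, 0]"] cross e by simp
    then have "?A *v e = - (?A *v e)" unfolding det by simp
    then have "2 *\<^sub>R (?A *v e) = 0" by (simp only: eq_neg_iff_add_eq_0 scaleR_2)
    then have "?A *v e = 0" by (simp only: scaleR_eq_0_iff) simp
    then have "norm e = 0" using norm[of e] by simp
    then have "vec_nth e 3 = 0" by simp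
    then show False by (simp add: e_def)
  qed
  ultimately show ?thesis
    using det_orthogonal_matrix[OF orth] by (auto simp: rotation_matrix_def)
qed

text \<open>A rotation extends to an automorphism of the quaternions that fixes the scalars, since it preserves
  inner and cross products.\<close>

definition rot_hom :: "real^3^3 \<Rightarrow> quat \<Rightarrow> quat" where
  "rot_hom R x = q0 x *\<^sub>R 1 + quat_pure (R *v quat_Im x)"

lemma rot_hom_sel: "q0 (rot_hom R x) = q0 x" "quat_Im (rot_hom R x) = R *v quat_Im x"
proof -
  show "q0 (rot_hom R x) = q0 x" by (simp add: rot_hom_def quat_pure_def)
  show "quat_Im (rot_hom R x) = R *v quat_Im x" by (simp add: rot_hom_def quat_Im_simps)
qed

lemma quat_eq_iff_Im: "x = y \<longleftrightarrow> q0 x = q0 y \<and> quat_Im x = quat_Im y"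
  by (auto simp: quat_eq_iff Finite_Cartesian_Product.vec_eq_iff forall_3)

lemma rot_hom_mult:
  assumes "rotation_matrix R"
  shows "rot_hom R (x * y) = rot_hom R x * rot_hom R y"
proof -
  have "inner (R *v v) (R *v w) = inner v w" for v w
    using assms orthogonal_transformation_matrix[of "(*v) R"]
    by (simp add: rotation_matrix_def matrix_of_matrix_vector_mul orthogonal_transformation_def)
  then show ?thesis
    unfolding quat_eq_iff_Im rot_hom_sel quat_mult_vector
    by (simp add: cross_rotation_matrix[OF assms] matrix_vector_right_distrib matrix_vector_mult_scaleR scaleR_matrix_vector_assoc[symmetric])
qed

definition "qi = Quat 0 1 0 0"
definition "qj = Quat 0 0 1 0"
definition "qk = Quat 0 0 0 1"

lemma quat_basis_mult:
  "qi * qi = - 1" "qj * qj = - 1" "qk * qk = - 1" "qi * qj = qk" "qj * qk = qi" "qk * qi = qj"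
  "qj * qi = - qk" "qk * qj = - qi" "qi * qk = - qj"
  by (simp_all add: qi_def qj_def qk_def quat_eq_iff quat_sel_mult)

lemma quat_basis_sum: "z - qi * z * qi - qj * z * qj - qk * z * qk = (4 * q0 z) *\<^sub>R 1"
  by (simp add: qi_def qj_def qk_def quat_eq_iff quat_sel_mult)

lemma quat_basis_expand: "x = q0 x *\<^sub>R 1 + q1 x *\<^sub>R qi + q2 x *\<^sub>R qj + q3 x *\<^sub>R qk"
  by (simp add: qi_def qj_def qk_def quat_eq_iff)

text \<open>Every rotation is conjugation by a quaternion. For an automorphism \<open>\<rho>\<close> and any \<open>p\<close>, averaging over
  the basis gives \<open>q = \<Sum> \<rho>(e) p qcnj(e)\<close> with \<open>\<rho>(x) q = q x\<close>; as \<open>\<Sum> q\<^sub>p qcnj(p) = 4\<close>, where \<open>p\<close> runs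
  over the basis too, some \<open>q\<^sub>p\<close> is nonzero. The formula shows that the coordinates of \<open>q\<close> lie in the
  field generated by the entries of the rotation.\<close>

definition rot_avg :: "real^3^3 \<Rightarrow> quat \<Rightarrow> quat" where
  "rot_avg R p = p - rot_hom R qi * p * qi - rot_hom R qj * p * qj - rot_hom R qk * p * qk"

lemma rot_hom_basis:
  assumes "rotation_matrix R"
  defines "I \<equiv> rot_hom R qi" and "J \<equiv> rot_hom R qj" and "M \<equiv> rot_hom R qk"
  shows "I * I = - 1" "J * J = - 1" "M * M = - 1" "I * J = M" "J * M = I" "M * I = J"
    "J * I = - M" "M * J = - I" "I * M = - J"
proof -
  have minus: "rot_hom R (- x) = - rot_hom R x" for x
  proof -
    have "rot_hom R ((- 1) *\<^sub>R x) = (- 1) *\<^sub>R rot_hom R x"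
      unfolding quat_eq_iff_Im by (simp only: rot_hom_sel quat_Im_simps quat_sel matrix_vector_mult_scaleR)
    then show ?thesis by simp
  qed
  have one: "rot_hom R 1 = 1" unfolding quat_eq_iff_Im by (simp add: rot_hom_sel quat_Im_simps)
  show "I * I = - 1" "J * J = - 1" "M * M = - 1" "I * J = M" "J * M = I" "M * I = J"
    "J * I = - M" "M * J = - I" "I * M = - J"
    unfolding I_def J_def M_def rot_hom_mult[OF assms(1), symmetric] quat_basis_mult minus one by simp_all
qed

lemma rot_avg_intertwines:
  assumes "rotation_matrix R"
  shows "rot_hom R x * rot_avg R p = rot_avg R p * x"
proof -
  define I J M where "I = rot_hom R qi" and "J = rot_hom R qj" and "M = rot_hom R qk"
  note hom = rot_hom_basis[OF assms, folded I_def J_def M_def]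
  have hom': "I * (I * z) = - z" "J * (J * z) = - z" "M * (M * z) = - z" "I * (J * z) = M * z" "J * (M * z) = I * z"
    "M * (I * z) = J * z" "J * (I * z) = - (M * z)" "M * (J * z) = - (I * z)" "I * (M * z) = - (J * z)" for z
    by (simp_all add: mult.assoc[symmetric] hom)
  have avg: "rot_avg R p = p - I * (p * qi) - J * (p * qj) - M * (p * qk)"
    by (simp add: rot_avg_def I_def J_def M_def mult.assoc)
  have i: "I * rot_avg R p = rot_avg R p * qi"
    unfolding avg by (simp add: right_diff_distrib left_diff_distrib hom' mult.assoc quat_basis_mult)
  have j: "J * rot_avg R p = rot_avg R p * qj"
    unfolding avg by (simp add: right_diff_distrib left_diff_distrib hom' mult.assoc quat_basis_mult)
  have k: "M * rot_avg R p = rot_avg R p * qk"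
    unfolding avg by (simp add: right_diff_distrib left_diff_distrib hom' mult.assoc quat_basis_mult)
  have "rot_hom R x = q0 x *\<^sub>R 1 + q1 x *\<^sub>R I + q2 x *\<^sub>R J + q3 x *\<^sub>R M"
  proof -
    have "rot_hom R (y + z) = rot_hom R y + rot_hom R z" "rot_hom R (r *\<^sub>R y) = r *\<^sub>R rot_hom R y" for r y z
      unfolding quat_eq_iff_Im
      by (simp_all add: rot_hom_sel quat_Im_simps matrix_vector_right_distrib matrix_vector_mult_scaleR)
    moreover have "rot_hom R 1 = 1" unfolding quat_eq_iff_Im by (simp add: rot_hom_sel quat_Im_simps)
    ultimately show ?thesis
      by (subst quat_basis_expand[of x]) (simp only: I_def J_def M_def)
  qed
  then have "rot_hom R x * rot_avg R p = q0 x *\<^sub>R rot_avg R p + q1 x *\<^sub>R (I * rot_avg R p) + q2 x *\<^sub>R (J * rot_avg R p) + q3 x *\<^sub>R (M * rot_avg R p)"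
    by (simp add: distrib_right)
  also have "\<dots> = rot_avg R p * (q0 x *\<^sub>R 1 + q1 x *\<^sub>R qi + q2 x *\<^sub>R qj + q3 x *\<^sub>R qk)"
    by (simp add: i j k distrib_left)
  finally show ?thesis using quat_basis_expand[of x] by simp
qed

lemma rot_avg_nonzero: "\<exists>p\<in>{1, qi, qj, qk}. rot_avg R p \<noteq> 0"
proof (rule ccontr)
  assume "\<not> ?thesis"
  then have "rot_avg R 1 - rot_avg R qi * qi - rot_avg R qj * qj - rot_avg R qk * qk = 0" by simp
  moreover have "rot_avg R 1 - rot_avg R qi * qi - rot_avg R qj * qj - rot_avg R qk * qk =
    (1 - qi * 1 * qi - qj * 1 * qj - qk * 1 * qk)
    - rot_hom R qi * (qi - qi * qi * qi - qj * qi * qj - qk * qi * qk)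
    - rot_hom R qj * (qj - qi * qj * qi - qj * qj * qj - qk * qj * qk)
    - rot_hom R qk * (qk - qi * qk * qi - qj * qk * qj - qk * qk * qk)"
    by (simp add: rot_avg_def right_diff_distrib left_diff_distrib mult.assoc)
  ultimately show False
    unfolding quat_basis_sum by (simp add: qi_def qj_def qk_def quat_eq_iff)
qed

context maximal_order_class_one
begin

section \<open>Coincidence site modules\<close>

text \<open>Equal imaginary parts mean \<open>x = z + c\<close> with \<open>z\<close> in the conjugate order and \<open>c \<in> K\<close>; comparing norms,
  \<open>c\<close> satisfies a monic quadratic equation over the integers, so \<open>c\<close> is integral.\<close>

lemma csm_idealizer:
  assumes q: "q \<in> L" "q \<noteq> 0"
  shows "quat_Im ` L \<inter> (*v) (quat_rot q) ` quat_Im ` L = quat_Im ` idealizer q"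
  unfolding quat_rot_image[OF q(2)]
proof (intro subset_antisym subsetI)
  fix v assume "v \<in> quat_Im ` L \<inter> quat_Im ` (\<lambda>x. q * x * inverse q) ` L"
  then obtain x y where xy: "x \<in> L" "y \<in> L" "v = quat_Im x" "v = quat_Im (q * y * inverse q)" by blast
  define z where "z = q * y * inverse q"
  define c where "c = q0 x - q0 z"
  have x_eq: "x = z + c *\<^sub>R 1"
    using xy(3,4) quat_Im_eq_iff[of x z] by (simp add: z_def c_def algebra_simps)
  have tr_z: "qtr z = qtr y"
    using qtr_commute[of "q * y" "inverse q"] q(2) by (simp add: z_def mult.assoc[symmetric])
  have "qnr q * qnr (inverse q) = 1" using q(2) by (simp add: qnr_mult[symmetric])
  then have nr_z: "qnr z = qnr y"
    unfolding z_def qnr_mult by (metis mult.commute mult.left_commute mult.right_neutral)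
  have "z \<in> \<H>" unfolding z_def by (intro H_closed H_inverse L_H q xy)
  then have "c \<in> K" using L_H[OF xy(1)] by (simp add: c_def quat_alg_def K_diff)
  moreover have "c\<^sup>2 + c * qtr y = qnr x - qnr y"
    unfolding x_eq qnr_add nr_z by (simp add: qnr_scaleR qcnj_simps qtr_simps tr_z)
  then have "c\<^sup>2 + c * qtr y \<in> \<oo>" using xy(1,2) by (simp add: oo_diff qnr_integral)
  ultimately have c: "c \<in> \<oo>" by (rule quadratic_integral[OF _ qtr_integral[OF xy(2)]])
  have "z * q = q * y" using q(2) by (simp add: z_def mult.assoc)
  then have "x * q = q * (y + c *\<^sub>R 1)" by (simp add: x_eq distrib_left distrib_right)
  then have "x * q \<in> (*) q ` L" using L_add[OF xy(2) oo_L[OF c]] by (rule image_eqI)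
  then have "x \<in> idealizer q" using xy(1) by (simp add: idealizer_def)
  then show "v \<in> quat_Im ` idealizer q" unfolding xy(3) by (rule imageI)
next
  fix v assume "v \<in> quat_Im ` idealizer q"
  then obtain x where x: "x \<in> idealizer q" "v = quat_Im x" by blast
  then have xL: "x \<in> L" "x * q \<in> (*) q ` L" by (simp_all add: idealizer_def)
  from xL(2) obtain y where y: "x * q = q * y" "y \<in> L" by (rule imageE)
  have "x = q * y * inverse q" unfolding y(1)[symmetric] using q(2) by (simp add: mult.assoc)
  then have "x \<in> (\<lambda>x. q * x * inverse q) ` L" using y(2) by (rule image_eqI)
  with xL(1) x(2) show "v \<in> quat_Im ` L \<inter> quat_Im ` (\<lambda>x. q * x * inverse q) ` L" by blast
qed

text \<open>The kernel of \<open>Im\<close> does not contribute to the index if the scalars of \<open>G\<close> already lie in \<open>H\<close>.\<close>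

lemma index_Im:
  assumes G: "add_subgroup G" and H: "add_subgroup H" "H \<subseteq> G" and scalars: "\<And>c. c *\<^sub>R 1 \<in> G \<Longrightarrow> c *\<^sub>R 1 \<in> H"
  shows "add_index (quat_Im ` G) (quat_Im ` H) = add_index G H"
    and "finite (add_cosets (quat_Im ` G) (quat_Im ` H)) \<longleftrightarrow> finite (add_cosets G H)"
proof -
  define f where "f x = (+) (quat_Im x) ` quat_Im ` H" for x
  have ImH: "add_subgroup (quat_Im ` H)" by (rule add_subgroup_image[OF additive_quat_Im H(1)])
  have f: "f x = f y \<longleftrightarrow> x - y \<in> H" if xy: "x \<in> G" "y \<in> G" for x y
  proof -
    have "f x = f y \<longleftrightarrow> quat_Im (x - y) \<in> quat_Im ` H"
      by (simp add: f_def coset_eq_iff[OF ImH] quat_Im_simps)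
    also have "\<dots> \<longleftrightarrow> x - y \<in> H"
    proof
      assume "quat_Im (x - y) \<in> quat_Im ` H"
      then obtain h where h: "quat_Im (x - y) = quat_Im h" "h \<in> H" by (rule imageE)
      define c where "c = q0 (x - y) - q0 h"
      have c: "(x - y) - h = c *\<^sub>R 1" using h(1) unfolding quat_Im_eq_iff c_def .
      have "(x - y) - h \<in> G"
        using h(2) H(2) by (intro add_subgroup_diff[OF G] xy) auto
      then have "c *\<^sub>R 1 \<in> H" unfolding c by (rule scalars)
      then have "(x - y) - h + h \<in> H" unfolding c using h(2) by (rule add_subgroup_add[OF H(1)])
      then show "x - y \<in> H" by simp
    qed (rule imageI)
    finally show ?thesis .
  qed
  have im: "f ` G = add_cosets (quat_Im ` G) (quat_Im ` H)"
    by (simp add: f_def add_cosets_def image_image)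
  show "add_index (quat_Im ` G) (quat_Im ` H) = add_index G H"
    using add_index_via(2)[OF H(1) f] im by (simp add: add_index_def)
  show "finite (add_cosets (quat_Im ` G) (quat_Im ` H)) \<longleftrightarrow> finite (add_cosets G H)"
    using add_index_via(1)[OF H(1) f] im by simp
qed

lemma index_Im_idealizer:
  "add_index (quat_Im ` L) (quat_Im ` idealizer q) = add_index L (idealizer q)"
  "finite (add_cosets (quat_Im ` L) (quat_Im ` idealizer q)) \<longleftrightarrow> finite (add_cosets L (idealizer q))"
  by (rule index_Im[OF add_subgroup_L add_subgroup_idealizer idealizer_sub], rule scalar_idealizer, rule real_in_L, assumption)+

text \<open>The idealizer has finite index in \<open>L\<close> because it contains \<open>q L\<close>, and in the conjugate order
  \<open>G = q L q\<^sup>-\<^sup>1\<close> because it contains \<open>|q|\<^sup>2 G = q L qcnj(q)\<close>.\<close>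

lemma quat_rot_SOC:
  assumes q: "q \<in> L" "q \<noteq> 0"
  shows "quat_rot q \<in> SOC (quat_Im ` L)"
proof -
  define conj where "conj x = q * x * inverse q" for x
  have add_conj: "Modules.additive conj" by (simp add: Modules.additive_def conj_def distrib_left distrib_right)
  have inj_conj: "inj conj" using q(2) by (simp add: inj_on_def conj_def)
  define G where "G = conj ` L"
  have G: "add_subgroup G" unfolding G_def by (rule add_subgroup_image[OF add_conj add_subgroup_L])
  have SG: "idealizer q \<subseteq> G"
  proof
    fix x assume "x \<in> idealizer q"
    then have "x * q \<in> (*) q ` L" by (simp add: idealizer_def)
    then obtain y where y: "x * q = q * y" "y \<in> L" by (rule imageE)
    have "x = conj y" unfolding conj_def y(1)[symmetric] using q(2) by (simp add: mult.assoc)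
    then show "x \<in> G" unfolding G_def using y(2) by (rule image_eqI)
  qed
  have scalars: "c *\<^sub>R 1 \<in> idealizer q" if "c *\<^sub>R 1 \<in> G" for c
  proof -
    from that[unfolded G_def] obtain y where y: "c *\<^sub>R 1 = conj y" "y \<in> L" by (rule imageE)
    have "conj (c *\<^sub>R 1) = c *\<^sub>R 1" using q(2) by (simp add: conj_def)
    then have "conj (c *\<^sub>R 1) = conj y" using y(1) by simp
    then have "c *\<^sub>R 1 = y" using inj_conj by (simp only: inj_eq)
    then show ?thesis using y(2) by (intro scalar_idealizer real_in_L) simp
  qed
  let ?n = "qnr q"
  have n: "?n \<in> \<oo>" "?n \<noteq> 0" using q by (simp_all add: qnr_integral)
  have nG: "(*\<^sub>R) ?n ` G = conj ` (*\<^sub>R) ?n ` L"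
    by (simp add: G_def image_image conj_def)
  have nS: "(*\<^sub>R) ?n ` G \<subseteq> idealizer q"
  proof (intro image_subsetI)
    fix x assume "x \<in> G"
    then obtain y where y: "x = conj y" "y \<in> L" unfolding G_def by (rule imageE)
    have "?n *\<^sub>R inverse q = qcnj q" using q(2) by (simp add: inverse_quat_def)
    moreover have "?n *\<^sub>R x = q * y * (?n *\<^sub>R inverse q)" by (simp add: y(1) conj_def)
    ultimately have nx: "?n *\<^sub>R x = q * y * qcnj q" by (simp only:)
    have "(?n *\<^sub>R x) * q = q * (y * qcnj q * q)" unfolding nx by (simp add: mult.assoc)
    then have "(?n *\<^sub>R x) * q \<in> (*) q ` L" by (rule image_eqI) (intro L_mult L_qcnj q y)
    moreover have "?n *\<^sub>R x \<in> L" unfolding nx by (intro L_mult L_qcnj q y)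
    ultimately show "?n *\<^sub>R x \<in> idealizer q" by (simp add: idealizer_def)
  qed
  have "finite (add_cosets G ((*\<^sub>R) ?n ` G))"
    unfolding nG unfolding G_def add_index_image(2)[OF add_conj inj_conj add_subgroup_mult(3)] by (rule index_scalar(2)[OF n])
  then have "finite (add_cosets G (idealizer q))"
    by (rule finite_add_cosets_mono[OF _ subset_refl nS add_subgroup_image[OF additive_quat(3) G] add_subgroup_idealizer])
  then have fin1: "finite (add_cosets (quat_Im ` G) (quat_Im ` idealizer q))"
    using index_Im(2)[OF G add_subgroup_idealizer SG scalars] by simp
  have "finite (add_cosets L (idealizer q))"
    by (rule finite_add_cosets_mono[OF finite_index_left_mult[OF q] subset_refl right_ideal_idealizer[OF q(1)]
          add_subgroup_mult(1) add_subgroup_idealizer])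
  then have fin2: "finite (add_cosets (quat_Im ` L) (quat_Im ` idealizer q))"
    unfolding index_Im_idealizer(2) .
  have "(*v) (quat_rot q) ` quat_Im ` L = quat_Im ` G"
    unfolding quat_rot_image[OF q(2)] G_def conj_def ..
  then have "commensurate (quat_Im ` L) ((*v) (quat_rot q) ` quat_Im ` L)"
    using fin1 fin2 csm_idealizer[OF q] by (simp add: commensurate_def)
  then show ?thesis by (simp add: SOC_def rotation_matrix_quat_rot[OF q(2)])
qed

text \<open>Among the multiples of \<open>R v\<close>, two lie in the same of the finitely many cosets, so some positive
  multiple of \<open>R v\<close> is in \<open>\<Gamma>\<close>.\<close>

lemma SOC_multiple:
  assumes R: "R \<in> SOC (quat_Im ` L)" and x: "x \<in> L"
  obtains m :: nat and y where "m > 0" "y \<in> L" "of_nat m *\<^sub>R (R *v quat_Im x) = quat_Im y"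
proof -
  let ?\<Gamma> = "quat_Im ` L"
  let ?R\<Gamma> = "(*v) R ` ?\<Gamma>"
  have add_R: "Modules.additive ((*v) R)" by (simp add: Modules.additive_def matrix_vector_right_distrib)
  have sg: "add_subgroup (?\<Gamma> \<inter> ?R\<Gamma>)"
    by (intro add_subgroup_Int add_subgroup_image additive_quat_Im add_R add_subgroup_L)
  have fin: "finite (add_cosets ?R\<Gamma> (?\<Gamma> \<inter> ?R\<Gamma>))" using R by (simp add: SOC_def commensurate_def)
  define w where "w = R *v quat_Im x"
  define g where "g n = (+) (of_nat n *\<^sub>R w) ` (?\<Gamma> \<inter> ?R\<Gamma>)" for n :: nat
  have mem: "of_nat n *\<^sub>R w \<in> ?R\<Gamma>" for n
  proof -
    have "of_nat n *\<^sub>R w = R *v quat_Im (of_nat n *\<^sub>R x)"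
      by (simp add: w_def quat_Im_simps matrix_vector_mult_scaleR)
    moreover have "quat_Im (of_nat n *\<^sub>R x) \<in> ?\<Gamma>" by (intro imageI L_scale oo_of_nat x)
    ultimately show ?thesis by (rule image_eqI)
  qed
  have "range g \<subseteq> add_cosets ?R\<Gamma> (?\<Gamma> \<inter> ?R\<Gamma>)" using mem by (auto simp: g_def add_cosets_def)
  then have "finite (range g)" using fin by (rule finite_subset)
  then have "\<not> inj g" using finite_imageD infinite_UNIV_nat by blast
  then obtain i j where "i \<noteq> j" "g i = g j" by (auto simp: inj_on_def)
  then obtain i j where ij: "i < j" "g j = g i" by (metis linorder_neqE_nat)
  then have "of_nat j *\<^sub>R w - of_nat i *\<^sub>R w \<in> ?\<Gamma> \<inter> ?R\<Gamma>"
    by (simp add: g_def coset_eq_iff[OF sg])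
  moreover have "of_nat j *\<^sub>R w - of_nat i *\<^sub>R w = of_nat (j - i) *\<^sub>R w"
    using ij(1) by (simp add: of_nat_diff scaleR_diff_left)
  ultimately have "of_nat (j - i) *\<^sub>R w \<in> ?\<Gamma>" by simp
  then obtain y where "of_nat (j - i) *\<^sub>R w = quat_Im y" "y \<in> L" by (rule imageE)
  then show thesis using that[of "j - i" y] ij(1) by (simp add: w_def)
qed

text \<open>As \<open>\<Gamma>\<close> consists of vectors with coordinates in \<open>K\<close>, a coincidence rotation preserves such vectors.\<close>

lemma SOC_rational:
  assumes R: "R \<in> SOC (quat_Im ` L)" and x: "x \<in> \<H>"
  shows "rot_hom R x \<in> \<H>"
proof -
  obtain n :: nat where n: "n > 0" "of_nat n *\<^sub>R x \<in> L" by (rule L_denominator[OF x])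
  obtain m :: nat and y where m: "m > 0" "y \<in> L" "of_nat m *\<^sub>R (R *v quat_Im (of_nat n *\<^sub>R x)) = quat_Im y"
    by (rule SOC_multiple[OF R n(2)])
  define k where "k = inverse (of_nat m * of_nat n :: real)"
  have kK: "k \<in> K" unfolding k_def by (intro K_inverse K_mult K_of_nat)
  have "quat_Im y = (of_nat m * of_nat n) *\<^sub>R (R *v quat_Im x)"
    using m(3) by (simp add: quat_Im_simps matrix_vector_mult_scaleR)
  moreover have "k * (of_nat m * of_nat n) = 1" unfolding k_def using n(1) m(1) by (intro left_inverse) simp
  ultimately have "R *v quat_Im x = k *\<^sub>R quat_Im y" by (simp only: scaleR_scaleR scaleR_one)
  then have "rot_hom R x = q0 x *\<^sub>R 1 + k *\<^sub>R (y - q0 y *\<^sub>R 1)"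
    unfolding quat_eq_iff_Im rot_hom_sel by (simp add: quat_Im_simps)
  also have "\<dots> \<in> \<H>"
    using x L_H[OF m(2)] by (intro H_closed kK) (simp_all add: quat_alg_def)
  finally show ?thesis .
qed

lemma SOC_quat_rot:
  assumes R: "R \<in> SOC (quat_Im ` L)"
  obtains q where "q \<in> L" "q \<noteq> 0" "R = quat_rot q"
proof -
  have rot: "rotation_matrix R" using R by (simp add: SOC_def)
  have basis: "qi \<in> \<H>" "qj \<in> \<H>" "qk \<in> \<H>"
    by (simp_all add: qi_def qj_def qk_def quat_alg_def K_zero K_one)
  obtain p where p: "p \<in> {1, qi, qj, qk}" "rot_avg R p \<noteq> 0" using rot_avg_nonzero by blast
  have pH: "p \<in> \<H>" using p(1) basis H_closed(7) by auto
  have "rot_avg R p \<in> \<H>"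
    unfolding rot_avg_def by (intro H_closed SOC_rational[OF R] basis pH)
  then obtain m :: nat where m: "m > 0" "of_nat m *\<^sub>R rot_avg R p \<in> L" by (rule L_denominator)
  define q where "q = of_nat m *\<^sub>R rot_avg R p"
  have q: "q \<in> L" "q \<noteq> 0" using m p(2) by (simp_all add: q_def)
  have inter: "rot_hom R x * q = q * x" for x
    by (simp add: q_def rot_avg_intertwines[OF rot])
  have "R *v v = quat_rot q *v v" for v
  proof -
    have "rot_hom R (quat_pure v) = q * quat_pure v * inverse q"
      unfolding inter[symmetric] using q(2) by (simp add: mult.assoc)
    then have "quat_Im (rot_hom R (quat_pure v)) = quat_Im (quat_pure (quat_rot q *v v))"
      by (simp only: quat_rot_works)
    then show ?thesis by (simp only: rot_hom_sel quat_Im_simps)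
  qed
  then have "R = quat_rot q" by (simp add: matrix_eq)
  with q show thesis by (rule that)
qed

text \<open>The idealizer of \<open>q\<close> is \<open>{x \<in> L. x I \<subseteq> I}\<close> for \<open>I = q L\<close>; in this form it depends on the ideal only, not on
  the choice of a generator.\<close>

definition csm_of_ideal :: "quat set \<Rightarrow> (real^3) set" where
  "csm_of_ideal I = quat_Im ` {x \<in> L. \<forall>y\<in>I. x * y \<in> I}"

lemma csm_of_right_ideal:
  assumes q: "q \<in> L" "q \<noteq> 0"
  shows "csm_of_ideal ((*) q ` L) = quat_Im ` idealizer q"
    and "csm_of_ideal ((*) q ` L) = quat_Im ` L \<inter> (*v) (quat_rot q) ` quat_Im ` L"
proof -
  have "x * q \<in> (*) q ` L \<longleftrightarrow> (\<forall>y\<in>(*) q ` L. x * y \<in> (*) q ` L)" for x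
  proof
    assume "x * q \<in> (*) q ` L"
    then obtain z where z: "x * q = q * z" "z \<in> L" by (rule imageE)
    have "x * (q * y) = q * (z * y)" for y by (simp add: mult.assoc[symmetric] z(1))
    then show "\<forall>y\<in>(*) q ` L. x * y \<in> (*) q ` L" using L_mult[OF z(2)] by (simp add: imageI)
  next
    assume *: "\<forall>y\<in>(*) q ` L. x * y \<in> (*) q ` L"
    have "q * 1 \<in> (*) q ` L" using L_one by (rule imageI)
    from bspec[OF * this] show "x * q \<in> (*) q ` L" by simp
  qed
  then show "csm_of_ideal ((*) q ` L) = quat_Im ` idealizer q"
    by (simp add: csm_of_ideal_def idealizer_def)
  then show "csm_of_ideal ((*) q ` L) = quat_Im ` L \<inter> (*v) (quat_rot q) ` quat_Im ` L"
    unfolding csm_idealizer[OF q] .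
qed

text \<open>The idealizer contains all integral scalars, so it is saturated for the map \<open>Im\<close> on \<open>L\<close>.\<close>

lemma idealizer_from_Im: "idealizer q = {x \<in> L. quat_Im x \<in> quat_Im ` idealizer q}"
proof (intro subset_antisym subsetI)
  fix x assume "x \<in> idealizer q"
  then show "x \<in> {x \<in> L. quat_Im x \<in> quat_Im ` idealizer q}" using idealizer_sub by auto
next
  fix x assume "x \<in> {x \<in> L. quat_Im x \<in> quat_Im ` idealizer q}"
  then have x: "x \<in> L" "quat_Im x \<in> quat_Im ` idealizer q" by simp_all
  from x(2) obtain h where h: "quat_Im x = quat_Im h" "h \<in> idealizer q" by (rule imageE)
  define c where "c = q0 x - q0 h"
  have c: "x - h = c *\<^sub>R 1" using h(1) unfolding quat_Im_eq_iff c_def .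
  have "h \<in> L" using idealizer_sub h(2) by (rule subsetD)
  then have "c *\<^sub>R 1 \<in> L" unfolding c[symmetric] by (rule L_diff[OF x(1)])
  then have "x - h \<in> idealizer q" unfolding c by (intro scalar_idealizer real_in_L)
  then have "x - h + h \<in> idealizer q" using h(2) by (rule add_subgroup_add[OF add_subgroup_idealizer])
  then show "x \<in> idealizer q" by simp
qed

text \<open>Injectivity recovers from the module first the idealizer and then the right ideal. Surjectivity
  writes a coincidence rotation as \<open>R\<^sub>q\<close> and passes to the reduced factor of \<open>q\<close>.\<close>

lemma csm_bijection:
  "bij_betw csm_of_ideal ((\<lambda>q. (*) q ` L) ` {q. order_reduced L q}) (CSMs (quat_Im ` L))"
  unfolding bij_betw_def
proof (intro conjI)
  show "inj_on csm_of_ideal ((\<lambda>q. (*) q ` L) ` {q. order_reduced L q})"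
  proof (intro inj_onI)
    fix I J
    assume "I \<in> (\<lambda>q. (*) q ` L) ` {q. order_reduced L q}" "J \<in> (\<lambda>q. (*) q ` L) ` {q. order_reduced L q}"
      and eq: "csm_of_ideal I = csm_of_ideal J"
    then obtain p q where p: "order_reduced L p" "I = (*) p ` L" and q: "order_reduced L q" "J = (*) q ` L"
      by blast
    have "quat_Im ` idealizer p = quat_Im ` idealizer q"
      using eq p q csm_of_right_ideal(1)[of p] csm_of_right_ideal(1)[of q] by (simp add: order_reduced_iff)
    then have "idealizer p = idealizer q"
      using idealizer_from_Im[of p] idealizer_from_Im[of q] by simp
    then show "I = J"
      unfolding p(2) q(2) right_ideal_from_idealizer[OF p(1)] right_ideal_from_idealizer[OF q(1)] by simp
  qed
  show "csm_of_ideal ` (\<lambda>q. (*) q ` L) ` {q. order_reduced L q} = CSMs (quat_Im ` L)"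
  proof (intro subset_antisym subsetI)
    fix C assume "C \<in> csm_of_ideal ` (\<lambda>q. (*) q ` L) ` {q. order_reduced L q}"
    then obtain q where q: "order_reduced L q" "C = csm_of_ideal ((*) q ` L)" by blast
    then have q': "q \<in> L" "q \<noteq> 0" by (simp_all add: order_reduced_iff)
    show "C \<in> CSMs (quat_Im ` L)"
      unfolding CSMs_def q(2) csm_of_right_ideal(2)[OF q'] using quat_rot_SOC[OF q'] by (rule imageI)
  next
    fix C assume "C \<in> CSMs (quat_Im ` L)"
    then obtain R where R: "R \<in> SOC (quat_Im ` L)" "C = quat_Im ` L \<inter> (*v) R ` quat_Im ` L"
      unfolding CSMs_def by blast
    obtain q where q: "q \<in> L" "q \<noteq> 0" "R = quat_rot q" by (rule SOC_quat_rot[OF R(1)])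
    obtain b where b: "order_reduced L b" "(\<lambda>x. q * x * inverse q) ` L = (\<lambda>x. b * x * inverse b) ` L"
      by (rule reduced_factor[OF q(1,2)])
    have b': "b \<in> L" "b \<noteq> 0" using b(1) by (simp_all add: order_reduced_iff)
    have "C = csm_of_ideal ((*) b ` L)"
      unfolding R(2) q(3) csm_of_right_ideal(2)[OF b'] quat_rot_image[OF q(2)] quat_rot_image[OF b'(2)] b(2) ..
    then show "C \<in> csm_of_ideal ` (\<lambda>q. (*) q ` L) ` {q. order_reduced L q}" using b(1) by blast
  qed
qed

lemma csm_index:
  assumes "order_reduced L q"
  shows "real (add_index (quat_Im ` L) (quat_Im ` L \<inter> (*v) (quat_rot q) ` quat_Im ` L)) = abs_norm K (qnr q)"
    and "real (add_index L ((*) q ` L)) = abs_norm K ((qnr q)\<^sup>2)"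
proof -
  have q: "q \<in> L" "q \<noteq> 0" using assms by (simp_all add: order_reduced_iff)
  have n: "qnr q \<in> \<oo>" "qnr q \<noteq> 0" using q by (simp_all add: qnr_integral)
  show "real (add_index (quat_Im ` L) (quat_Im ` L \<inter> (*v) (quat_rot q) ` quat_Im ` L)) = abs_norm K (qnr q)"
    unfolding csm_idealizer[OF q] index_Im_idealizer(1) index_idealizer(1)[OF assms] by (rule index_principal(2)[OF n])
  show "real (add_index L ((*) q ` L)) = abs_norm K ((qnr q)\<^sup>2)"
    unfolding index_left_mult[OF q] of_nat_power index_principal(2)[OF n]
    by (simp add: power2_eq_square abs_norm_mult[OF oo_K[OF n(1)] oo_K[OF n(1)]])
qed

end

text \<open>The square root in the last equation is that of \<open>N(|q|\<^sup>4) = N(|q|\<^sup>2)\<^sup>2\<close>.\<close>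

theorem theorem1:
  fixes K :: "real set" and \<O> :: "quat set" and \<Gamma> :: "(real^3) set"
  assumes "real_number_field K"
    and "field_class_number K = 1"
    and "has_quat_class_number K 1"
    and "maximal_order K \<O>"
    and "\<Gamma> = quat_Im ` \<O>"
  shows "(\<exists>f. bij_betw f ((\<lambda>q. (*) q ` \<O>) ` {q. order_reduced \<O> q}) (CSMs \<Gamma>) \<and>
            (\<forall>q. order_reduced \<O> q \<longrightarrow> f ((*) q ` \<O>) = \<Gamma> \<inter> (*v) (quat_rot q) ` \<Gamma>)) \<and>
         (\<forall>q. order_reduced \<O> q \<longrightarrow>
            real (add_index \<Gamma> (\<Gamma> \<inter> (*v) (quat_rot q) ` \<Gamma>)) = abs_norm K (qnr q) \<and>
            real (add_index \<O> ((*) q ` \<O>)) = abs_norm K ((qnr q)\<^sup>2) \<and>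
            real (add_index \<Gamma> (\<Gamma> \<inter> (*v) (quat_rot q) ` \<Gamma>)) =
              sqrt (real (add_index \<O> ((*) q ` \<O>))))"
proof -
  interpret maximal_order_class_one K \<O>
    by unfold_locales (fact assms)+
  have csm: "csm_of_ideal ((*) q ` \<O>) = \<Gamma> \<inter> (*v) (quat_rot q) ` \<Gamma>" if "order_reduced \<O> q" for q
    unfolding assms(5) using that by (intro csm_of_right_ideal(2)) (simp_all add: order_reduced_iff)
  have idx: "real (add_index \<Gamma> (\<Gamma> \<inter> (*v) (quat_rot q) ` \<Gamma>)) = abs_norm K (qnr q)"
    "real (add_index \<O> ((*) q ` \<O>)) = abs_norm K ((qnr q)\<^sup>2)" if "order_reduced \<O> q" for q
    unfolding assms(5) using csm_index[OF that] by simp_all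
  have root: "abs_norm K (qnr q) = sqrt (abs_norm K ((qnr q)\<^sup>2))" if "order_reduced \<O> q" for q
  proof -
    have "q \<in> \<O>" using that by (simp add: order_reduced_iff)
    then have "qnr q \<in> K" by (intro oo_K qnr_integral)
    then have "abs_norm K (qnr q * qnr q) = abs_norm K (qnr q) * abs_norm K (qnr q)" by (intro abs_norm_mult)
    moreover have "abs_norm K (qnr q) \<ge> 0" by (simp add: abs_norm_def)
    ultimately show ?thesis by (simp add: power2_eq_square)
  qed
  show ?thesis
  proof (intro conjI exI[of _ csm_of_ideal] allI impI)
    show "bij_betw csm_of_ideal ((\<lambda>q. (*) q ` \<O>) ` {q. order_reduced \<O> q}) (CSMs \<Gamma>)"
      unfolding assms(5) by (rule csm_bijection)
    fix q assume red: "order_reduced \<O> q"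
    show "csm_of_ideal ((*) q ` \<O>) = \<Gamma> \<inter> (*v) (quat_rot q) ` \<Gamma>" by (rule csm[OF red])
    show "real (add_index \<Gamma> (\<Gamma> \<inter> (*v) (quat_rot q) ` \<Gamma>)) = abs_norm K (qnr q)"
      "real (add_index \<O> ((*) q ` \<O>)) = abs_norm K ((qnr q)\<^sup>2)" by (rule idx[OF red])+
    show "real (add_index \<Gamma> (\<Gamma> \<inter> (*v) (quat_rot q) ` \<Gamma>)) = sqrt (real (add_index \<O> ((*) q ` \<O>)))"
      unfolding idx[OF red] by (rule root[OF red])
  qed
qed

end
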